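(* Let $L$ be a link. Let $(B,X,\underline{*},\overline{*},* )$ be a shadow biquandle such that $X$ is strongly connected, and let $(X,\{\underline{\star}\},\{\overline{\star}\})$ be the corresponding local biquandle of $(B,X)$. Let $\mu_2:C_2^{\rm SB}(B,X)\to C_2^{\rm LB}(X)$ be the bijective chain map given by $\mu_2\big((x,a_1,a_2)\big)=\big((x,x*a_1),(x,x*a_2)\big)$, and let $\mu_2^*:H_2^{\rm SB}(B,X)\to H_2^{\rm LB}(X)$ be the induced isomorphism. Then, as multisets, $$\mathcal{H}^{\rm LB}(L)=\mu_2^*\big(\mathcal{H}^{\rm SB}(L)\big)\quad\text{and}\quad(\mu_2^* )^{-1}\big(\mathcal{H}^{\rm LB}(L)\big)=\mathcal{H}^{\rm SB}(L).$$ Moreover, for an abelian group $A$, let $\theta\in Z^2_{\rm SB}(B,X;A)$ and $\theta'\in Z^2_{\rm LB}(X;A)$ be such that $\theta=\theta'\circ\mu_2$. Then $$\Phi_\theta^{\rm SB}(L)=\Phi_{\theta'}^{\rm LB}(L).$$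
   Context: A biquandle is a set $B$ with binary operations $\underline{*},\overline{*}:B\times B\to B$ such that: (i) $a\,\underline{*}\,a=a\,\overline{*}\,a$ for all $a\in B$; (ii) for every $b\in B$ the maps $B\to B$, $a\mapsto a\,\underline{*}\,b$ and $a\mapsto a\,\overline{*}\,b$ are bijective, and the map $S:B\times B\to B\times B$, $S(a,b)=(b\,\overline{*}\,a,\;a\,\underline{*}\,b)$ is bijective; (iii) for all $a,b,c\in B$: $(a\underline{*}b)\underline{*}(c\underline{*}b)=(a\underline{*}c)\underline{*}(b\overline{*}c)$, $(a\underline{*}b)\overline{*}(c\underline{*}b)=(a\overline{*}c)\underline{*}(b\overline{*}c)$, $(a\overline{*}b)\overline{*}(c\overline{*}b)=(a\overline{*}c)\overline{*}(b\underline{*}c)$. A $B$-set is a set $X$ with a map $*:X\times B\to X$ such that for each $a\in B$ the map $X\to X$, $x\mapsto x*a$ is bijective, and $(x*a)*(b\,\overline{*}\,a)=(x*b)*(a\,\underline{*}\,b)$ for all $a,b\in B$, $x\in X$. A shadow biquandle $(B,X,\underline{*},\overline{*},* )$ is a pair of a biquandle $B$ and a $B$-set $X$. A $B$-set $X$ is strongly connected if for every $x\in X$ the map $B\to X$, $a\mapsto x*a$ is bijective; then for $x,y\in X$, $x\searrow y\in B$ denotes the unique element $a\in B$ with $x*a=y$. A horizontal-tribracket on a set $X$ is a ternary operation $[\,]:X^3\to X$ such that: (H1) in the equation $[x,y,z]=w$, any three of $x,y,z,w$ that include $w$ determine the remaining one uniquely (and it exists); (H2) $[y,[x,y,z],[x,y,w]]=[z,[x,y,z],[x,z,w]]=[w,[x,y,w],[x,z,w]]$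 for all $x,y,z,w\in X$. The local biquandle associated with $(X,[\,])$ consists of the operations, for each $x\in X$, $\underline{\star}_x,\overline{\star}_x:(\{x\}\times X)^2\to X^2$, $(x,y)\,\underline{\star}_x\,(x,z)=(z,[x,y,z])$, $(x,y)\,\overline{\star}_x\,(x,z)=(z,[x,z,y])$ (subscripts omitted). For a shadow biquandle $(B,X)$ with $X$ strongly connected, the corresponding horizontal-tribracket is $[x,y,z]=y*\big((x\searrow z)\overline{*}(x\searrow y)\big)=z*\big((x\searrow y)\underline{*}(x\searrow z)\big)$ (it is known that the two expressions agree and define a horizontal-tribracket), and the corresponding local biquandle of $(B,X)$ is the local biquandle associated with it. Chain complexes. $C_n^{\rm sb}(B,X)$ is the free $\mathbb{Z}$-module on $X\times B^n$ if $n\ge 1$ and $0$ otherwise, with $$\partial_n^{\rm sb}(x,a_1,\dots,a_n)=\sum_{i=1}^n(-1)^i\big\{(x,a_1,\dots,a_{i-1},a_{i+1},\dots,a_n)-(x*a_i,a_1\underline{*}a_i,\dots,a_{i-1}\underline{*}a_i,a_{i+1}\overline{*}a_i,\dots,a_n\overline{*}a_i)\big\}$$ for $n\ge 2$ and $0$ for $n\le 1$; $D_n^{\rm sb}(B,X)$ is the submodule generated by the $(x,a_1,\dots,a_n)$ with $a_i=a_{i+1}$ for some $i$; $C_n^{\rm SB}=C_n^{\rm sb}/D_n^{\rm sb}$ with induced boundary. $C_n^{\rm lb}(X)$ is the free $\mathbb{Z}$-module on $\{((x,y_1),\dots,(x,y_n)) : x,y_1,\dots,y_n\in X\}$ if $n\ge1$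 and $0$ otherwise, with $$\partial_n^{\rm lb}\big((x,y_1),\dots,(x,y_n)\big)=\sum_{i=1}^n(-1)^i\big\{\big((x,y_1),\dots,(x,y_{i-1}),(x,y_{i+1}),\dots,(x,y_n)\big)-\big((x,y_1)\underline{\star}(x,y_i),\dots,(x,y_{i-1})\underline{\star}(x,y_i),(x,y_{i+1})\overline{\star}(x,y_i),\dots,(x,y_n)\overline{\star}(x,y_i)\big)\big\}$$ for $n\ge2$ and $0$ otherwise; $D_n^{\rm lb}(X)$ is the submodule generated by the $((x,y_1),\dots,(x,y_n))$ with $y_i=y_{i+1}$ for some $i$; $C_n^{\rm LB}=C_n^{\rm lb}/D_n^{\rm lb}$ with induced boundary. $H_n^{\rm SB}(B,X)$, $H_n^{\rm LB}(X)$ are the homology groups; $Z^n_{\rm SB}(B,X;A)$, $Z^n_{\rm LB}(X;A)$ are the groups of $n$-cocycles, i.e. homomorphisms $f$ from $C_n^{\rm SB}(B,X)$, respectively $C_n^{\rm LB}(X)$, to $A$ with $f\circ\partial_{n+1}=0$. Diagrams. Links are oriented links in $\mathbb{R}^3$; a diagram $D$ is a regular projection to $\mathbb{R}^2$ with over/under information. A diagram is connected if it is connected as a subset of the plane. $\mathcal{SA}(D)$ is the set of semi-arcs (connected components of $D$ after removing small neighborhoods of the crossings), $\mathcal{R}(D)$ the set of connected components of $\mathbb{R}^2\setminus D$. Each semi-arc $s$ has a normal vector $n_s$ such that (orientation of $D$, $n_s$) is the right-handed orientation of $\mathbb{R}^2$. At a crossing, $r$ denotes the region from which the normal vectors of both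 strands point away, $u_1$ and $o_1$ the under- and over-semi-arcs adjacent to $r$, and $u_2$, $o_2$ the other under- and over-semi-arcs. ${\rm sign}(\chi)=\pm1$ is the usual sign of a crossing $\chi$. Shadow biquandle colorings. A $(B,X)$-coloring of $D$ is a map $C:\mathcal{SA}(D)\cup\mathcal{R}(D)\to B\cup X$ with $C(\mathcal{SA}(D))\subset B$, $C(\mathcal{R}(D))\subset X$, such that at each crossing $C(u_2)=C(u_1)\underline{*}C(o_1)$ and $C(o_2)=C(o_1)\overline{*}C(u_1)$, and for each semi-arc $s$ whose normal vector points from region $r_1$ to region $r_2$, $C(r_1)*C(s)=C(r_2)$. The set of them is ${\rm Col}^{\rm SB}_{(B,X)}(D)$. Put $W^{\rm SB}(D,C)=\sum_\chi{\rm sign}(\chi)\,(C(r),C(u_1),C(o_1))\in C_2^{\rm SB}(B,X)$, the sum over all crossings $\chi$ of $D$. Local biquandle colorings. An $X^2$-coloring of $D$ is a map $C:\mathcal{SA}(D)\to X^2$ such that at each crossing $C(u_1)$ and $C(o_1)$ have the same first component, say $C(u_1)=(x,y)$, $C(o_1)=(x,z)$, and $C(u_2)=(x,y)\underline{\star}(x,z)=(z,[x,y,z])$, $C(o_2)=(x,z)\overline{\star}(x,y)=(y,[x,y,z])$. The set of them is ${\rm Col}^{\rm LB}_{X^2}(D)$. Put $W^{\rm LB}(D,C)=\sum_\chi{\rm sign}(\chi)\,(C(u_1),C(o_1))\in C_2^{\rm LB}(X)$. Invariants (multisets). For a connected diagram $D$ of $L$: $\mathcal{H}^{\rm SB}(L)=\{[W^{\rm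 SB}(D,C)]\in H_2^{\rm SB}(B,X) : C\in{\rm Col}^{\rm SB}_{(B,X)}(D)\}$, $\Phi_\theta^{\rm SB}(L)=\{\theta(W^{\rm SB}(D,C))\in A : C\in{\rm Col}^{\rm SB}_{(B,X)}(D)\}$, $\mathcal{H}^{\rm LB}(L)=\{[W^{\rm LB}(D,C)]\in H_2^{\rm LB}(X) : C\in{\rm Col}^{\rm LB}_{X^2}(D)\}$, $\Phi_{\theta'}^{\rm LB}(L)=\{\theta'(W^{\rm LB}(D,C))\in A : C\in{\rm Col}^{\rm LB}_{X^2}(D)\}$. It is known that these do not depend on the choice of connected diagram $D$ of $L$. Isomorphisms are applied to multisets elementwise. *)

theory Defs
  imports "HOL-Analysis.Analysis" "HOL-Algebra.Free_Abelian_Groups" "HOL-Library.Equipollence"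
begin

section \<open>Multisets\<close>

text \<open>The biquandles below may be infinite, so multiplicities may be infinite cardinals and
  the type \<open>multiset\<close> does not apply.  A multiset is given as an indexed family;
  two families are equal as multisets if every element has the same (cardinal) multiplicity
  in both.\<close>

type_synonym ('i, 'a) family = "'i set \<times> ('i \<Rightarrow> 'a)"

definition fibre :: "('i, 'a) family \<Rightarrow> 'a \<Rightarrow> 'i set" where
  "fibre M a = {i \<in> fst M. snd M i = a}"

definition mset_eq :: "('i, 'a) family \<Rightarrow> ('j, 'a) family \<Rightarrow> bool"  (infix \<open>=\<^sub>m\<close> 50) where
  "M =\<^sub>m N \<longleftrightarrow> (\<forall>a. fibre M a \<approx> fibre N a)"

definition mset_map :: "('a \<Rightarrow> 'b) \<Rightarrow> ('i, 'a) family \<Rightarrow> ('i, 'b) family" where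
  "mset_map h M = (fst M, h \<circ> snd M)"


section \<open>Shadow biquandles and local biquandles\<close>

text \<open>\<open>us a b\<close> and \<open>os a b\<close> are the operations with the under- and the overlined star.\<close>

definition biquandle :: "'b set \<Rightarrow> ('b \<Rightarrow> 'b \<Rightarrow> 'b) \<Rightarrow> ('b \<Rightarrow> 'b \<Rightarrow> 'b) \<Rightarrow> bool" where
  "biquandle B us os \<longleftrightarrow>
     (\<forall>a\<in>B. \<forall>b\<in>B. us a b \<in> B \<and> os a b \<in> B) \<and>
     (\<forall>a\<in>B. us a a = os a a) \<and>
     (\<forall>b\<in>B. bij_betw (\<lambda>a. us a b) B B \<and> bij_betw (\<lambda>a. os a b) B B) \<and>
     bij_betw (\<lambda>(a, b). (os b a, us a b)) (B \<times> B) (B \<times> B) \<and>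
     (\<forall>a\<in>B. \<forall>b\<in>B. \<forall>c\<in>B.
        us (us a b) (us c b) = us (us a c) (os b c) \<and>
        os (us a b) (us c b) = us (os a c) (os b c) \<and>
        os (os a b) (os c b) = os (os a c) (us b c))"

definition biquandle_set ::
  "'b set \<Rightarrow> ('b \<Rightarrow> 'b \<Rightarrow> 'b) \<Rightarrow> ('b \<Rightarrow> 'b \<Rightarrow> 'b) \<Rightarrow> 'x set \<Rightarrow> ('x \<Rightarrow> 'b \<Rightarrow> 'x) \<Rightarrow> bool" where
  "biquandle_set B us os X act \<longleftrightarrow>
     (\<forall>a\<in>B. bij_betw (\<lambda>x. act x a) X X) \<and>
     (\<forall>a\<in>B. \<forall>b\<in>B. \<forall>x\<in>X. act (act x a) (os b a) = act (act x b) (us a b))"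

definition shadow_biquandle ::
  "'b set \<Rightarrow> ('b \<Rightarrow> 'b \<Rightarrow> 'b) \<Rightarrow> ('b \<Rightarrow> 'b \<Rightarrow> 'b) \<Rightarrow> 'x set \<Rightarrow> ('x \<Rightarrow> 'b \<Rightarrow> 'x) \<Rightarrow> bool" where
  "shadow_biquandle B us os X act \<longleftrightarrow> biquandle B us os \<and> biquandle_set B us os X act"

definition strongly_connected :: "'b set \<Rightarrow> 'x set \<Rightarrow> ('x \<Rightarrow> 'b \<Rightarrow> 'x) \<Rightarrow> bool" where
  "strongly_connected B X act \<longleftrightarrow> (\<forall>x\<in>X. bij_betw (act x) B X)"

text \<open>\<open>searrow B act x y\<close> is the element \<open>x \<searrow> y\<close> of \<open>B\<close>.\<close>

definition searrow :: "'b set \<Rightarrow> ('x \<Rightarrow> 'b \<Rightarrow> 'x) \<Rightarrow> 'x \<Rightarrow> 'x \<Rightarrow> 'b" where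
  "searrow B act x y = (THE a. a \<in> B \<and> act x a = y)"

definition shadow_bracket ::
  "'b set \<Rightarrow> ('b \<Rightarrow> 'b \<Rightarrow> 'b) \<Rightarrow> ('x \<Rightarrow> 'b \<Rightarrow> 'x) \<Rightarrow> 'x \<Rightarrow> 'x \<Rightarrow> 'x \<Rightarrow> 'x" where
  "shadow_bracket B os act x y z = act y (os (searrow B act x z) (searrow B act x y))"

lemma searrow_props:
  assumes "strongly_connected B X act" "x \<in> X" "y \<in> X"
  shows "searrow B act x y \<in> B" "act x (searrow B act x y) = y"
proof -
  have b: "bij_betw (act x) B X"
    using assms by (simp add: strongly_connected_def)
  have "\<exists>!a. a \<in> B \<and> act x a = y"
  proof (rule ex_ex1I)
    have "y \<in> act x ` B"
      using b assms(3) by (simp add: bij_betw_def)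
    then show "\<exists>a. a \<in> B \<and> act x a = y"
      by (elim imageE) auto
  next
    fix a a' assume "a \<in> B \<and> act x a = y" "a' \<in> B \<and> act x a' = y"
    then show "a = a'"
      using inj_onD[OF bij_betw_imp_inj_on[OF b]] by simp
  qed
  from theI'[OF this]
  have "searrow B act x y \<in> B \<and> act x (searrow B act x y) = y"
    by (simp only: searrow_def)
  then show "searrow B act x y \<in> B" "act x (searrow B act x y) = y"
    by simp_all
qed

lemma shadow_bracket_alt:
  assumes "shadow_biquandle B us os X act" "strongly_connected B X act" "x \<in> X" "y \<in> X" "z \<in> X"
  shows "shadow_bracket B os act x y z
           = act z (us (searrow B act x y) (searrow B act x z))"
proof -
  let ?a = "searrow B act x y" and ?b = "searrow B act x z"
  have "\<forall>a\<in>B. \<forall>b\<in>B. \<forall>x\<in>X. act (act x a) (os b a) = act (act x b) (us a b)"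
    using assms(1) by (simp add: shadow_biquandle_def biquandle_set_def)
  then have "act (act x ?a) (os ?b ?a) = act (act x ?b) (us ?a ?b)"
    using assms(3) searrow_props(1)[OF assms(2,3,4)] searrow_props(1)[OF assms(2,3,5)] by blast
  then show ?thesis
    by (simp only: shadow_bracket_def searrow_props(2)[OF assms(2,3,4)] searrow_props(2)[OF assms(2,3,5)])
qed

text \<open>The operations of the local biquandle of a horizontal-tribracket \<open>br\<close>.  They are only meant
  to be applied to pairs with the same first component.\<close>

definition lb_under :: "('x \<Rightarrow> 'x \<Rightarrow> 'x \<Rightarrow> 'x) \<Rightarrow> 'x \<times> 'x \<Rightarrow> 'x \<times> 'x \<Rightarrow> 'x \<times> 'x" where
  "lb_under br p q = (snd q, br (fst p) (snd p) (snd q))"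

definition lb_over :: "('x \<Rightarrow> 'x \<Rightarrow> 'x \<Rightarrow> 'x) \<Rightarrow> 'x \<times> 'x \<Rightarrow> 'x \<times> 'x \<Rightarrow> 'x \<times> 'x" where
  "lb_over br p q = (snd q, br (fst p) (snd q) (snd p))"


section \<open>Quotients of free abelian groups, homology\<close>

text \<open>\<open>free_quot S T\<close> is the free abelian group on \<open>S\<close> modulo the subgroup generated by \<open>T\<close>
  (a subset of \<open>S\<close>), \<open>quot_cls S T c\<close> the class of \<open>c\<close>, and \<open>quot_map S' T' h\<close> the map into
  \<open>free_quot S' T'\<close> induced by the map \<open>h\<close> on representatives.\<close>

definition quot_sub :: "'a set \<Rightarrow> 'a set \<Rightarrow> ('a \<Rightarrow>\<^sub>0 int) set" where
  "quot_sub S T = generate (free_Abelian_group S) (frag_of ` T)"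

definition free_quot :: "'a set \<Rightarrow> 'a set \<Rightarrow> ('a \<Rightarrow>\<^sub>0 int) set monoid" where
  "free_quot S T = free_Abelian_group S Mod quot_sub S T"

definition quot_cls :: "'a set \<Rightarrow> 'a set \<Rightarrow> ('a \<Rightarrow>\<^sub>0 int) \<Rightarrow> ('a \<Rightarrow>\<^sub>0 int) set" where
  "quot_cls S T c = quot_sub S T #>\<^bsub>free_Abelian_group S\<^esub> c"

definition quot_map ::
  "'c set \<Rightarrow> 'c set \<Rightarrow> (('a \<Rightarrow>\<^sub>0 int) \<Rightarrow> ('c \<Rightarrow>\<^sub>0 int)) \<Rightarrow> ('a \<Rightarrow>\<^sub>0 int) set \<Rightarrow> ('c \<Rightarrow>\<^sub>0 int) set" where
  "quot_map S' T' h U = the_elem ((\<lambda>c. quot_cls S' T' (h c)) ` U)"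

text \<open>Homology at \<open>G\<close> of \<open>F \<rightarrow> G \<rightarrow> H\<close> with maps \<open>d\<close> and \<open>e\<close>.\<close>

definition cycles :: "('a, 'm) monoid_scheme \<Rightarrow> ('c, 'n) monoid_scheme \<Rightarrow> ('a \<Rightarrow> 'c)
    \<Rightarrow> ('a, 'm) monoid_scheme" where
  "cycles G H e = G\<lparr>carrier := kernel G H e\<rparr>"

definition homology :: "('f, 'k) monoid_scheme \<Rightarrow> ('f \<Rightarrow> 'a) \<Rightarrow> ('a, 'm) monoid_scheme
    \<Rightarrow> ('a \<Rightarrow> 'c) \<Rightarrow> ('c, 'n) monoid_scheme \<Rightarrow> 'a set monoid" where
  "homology F d G e H = cycles G H e Mod (d ` carrier F)"

definition homology_cls :: "('f, 'k) monoid_scheme \<Rightarrow> ('f \<Rightarrow> 'a) \<Rightarrow> ('a, 'm) monoid_scheme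
    \<Rightarrow> 'a \<Rightarrow> 'a set" where
  "homology_cls F d G w = (d ` carrier F) #>\<^bsub>G\<^esub> w"


section \<open>The shadow biquandle complex\<close>

text \<open>The basis element \<open>(x, a\<^sub>1, \<dots>, a\<^sub>n)\<close> is \<open>(x, [a\<^sub>1, \<dots>, a\<^sub>n])\<close>; list positions start at \<open>0\<close>,
  whence the sign \<open>(- 1) ^ Suc i\<close>.\<close>

definition sb_basis :: "'b set \<Rightarrow> 'x set \<Rightarrow> nat \<Rightarrow> ('x \<times> 'b list) set" where
  "sb_basis B X n = {(x, as). n \<ge> 1 \<and> x \<in> X \<and> as \<in> lists B \<and> length as = n}"

definition sb_degen :: "'b set \<Rightarrow> 'x set \<Rightarrow> nat \<Rightarrow> ('x \<times> 'b list) set" where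
  "sb_degen B X n = {(x, as) \<in> sb_basis B X n. \<exists>i. Suc i < n \<and> as ! i = as ! Suc i}"

definition sb_bd_basis :: "('b \<Rightarrow> 'b \<Rightarrow> 'b) \<Rightarrow> ('b \<Rightarrow> 'b \<Rightarrow> 'b) \<Rightarrow> ('x \<Rightarrow> 'b \<Rightarrow> 'x)
    \<Rightarrow> 'x \<times> 'b list \<Rightarrow> ('x \<times> 'b list) \<Rightarrow>\<^sub>0 int" where
  "sb_bd_basis us os act = (\<lambda>(x, as).
     if length as \<ge> 2 then
       (\<Sum>i<length as. frag_cmul ((- 1) ^ Suc i)
          (frag_of (x, take i as @ drop (Suc i) as)
           - frag_of (act x (as ! i),
               map (\<lambda>a. us a (as ! i)) (take i as) @ map (\<lambda>a. os a (as ! i)) (drop (Suc i) as))))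
     else 0)"

definition C_SB :: "'b set \<Rightarrow> 'x set \<Rightarrow> nat \<Rightarrow> (('x \<times> 'b list) \<Rightarrow>\<^sub>0 int) set monoid" where
  "C_SB B X n = free_quot (sb_basis B X n) (sb_degen B X n)"

text \<open>\<open>bd_SB B us os X act n\<close> is the boundary from \<open>C_SB B X n\<close> to \<open>C_SB B X (n - 1)\<close>.\<close>

definition bd_SB :: "'b set \<Rightarrow> ('b \<Rightarrow> 'b \<Rightarrow> 'b) \<Rightarrow> ('b \<Rightarrow> 'b \<Rightarrow> 'b) \<Rightarrow> 'x set \<Rightarrow> ('x \<Rightarrow> 'b \<Rightarrow> 'x)
    \<Rightarrow> nat \<Rightarrow> (('x \<times> 'b list) \<Rightarrow>\<^sub>0 int) set \<Rightarrow> (('x \<times> 'b list) \<Rightarrow>\<^sub>0 int) set" where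
  "bd_SB B us os X act n =
     quot_map (sb_basis B X (n - 1)) (sb_degen B X (n - 1)) (frag_extend (sb_bd_basis us os act))"

definition H_SB :: "'b set \<Rightarrow> ('b \<Rightarrow> 'b \<Rightarrow> 'b) \<Rightarrow> ('b \<Rightarrow> 'b \<Rightarrow> 'b) \<Rightarrow> 'x set \<Rightarrow> ('x \<Rightarrow> 'b \<Rightarrow> 'x)
    \<Rightarrow> nat \<Rightarrow> (('x \<times> 'b list) \<Rightarrow>\<^sub>0 int) set set monoid" where
  "H_SB B us os X act n =
     homology (C_SB B X (Suc n)) (bd_SB B us os X act (Suc n)) (C_SB B X n)
       (bd_SB B us os X act n) (C_SB B X (n - 1))"

definition cls_SB :: "'b set \<Rightarrow> ('b \<Rightarrow> 'b \<Rightarrow> 'b) \<Rightarrow> ('b \<Rightarrow> 'b \<Rightarrow> 'b) \<Rightarrow> 'x set \<Rightarrow> ('x \<Rightarrow> 'b \<Rightarrow> 'x)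
    \<Rightarrow> nat \<Rightarrow> (('x \<times> 'b list) \<Rightarrow>\<^sub>0 int) set \<Rightarrow> (('x \<times> 'b list) \<Rightarrow>\<^sub>0 int) set set" where
  "cls_SB B us os X act n =
     homology_cls (C_SB B X (Suc n)) (bd_SB B us os X act (Suc n)) (C_SB B X n)"

definition Z_SB :: "'b set \<Rightarrow> ('b \<Rightarrow> 'b \<Rightarrow> 'b) \<Rightarrow> ('b \<Rightarrow> 'b \<Rightarrow> 'b) \<Rightarrow> 'x set \<Rightarrow> ('x \<Rightarrow> 'b \<Rightarrow> 'x)
    \<Rightarrow> nat \<Rightarrow> ('a, 'm) monoid_scheme \<Rightarrow> ((('x \<times> 'b list) \<Rightarrow>\<^sub>0 int) set \<Rightarrow> 'a) set" where
  "Z_SB B us os X act n A =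
     {f \<in> hom (C_SB B X n) A.
        \<forall>c \<in> carrier (C_SB B X (Suc n)). f (bd_SB B us os X act (Suc n) c) = \<one>\<^bsub>A\<^esub>}"


section \<open>The local biquandle complex\<close>

text \<open>The basis element \<open>((x, y\<^sub>1), \<dots>, (x, y\<^sub>n))\<close> is the list \<open>[(x, y\<^sub>1), \<dots>, (x, y\<^sub>n)]\<close>.\<close>

definition lb_basis :: "'x set \<Rightarrow> nat \<Rightarrow> ('x \<times> 'x) list set" where
  "lb_basis X n = {map (Pair x) ys | x ys. n \<ge> 1 \<and> x \<in> X \<and> ys \<in> lists X \<and> length ys = n}"

definition lb_degen :: "'x set \<Rightarrow> nat \<Rightarrow> ('x \<times> 'x) list set" where
  "lb_degen X n = {ps \<in> lb_basis X n. \<exists>i. Suc i < n \<and> snd (ps ! i) = snd (ps ! Suc i)}"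

definition lb_bd_basis ::
  "('x \<Rightarrow> 'x \<Rightarrow> 'x \<Rightarrow> 'x) \<Rightarrow> ('x \<times> 'x) list \<Rightarrow> ('x \<times> 'x) list \<Rightarrow>\<^sub>0 int" where
  "lb_bd_basis br ps =
     (if length ps \<ge> 2 then
       (\<Sum>i<length ps. frag_cmul ((- 1) ^ Suc i)
          (frag_of (take i ps @ drop (Suc i) ps)
           - frag_of (map (\<lambda>p. lb_under br p (ps ! i)) (take i ps)
                      @ map (\<lambda>p. lb_over br p (ps ! i)) (drop (Suc i) ps))))
     else 0)"

definition C_LB :: "'x set \<Rightarrow> nat \<Rightarrow> (('x \<times> 'x) list \<Rightarrow>\<^sub>0 int) set monoid" where
  "C_LB X n = free_quot (lb_basis X n) (lb_degen X n)"

definition bd_LB :: "'x set \<Rightarrow> ('x \<Rightarrow> 'x \<Rightarrow> 'x \<Rightarrow> 'x) \<Rightarrow> nat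
    \<Rightarrow> (('x \<times> 'x) list \<Rightarrow>\<^sub>0 int) set \<Rightarrow> (('x \<times> 'x) list \<Rightarrow>\<^sub>0 int) set" where
  "bd_LB X br n =
     quot_map (lb_basis X (n - 1)) (lb_degen X (n - 1)) (frag_extend (lb_bd_basis br))"

definition H_LB :: "'x set \<Rightarrow> ('x \<Rightarrow> 'x \<Rightarrow> 'x \<Rightarrow> 'x) \<Rightarrow> nat
    \<Rightarrow> (('x \<times> 'x) list \<Rightarrow>\<^sub>0 int) set set monoid" where
  "H_LB X br n =
     homology (C_LB X (Suc n)) (bd_LB X br (Suc n)) (C_LB X n) (bd_LB X br n) (C_LB X (n - 1))"

definition cls_LB :: "'x set \<Rightarrow> ('x \<Rightarrow> 'x \<Rightarrow> 'x \<Rightarrow> 'x) \<Rightarrow> nat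
    \<Rightarrow> (('x \<times> 'x) list \<Rightarrow>\<^sub>0 int) set \<Rightarrow> (('x \<times> 'x) list \<Rightarrow>\<^sub>0 int) set set" where
  "cls_LB X br n = homology_cls (C_LB X (Suc n)) (bd_LB X br (Suc n)) (C_LB X n)"

definition Z_LB :: "'x set \<Rightarrow> ('x \<Rightarrow> 'x \<Rightarrow> 'x \<Rightarrow> 'x) \<Rightarrow> nat
    \<Rightarrow> ('a, 'm) monoid_scheme \<Rightarrow> ((('x \<times> 'x) list \<Rightarrow>\<^sub>0 int) set \<Rightarrow> 'a) set" where
  "Z_LB X br n A =
     {f \<in> hom (C_LB X n) A.
        \<forall>c \<in> carrier (C_LB X (Suc n)). f (bd_LB X br (Suc n) c) = \<one>\<^bsub>A\<^esub>}"


section \<open>The map \<open>\<mu>\<close>\<close>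

definition mu_basis :: "('x \<Rightarrow> 'b \<Rightarrow> 'x) \<Rightarrow> 'x \<times> 'b list \<Rightarrow> ('x \<times> 'x) list" where
  "mu_basis act = (\<lambda>(x, as). map (\<lambda>a. (x, act x a)) as)"

text \<open>\<open>mu X act n\<close> maps \<open>C_SB B X n\<close> to \<open>C_LB X n\<close>; \<open>mu_star\<close> is the induced map from
  \<open>H_SB B us os X act n\<close> to \<open>H_LB X br n\<close>.\<close>

definition mu :: "'x set \<Rightarrow> ('x \<Rightarrow> 'b \<Rightarrow> 'x) \<Rightarrow> nat
    \<Rightarrow> (('x \<times> 'b list) \<Rightarrow>\<^sub>0 int) set \<Rightarrow> (('x \<times> 'x) list \<Rightarrow>\<^sub>0 int) set" where
  "mu X act n =
     quot_map (lb_basis X n) (lb_degen X n) (frag_extend (\<lambda>c. frag_of (mu_basis act c)))"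

definition mu_star :: "'x set \<Rightarrow> ('x \<Rightarrow> 'b \<Rightarrow> 'x) \<Rightarrow> ('x \<Rightarrow> 'x \<Rightarrow> 'x \<Rightarrow> 'x) \<Rightarrow> nat
    \<Rightarrow> (('x \<times> 'b list) \<Rightarrow>\<^sub>0 int) set set \<Rightarrow> (('x \<times> 'x) list \<Rightarrow>\<^sub>0 int) set set" where
  "mu_star X act br n U = the_elem ((\<lambda>w. cls_LB X br n (mu X act n w)) ` U)"


section \<open>Links and diagrams\<close>

text \<open>We work in the piecewise linear category.  Space is \<open>complex \<times> real\<close>, projected to the plane
  \<open>complex\<close> by \<open>fst\<close>; \<open>snd\<close> is the height, and the viewer looks down from above.
  An oriented link is given by its finite set of oriented edges \<open>(a, b)\<close>: every vertex is the
  initial point of exactly one edge and the terminal point of exactly one edge, and edges meet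
  only in common vertices.  Hence the union of the edges is a nonempty disjoint union of finitely
  many oriented simple closed polygons.\<close>

type_synonym pt = "complex \<times> real"
type_synonym edges = "(pt \<times> pt) set"

definition seg :: "pt \<times> pt \<Rightarrow> pt set" where
  "seg e = closed_segment (fst e) (snd e)"

definition body :: "edges \<Rightarrow> pt set" where
  "body K = (\<Union>e\<in>K. seg e)"

definition oriented_link :: "edges \<Rightarrow> bool" where
  "oriented_link K \<longleftrightarrow>
     finite K \<and> K \<noteq> {} \<and> (\<forall>(a, b)\<in>K. a \<noteq> b) \<and>
     fst ` K = snd ` K \<and> inj_on fst K \<and> inj_on snd K \<and>
     (\<forall>e\<in>K. \<forall>e'\<in>K. e \<noteq> e' \<longrightarrow> seg e \<inter> seg e' \<subseteq> {fst e, snd e} \<inter> {fst e', snd e'})"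

text \<open>Isotopy of oriented polygonal links is the equivalence relation generated by Reidemeister's
  elementary moves, which replace an edge \<open>(a, c)\<close> by \<open>(a, b)\<close>, \<open>(b, c)\<close> if the triangle \<open>abc\<close>
  meets the link in the edge \<open>(a, c)\<close> only (subdivision of an edge is the case of a
  degenerate triangle).\<close>

definition elementary_move :: "edges \<Rightarrow> edges \<Rightarrow> bool" where
  "elementary_move K K' \<longleftrightarrow>
     oriented_link K \<and> oriented_link K' \<and>
     (\<exists>a b c. (a, c) \<in> K \<and> K' = (K - {(a, c)}) \<union> {(a, b), (b, c)} \<and>
        convex hull {a, b, c} \<inter> body K = closed_segment a c)"

definition link_isotopic :: "edges \<Rightarrow> edges \<Rightarrow> bool" where
  "link_isotopic = equivclp elementary_move"

definition projection :: "edges \<Rightarrow> complex set" where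
  "projection K = fst ` body K"

definition preimages :: "edges \<Rightarrow> complex \<Rightarrow> pt set" where
  "preimages K p = {q \<in> body K. fst q = p}"

definition crossings :: "edges \<Rightarrow> complex set" where
  "crossings K = {p. card (preimages K p) = 2}"

text \<open>Regular projection: at most double points, finitely many of them, none of them the image of
  a vertex.  This excludes vertical edges and overlapping or folded images of edges, so all double
  points are transverse.\<close>

definition regular_position :: "edges \<Rightarrow> bool" where
  "regular_position K \<longleftrightarrow>
     oriented_link K \<and>
     (\<forall>p. finite (preimages K p) \<and> card (preimages K p) \<le> 2) \<and>
     finite (crossings K) \<and>
     (\<forall>(a, b)\<in>K. fst a \<notin> crossings K)"

text \<open>A diagram is an oriented link in regular position; its heights provide the over/under
  information at the double points.\<close>

definition diagram_of :: "edges \<Rightarrow> edges \<Rightarrow> bool" where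
  "diagram_of D L \<longleftrightarrow> regular_position D \<and> link_isotopic L D"

definition connected_diagram :: "edges \<Rightarrow> bool" where
  "connected_diagram D \<longleftrightarrow> connected (projection D)"

definition semi_arcs :: "edges \<Rightarrow> complex set set" where
  "semi_arcs D = components (projection D - crossings D)"

definition regions :: "edges \<Rightarrow> complex set set" where
  "regions D = components (- projection D)"

text \<open>The plane is oriented by \<open>(1, \<i>)\<close>, so \<open>(v, \<i> * v)\<close> is a positively oriented basis.\<close>

definition normal :: "complex \<Rightarrow> complex" where
  "normal v = \<i> * v"

text \<open>The points \<open>p + t w\<close> with small positive \<open>t\<close> lie in \<open>S\<close>.\<close>

definition germ_in :: "complex \<Rightarrow> complex \<Rightarrow> complex set \<Rightarrow> bool" where
  "germ_in p w S \<longleftrightarrow> (\<forall>\<^sub>F t in at_right (0::real). p + t *\<^sub>R w \<in> S)"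

definition normal_points :: "edges \<Rightarrow> complex set \<Rightarrow> complex set \<Rightarrow> complex set \<Rightarrow> bool" where
  "normal_points D s r1 r2 \<longleftrightarrow>
     (\<exists>(a, b)\<in>D. \<exists>p \<in> s \<inter> open_segment (fst a) (fst b).
        germ_in p (- normal (fst b - fst a)) r1 \<and> germ_in p (normal (fst b - fst a)) r2)"

text \<open>The directions \<open>u\<close> and \<open>v\<close> of the under- and the over-strand at a crossing.\<close>

definition strand_dirs :: "edges \<Rightarrow> complex \<Rightarrow> complex \<times> complex" where
  "strand_dirs D p = (THE (u, v). \<exists>a b c d q q'.
     (a, b) \<in> D \<and> (c, d) \<in> D \<and> q \<in> closed_segment a b \<and> q' \<in> closed_segment c d \<and>
     fst q = p \<and> fst q' = p \<and> snd q < snd q' \<and> u = fst b - fst a \<and> v = fst d - fst c)"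

definition under_dir :: "edges \<Rightarrow> complex \<Rightarrow> complex" where
  "under_dir D p = fst (strand_dirs D p)"

definition over_dir :: "edges \<Rightarrow> complex \<Rightarrow> complex" where
  "over_dir D p = snd (strand_dirs D p)"

text \<open>A crossing is positive if the pair (direction of the over-strand, direction of the
  under-strand) is positively oriented.\<close>

definition cr_sign :: "edges \<Rightarrow> complex \<Rightarrow> int" where
  "cr_sign D p = (if under_dir D p \<bullet> normal (over_dir D p) > 0 then 1 else - 1)"

definition cr_region :: "edges \<Rightarrow> complex \<Rightarrow> complex set" where
  "cr_region D p = (THE r. r \<in> regions D \<and>
     (\<exists>w. w \<bullet> normal (under_dir D p) < 0 \<and> w \<bullet> normal (over_dir D p) < 0 \<and> germ_in p w r))"

text \<open>\<open>branch D p v m\<close> is the semi-arc containing that half of the strand with direction \<open>v\<close> at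
  \<open>p\<close> from which \<open>m\<close> points away.  The semi-arcs \<open>u\<^sub>1\<close>, \<open>o\<^sub>1\<close> adjacent to the region \<open>cr_region D p\<close>
  are the halves of each strand from which the normal vector of the other strand points away.\<close>

definition branch :: "edges \<Rightarrow> complex \<Rightarrow> complex \<Rightarrow> complex \<Rightarrow> complex set" where
  "branch D p v m = (THE s. s \<in> semi_arcs D \<and> (\<exists>w\<in>{v, - v}. w \<bullet> m < 0 \<and> germ_in p w s))"

definition under1 :: "edges \<Rightarrow> complex \<Rightarrow> complex set" where
  "under1 D p = branch D p (under_dir D p) (normal (over_dir D p))"

definition under2 :: "edges \<Rightarrow> complex \<Rightarrow> complex set" where
  "under2 D p = branch D p (under_dir D p) (- normal (over_dir D p))"

definition over1 :: "edges \<Rightarrow> complex \<Rightarrow> complex set" where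
  "over1 D p = branch D p (over_dir D p) (normal (under_dir D p))"

definition over2 :: "edges \<Rightarrow> complex \<Rightarrow> complex set" where
  "over2 D p = branch D p (over_dir D p) (- normal (under_dir D p))"


section \<open>Colorings and invariants\<close>

text \<open>A shadow coloring is given by its restrictions to the semi-arcs and to the regions.\<close>

definition Col_SB :: "'b set \<Rightarrow> ('b \<Rightarrow> 'b \<Rightarrow> 'b) \<Rightarrow> ('b \<Rightarrow> 'b \<Rightarrow> 'b) \<Rightarrow> 'x set \<Rightarrow> ('x \<Rightarrow> 'b \<Rightarrow> 'x)
    \<Rightarrow> edges \<Rightarrow> ((complex set \<Rightarrow> 'b) \<times> (complex set \<Rightarrow> 'x)) set" where
  "Col_SB B us os X act D =
     {(CS, CR) \<in> (semi_arcs D \<rightarrow>\<^sub>E B) \<times> (regions D \<rightarrow>\<^sub>E X).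
        (\<forall>p \<in> crossings D.
           CS (under2 D p) = us (CS (under1 D p)) (CS (over1 D p)) \<and>
           CS (over2 D p) = os (CS (over1 D p)) (CS (under1 D p))) \<and>
        (\<forall>s \<in> semi_arcs D. \<forall>r1 \<in> regions D. \<forall>r2 \<in> regions D.
           normal_points D s r1 r2 \<longrightarrow> act (CR r1) (CS s) = CR r2)}"

definition W_SB :: "'b set \<Rightarrow> 'x set \<Rightarrow> edges \<Rightarrow> (complex set \<Rightarrow> 'b) \<times> (complex set \<Rightarrow> 'x)
    \<Rightarrow> (('x \<times> 'b list) \<Rightarrow>\<^sub>0 int) set" where
  "W_SB B X D = (\<lambda>(CS, CR). quot_cls (sb_basis B X 2) (sb_degen B X 2)
     (\<Sum>p \<in> crossings D. frag_cmul (cr_sign D p)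
        (frag_of (CR (cr_region D p), [CS (under1 D p), CS (over1 D p)]))))"

definition Col_LB :: "'x set \<Rightarrow> ('x \<Rightarrow> 'x \<Rightarrow> 'x \<Rightarrow> 'x) \<Rightarrow> edges \<Rightarrow> (complex set \<Rightarrow> 'x \<times> 'x) set" where
  "Col_LB X br D =
     {C \<in> semi_arcs D \<rightarrow>\<^sub>E X \<times> X.
        \<forall>p \<in> crossings D.
           fst (C (under1 D p)) = fst (C (over1 D p)) \<and>
           C (under2 D p) = lb_under br (C (under1 D p)) (C (over1 D p)) \<and>
           C (over2 D p) = lb_over br (C (over1 D p)) (C (under1 D p))}"

definition W_LB :: "'x set \<Rightarrow> edges \<Rightarrow> (complex set \<Rightarrow> 'x \<times> 'x) \<Rightarrow> (('x \<times> 'x) list \<Rightarrow>\<^sub>0 int) set" where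
  "W_LB X D C = quot_cls (lb_basis X 2) (lb_degen X 2)
     (\<Sum>p \<in> crossings D. frag_cmul (cr_sign D p) (frag_of [C (under1 D p), C (over1 D p)]))"

text \<open>The invariants of a link, computed from a diagram of it.\<close>

definition Hinv_SB :: "'b set \<Rightarrow> ('b \<Rightarrow> 'b \<Rightarrow> 'b) \<Rightarrow> ('b \<Rightarrow> 'b \<Rightarrow> 'b) \<Rightarrow> 'x set \<Rightarrow> ('x \<Rightarrow> 'b \<Rightarrow> 'x)
    \<Rightarrow> edges \<Rightarrow> ((complex set \<Rightarrow> 'b) \<times> (complex set \<Rightarrow> 'x), (('x \<times> 'b list) \<Rightarrow>\<^sub>0 int) set set) family" where
  "Hinv_SB B us os X act D =
     (Col_SB B us os X act D, \<lambda>C. cls_SB B us os X act 2 (W_SB B X D C))"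

definition Hinv_LB :: "'x set \<Rightarrow> ('x \<Rightarrow> 'x \<Rightarrow> 'x \<Rightarrow> 'x) \<Rightarrow> edges
    \<Rightarrow> (complex set \<Rightarrow> 'x \<times> 'x, (('x \<times> 'x) list \<Rightarrow>\<^sub>0 int) set set) family" where
  "Hinv_LB X br D = (Col_LB X br D, \<lambda>C. cls_LB X br 2 (W_LB X D C))"

definition Phi_SB :: "'b set \<Rightarrow> ('b \<Rightarrow> 'b \<Rightarrow> 'b) \<Rightarrow> ('b \<Rightarrow> 'b \<Rightarrow> 'b) \<Rightarrow> 'x set \<Rightarrow> ('x \<Rightarrow> 'b \<Rightarrow> 'x)
    \<Rightarrow> ((('x \<times> 'b list) \<Rightarrow>\<^sub>0 int) set \<Rightarrow> 'a) \<Rightarrow> edges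
    \<Rightarrow> ((complex set \<Rightarrow> 'b) \<times> (complex set \<Rightarrow> 'x), 'a) family" where
  "Phi_SB B us os X act \<theta> D = (Col_SB B us os X act D, \<lambda>C. \<theta> (W_SB B X D C))"

definition Phi_LB :: "'x set \<Rightarrow> ('x \<Rightarrow> 'x \<Rightarrow> 'x \<Rightarrow> 'x)
    \<Rightarrow> ((('x \<times> 'x) list \<Rightarrow>\<^sub>0 int) set \<Rightarrow> 'a) \<Rightarrow> edges \<Rightarrow> (complex set \<Rightarrow> 'x \<times> 'x, 'a) family" where
  "Phi_LB X br \<theta> D = (Col_LB X br D, \<lambda>C. \<theta> (W_LB X D C))"

end

theory Submission
  imports Defs
begin

text \<open>A shadow colouring induces a local biquandle colouring that maps a semi-arc to the pair of
  colours of the regions before and behind it, and \<open>\<mu>\<close> takes the weight of the one to the weight of the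
  other.  The induced map on colourings is injective because the action is strongly connected and
  every region borders a semi-arc.  It is surjective because a local biquandle colouring is the same
  as a locally constant colouring of the complement of the diagram near the diagram, and near the
  diagram each region is connected: by unicoherence of the plane, the intersection of a region with
  a connected open neighbourhood of a connected diagram is connected.  Finally, weights are cycles since the
  boundary of the weight is a sum over all edges of the jumps of one function of semi-arcs, and
  these telescope along the closed polygons of the link.\<close>

section \<open>Cosets in free abelian groups\<close>

text \<open>A local colouring prescribes a value for each side of each semi-arc, but a region may
  touch the diagram in many places, and the colouring equations do not compare distant places on its
  boundary. Connectedness of the collar of the diagram inside a region forces the prescribed values
  to agree; between two components of a disconnected diagram the collar would fall apart. Near a
  crossing the values agree because the new pairs \<open>(z, [x,y,z])\<close> and
  \<open>(y, [x,y,z])\<close> repeat z, y and the bracket, so that the two half-strands bounding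
  each quadrant prescribe the same value. Another obstacle is that a vertex has no normal vector of
  its own: sides are therefore tested at interior points of edges, and each chart away from the
  crossings guarantees such points arbitrarily close to its centre.\<close>

lemma quot_sub_eq:
  assumes "T \<subseteq> S"
  shows "quot_sub S T = {c. Poly_Mapping.keys c \<subseteq> T}"
proof
  let ?G = "free_Abelian_group S"
  interpret group ?G by simp
  have sub: "subgroup {c. Poly_Mapping.keys c \<subseteq> T} ?G"
  proof (rule subgroup.intro)
    show "x \<otimes>\<^bsub>?G\<^esub> y \<in> {c. Poly_Mapping.keys c \<subseteq> T}"
      if "x \<in> {c. Poly_Mapping.keys c \<subseteq> T}" "y \<in> {c. Poly_Mapping.keys c \<subseteq> T}" for x y
      using that keys_add[of x y] by auto
    show "inv\<^bsub>?G\<^esub> x \<in> {c. Poly_Mapping.keys c \<subseteq> T}" if "x \<in> {c. Poly_Mapping.keys c \<subseteq> T}" for x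
    proof -
      have "Poly_Mapping.keys x \<subseteq> S" using that assms by auto
      then show ?thesis using that by (simp add: keys_minus)
    qed
  qed (use assms in auto)
  show "quot_sub S T \<subseteq> {c. Poly_Mapping.keys c \<subseteq> T}"
    unfolding quot_sub_def by (rule generate_subgroup_incl[OF _ sub]) auto
  have gen: "subgroup (generate ?G (frag_of ` T)) ?G"
    by (rule generate_is_subgroup) (use assms in auto)
  show "{c. Poly_Mapping.keys c \<subseteq> T} \<subseteq> quot_sub S T"
  proof
    fix c :: "'a \<Rightarrow>\<^sub>0 int" assume "c \<in> {c. Poly_Mapping.keys c \<subseteq> T}"
    then have "Poly_Mapping.keys c \<subseteq> T" by simp
    then show "c \<in> quot_sub S T"
      unfolding quot_sub_def
    proof (rule free_Abelian_group_induct)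
      show "0 \<in> generate ?G (frag_of ` T)" using subgroup.one_closed[OF gen] by simp
      show "frag_of a \<in> generate ?G (frag_of ` T)" if "a \<in> T" for a
        using that by (auto intro: generate.incl)
      fix x y :: "'a \<Rightarrow>\<^sub>0 int"
      assume "Poly_Mapping.keys y \<subseteq> T" and
        x: "x \<in> generate ?G (frag_of ` T)" and y: "y \<in> generate ?G (frag_of ` T)"
      then have "Poly_Mapping.keys y \<subseteq> S" using assms by auto
      then have "- y \<in> generate ?G (frag_of ` T)"
        using subgroup.m_inv_closed[OF gen y] by simp
      from subgroup.m_closed[OF gen x this] show "x - y \<in> generate ?G (frag_of ` T)" by simp
    qed
  qed
qed

text \<open>The subgroup generated by a set of basis elements consists of the chains supported on
  it, so questions about classes become questions about the support of a difference.\<close>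

lemma mem_quot_cls:
  assumes "T \<subseteq> S"
  shows "d \<in> quot_cls S T c \<longleftrightarrow> Poly_Mapping.keys (d - c) \<subseteq> T"
  unfolding quot_cls_def r_coset_def quot_sub_eq[OF assms]
  by (auto intro!: bexI[of _ "d - c"])

lemma quot_cls_eq_iff:
  assumes "T \<subseteq> S"
  shows "quot_cls S T c = quot_cls S T d \<longleftrightarrow> Poly_Mapping.keys (c - d) \<subseteq> T" (is "?L \<longleftrightarrow> ?R")
proof
  assume ?L
  moreover have "c \<in> quot_cls S T c" by (simp add: mem_quot_cls[OF assms])
  ultimately show ?R by (simp add: mem_quot_cls[OF assms])
next
  assume R: ?R
  have "Poly_Mapping.keys (x - c) \<subseteq> T \<longleftrightarrow> Poly_Mapping.keys (x - d) \<subseteq> T" for x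
    using keys_add[of "x - c" "c - d"] keys_diff[of "x - d" "c - d"] R by auto
  then show ?L by (auto simp: mem_quot_cls[OF assms])
qed

lemma quot_sub_normal:
  assumes "T \<subseteq> S"
  shows "quot_sub S T \<lhd> free_Abelian_group S"
proof -
  interpret comm_group "free_Abelian_group S" by (rule abelian_free_Abelian_group)
  show ?thesis
    unfolding normal_iff_subgroup quot_sub_def
    by (rule generate_is_subgroup) (use assms in auto)
qed

lemma carrier_free_quot:
  "carrier (free_quot S T) = quot_cls S T ` {c. Poly_Mapping.keys c \<subseteq> S}"
  by (auto simp: free_quot_def carrier_FactGroup quot_cls_def)

lemma mult_free_quot:
  assumes "T \<subseteq> S" "Poly_Mapping.keys c \<subseteq> S" "Poly_Mapping.keys d \<subseteq> S"
  shows "quot_cls S T c \<otimes>\<^bsub>free_quot S T\<^esub> quot_cls S T d = quot_cls S T (c + d)"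
  using normal.rcos_sum[OF quot_sub_normal[OF assms(1)], of c d] assms
  by (simp add: free_quot_def quot_cls_def FactGroup_def)

lemma one_free_quot:
  assumes "T \<subseteq> S"
  shows "\<one>\<^bsub>free_quot S T\<^esub> = quot_cls S T 0"
  by (auto simp: free_quot_def quot_cls_def FactGroup_def r_coset_def)

lemma group_free_quot:
  assumes "T \<subseteq> S"
  shows "group (free_quot S T)"
  unfolding free_quot_def by (rule normal.factorgroup_is_group[OF quot_sub_normal[OF assms]])

lemma keys_frag_extend_subset:
  assumes "\<And>t. t \<in> T \<Longrightarrow> Poly_Mapping.keys (f t) \<subseteq> T'" "Poly_Mapping.keys c \<subseteq> T"
  shows "Poly_Mapping.keys (frag_extend f c) \<subseteq> T'"
  using keys_frag_extend[of f c] assms by blast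

lemma keys_diff_subset:
  "Poly_Mapping.keys c \<subseteq> T \<Longrightarrow> Poly_Mapping.keys d \<subseteq> T \<Longrightarrow> Poly_Mapping.keys (c - d) \<subseteq> T"
  using keys_diff[of c d] by blast

text \<open>\<open>quot_map\<close> takes the unique element of an image, so it is meaningful only
  if all representatives have the same image class. Two representatives differ by a chain supported
  on \<open>T\<close>; linearity and the hypothesis on \<open>f\<close> send it to a chain supported
  on \<open>T'\<close>.\<close>

lemma quot_map_frag_extend:
  assumes "T \<subseteq> S" "T' \<subseteq> S'" "\<And>t. t \<in> T \<Longrightarrow> Poly_Mapping.keys (f t) \<subseteq> T'"
  shows "quot_map S' T' (frag_extend f) (quot_cls S T c) = quot_cls S' T' (frag_extend f c)"
proof -
  have "quot_cls S' T' (frag_extend f d) = quot_cls S' T' (frag_extend f c)"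
    if "d \<in> quot_cls S T c" for d
  proof -
    have "Poly_Mapping.keys (d - c) \<subseteq> T" using that by (simp add: mem_quot_cls[OF assms(1)])
    from keys_frag_extend_subset[OF assms(3) this] show ?thesis
      by (simp add: quot_cls_eq_iff[OF assms(2)] frag_extend_diff)
  qed
  moreover have "c \<in> quot_cls S T c" by (simp add: mem_quot_cls[OF assms(1)])
  ultimately have "(\<lambda>d. quot_cls S' T' (frag_extend f d)) ` quot_cls S T c
      = {quot_cls S' T' (frag_extend f c)}"
    by (metis (no_types, lifting) empty_iff image_cong image_constant_conv)
  then show ?thesis by (simp add: quot_map_def)
qed

lemma quot_map_frag_extend_hom:
  assumes "T \<subseteq> S" "T' \<subseteq> S'" "\<And>t. t \<in> T \<Longrightarrow> Poly_Mapping.keys (f t) \<subseteq> T'"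
    and "\<And>t. t \<in> S \<Longrightarrow> Poly_Mapping.keys (f t) \<subseteq> S'"
  shows "quot_map S' T' (frag_extend f) \<in> hom (free_quot S T) (free_quot S' T')"
proof (rule homI)
  note [simp] = quot_map_frag_extend[where f = f, OF assms(1,2,3)]
  have S: "Poly_Mapping.keys (frag_extend f c) \<subseteq> S'" if "Poly_Mapping.keys c \<subseteq> S" for c
    using keys_frag_extend_subset[OF assms(4) that] .
  show "quot_map S' T' (frag_extend f) x \<in> carrier (free_quot S' T')"
    if "x \<in> carrier (free_quot S T)" for x
    using that S by (auto simp: carrier_free_quot)
  fix x y assume "x \<in> carrier (free_quot S T)" "y \<in> carrier (free_quot S T)"
  then obtain c d where cd: "x = quot_cls S T c" "y = quot_cls S T d"
    "Poly_Mapping.keys c \<subseteq> S" "Poly_Mapping.keys d \<subseteq> S"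
    by (auto simp: carrier_free_quot)
  then show "quot_map S' T' (frag_extend f) (x \<otimes>\<^bsub>free_quot S T\<^esub> y)
    = quot_map S' T' (frag_extend f) x \<otimes>\<^bsub>free_quot S' T'\<^esub> quot_map S' T' (frag_extend f) y"
    using S by (simp add: mult_free_quot assms(1,2) frag_extend_add)
qed

lemma induced_coset_map:
  assumes "group G" "group G'" "m \<in> hom G G'" "inj_on m (carrier G)" "subgroup K G"
    "subgroup (m ` K) G'" "w \<in> carrier G"
  shows "the_elem ((\<lambda>w. (m ` K) #>\<^bsub>G'\<^esub> m w) ` (K #>\<^bsub>G\<^esub> w)) = (m ` K) #>\<^bsub>G'\<^esub> m w"
    and "w' \<in> carrier G \<Longrightarrow> (m ` K) #>\<^bsub>G'\<^esub> m w = (m ` K) #>\<^bsub>G'\<^esub> m w' \<Longrightarrow> K #>\<^bsub>G\<^esub> w = K #>\<^bsub>G\<^esub> w'"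
proof -
  interpret G: group G by fact
  interpret G': group G' by fact
  interpret K: subgroup K G by fact
  interpret K': subgroup "m ` K" G' by fact
  have m: "m x \<in> carrier G'" if "x \<in> carrier G" for x
    using that assms(3) by (auto simp: hom_def)
  have mm: "m (x \<otimes>\<^bsub>G\<^esub> y) = m x \<otimes>\<^bsub>G'\<^esub> m y" if "x \<in> carrier G" "y \<in> carrier G" for x y
    using that assms(3) by (auto simp: hom_def)
  have absorb: "(m ` K) #>\<^bsub>G'\<^esub> m (k \<otimes>\<^bsub>G\<^esub> w) = (m ` K) #>\<^bsub>G'\<^esub> m w" if "k \<in> K" for k
  proof -
    have "(m ` K) #>\<^bsub>G'\<^esub> (m k \<otimes>\<^bsub>G'\<^esub> m w) = ((m ` K) #>\<^bsub>G'\<^esub> m k) #>\<^bsub>G'\<^esub> m w"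
      using that m assms(7) by (subst G'.coset_mult_assoc) (auto simp: K'.subset)
    also have "(m ` K) #>\<^bsub>G'\<^esub> m k = m ` K"
      using that m by (intro G'.coset_join2 assms(6)) auto
    finally show ?thesis using that assms(7) by (simp add: mm)
  qed
  have "(\<lambda>w. (m ` K) #>\<^bsub>G'\<^esub> m w) ` (K #>\<^bsub>G\<^esub> w) = {(m ` K) #>\<^bsub>G'\<^esub> m w}"
  proof -
    have "K #>\<^bsub>G\<^esub> w = (\<lambda>k. k \<otimes>\<^bsub>G\<^esub> w) ` K" by (auto simp: r_coset_def)
    then have "(\<lambda>w. (m ` K) #>\<^bsub>G'\<^esub> m w) ` (K #>\<^bsub>G\<^esub> w) = (\<lambda>k. (m ` K) #>\<^bsub>G'\<^esub> m w) ` K"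
      using absorb by (simp only: image_image cong: image_cong)
    then show ?thesis by (simp only: image_constant[OF K.one_closed])
  qed
  then show "the_elem ((\<lambda>w. (m ` K) #>\<^bsub>G'\<^esub> m w) ` (K #>\<^bsub>G\<^esub> w)) = (m ` K) #>\<^bsub>G'\<^esub> m w"
    by simp
  assume w': "w' \<in> carrier G" and eq: "(m ` K) #>\<^bsub>G'\<^esub> m w = (m ` K) #>\<^bsub>G'\<^esub> m w'"
  have "m w \<in> (m ` K) #>\<^bsub>G'\<^esub> m w'"
    using G'.rcos_self[OF m[OF assms(7)] assms(6)] eq by simp
  then obtain k where k: "k \<in> K" "m w = m k \<otimes>\<^bsub>G'\<^esub> m w'"
    by (auto simp: r_coset_def)
  then have "m w = m (k \<otimes>\<^bsub>G\<^esub> w')" using w' by (simp add: mm)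
  then have "w = k \<otimes>\<^bsub>G\<^esub> w'"
    using inj_onD[OF assms(4)] k w' assms(7) by simp
  then have "K #>\<^bsub>G\<^esub> w = (K #>\<^bsub>G\<^esub> k) #>\<^bsub>G\<^esub> w'"
    using k w' by (subst G.coset_mult_assoc) (auto simp: K.subset)
  also have "K #>\<^bsub>G\<^esub> k = K" using k by (intro G.coset_join2 assms(5)) auto
  finally show "K #>\<^bsub>G\<^esub> w = K #>\<^bsub>G\<^esub> w'" .
qed


section \<open>The two chain complexes\<close>

text \<open>Homology in degree 2 unfolds to boundaries from degree \<open>Suc 2\<close>, whereas the
  boundary lemmas are stated for the numeral 3.\<close>

lemma Suc_2: "Suc 2 = 3" by simp

locale strong_shadow =
  fixes B :: "'b set" and us os :: "'b \<Rightarrow> 'b \<Rightarrow> 'b" and X :: "'x set" and act :: "'x \<Rightarrow> 'b \<Rightarrow> 'x"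
  assumes shadow: "shadow_biquandle B us os X act" and strong: "strongly_connected B X act"
begin

abbreviation br :: "'x \<Rightarrow> 'x \<Rightarrow> 'x \<Rightarrow> 'x" where "br \<equiv> shadow_bracket B os act"

abbreviation arrow :: "'x \<Rightarrow> 'x \<Rightarrow> 'b" where "arrow \<equiv> searrow B act"

lemma us_closed [simp]: "a \<in> B \<Longrightarrow> b \<in> B \<Longrightarrow> us a b \<in> B"
  and os_closed [simp]: "a \<in> B \<Longrightarrow> b \<in> B \<Longrightarrow> os a b \<in> B"
  and us_diag: "a \<in> B \<Longrightarrow> us a a = os a a"
  using shadow by (auto simp: shadow_biquandle_def biquandle_def)

lemma act_closed [simp]: "x \<in> X \<Longrightarrow> a \<in> B \<Longrightarrow> act x a \<in> X"
  using strong by (auto simp: strongly_connected_def bij_betw_def)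

lemma act_inj: "x \<in> X \<Longrightarrow> a \<in> B \<Longrightarrow> b \<in> B \<Longrightarrow> act x a = act x b \<longleftrightarrow> a = b"
  using strong by (auto simp: strongly_connected_def bij_betw_def inj_on_def)

lemma arrow_act [simp]: "x \<in> X \<Longrightarrow> a \<in> B \<Longrightarrow> arrow x (act x a) = a"
  using searrow_props[OF strong, of x "act x a"] act_inj by auto

lemma arrow_closed [simp]: "x \<in> X \<Longrightarrow> y \<in> X \<Longrightarrow> arrow x y \<in> B"
  and act_arrow [simp]: "x \<in> X \<Longrightarrow> y \<in> X \<Longrightarrow> act x (arrow x y) = y"
  using searrow_props[OF strong] by auto

text \<open>In the coordinates y = x*a and z = x*b the bracket is an action of \<open>os\<close> by
  definition and an action of \<open>us\<close> by the axiom of a B-set. All comparisons of the two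
  structures use these two forms.\<close>

lemma br_over: "x \<in> X \<Longrightarrow> a \<in> B \<Longrightarrow> b \<in> B \<Longrightarrow> br x (act x a) (act x b) = act (act x a) (os b a)"
  by (simp add: shadow_bracket_def)

lemma br_under: "x \<in> X \<Longrightarrow> a \<in> B \<Longrightarrow> b \<in> B \<Longrightarrow> br x (act x a) (act x b) = act (act x b) (us a b)"
  by (simp add: shadow_bracket_alt[OF shadow strong])

section \<open>Generators and boundaries of the shadow complex in degrees two and three\<close>

lemma sb_degen_subset: "sb_degen B X n \<subseteq> sb_basis B X n"
  by (auto simp: sb_degen_def)

lemma lb_degen_subset: "lb_degen X n \<subseteq> lb_basis X n"
  by (auto simp: lb_degen_def)

lemma sb_basis_2: "(x, as) \<in> sb_basis B X 2 \<longleftrightarrow> (\<exists>a b. as = [a, b] \<and> x \<in> X \<and> a \<in> B \<and> b \<in> B)"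
  by (auto simp: sb_basis_def length_Suc_conv numeral_2_eq_2)

lemma sb_basis_3:
  "(x, as) \<in> sb_basis B X 3 \<longleftrightarrow> (\<exists>a b c. as = [a, b, c] \<and> x \<in> X \<and> a \<in> B \<and> b \<in> B \<and> c \<in> B)"
  by (auto simp: sb_basis_def length_Suc_conv numeral_3_eq_3)

lemma sb_degen_2: "(x, [a, b]) \<in> sb_degen B X 2 \<longleftrightarrow> x \<in> X \<and> a \<in> B \<and> b \<in> B \<and> a = b"
  by (auto simp: sb_degen_def sb_basis_def less_Suc_eq numeral_2_eq_2)

lemma sb_degen_3:
  "(x, [a, b, c]) \<in> sb_degen B X 3 \<longleftrightarrow> x \<in> X \<and> a \<in> B \<and> b \<in> B \<and> c \<in> B \<and> (a = b \<or> b = c)"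
  by (auto simp: sb_degen_def sb_basis_def less_Suc_eq numeral_3_eq_3)

lemma sb_bd_2:
  "sb_bd_basis us os act (x, [a, b]) =
     frag_of (x, [a]) - frag_of (act x b, [us a b])
     - (frag_of (x, [b]) - frag_of (act x a, [os b a]))"
  by (simp add: sb_bd_basis_def numeral_2_eq_2)

lemma sb_bd_3:
  "sb_bd_basis us os act (x, [a, b, c]) =
     (frag_of (x, [a, c]) - frag_of (act x b, [us a b, os c b]))
     - (frag_of (x, [b, c]) - frag_of (act x a, [os b a, os c a]))
     - (frag_of (x, [a, b]) - frag_of (act x c, [us a c, us b c]))"
  by (simp add: sb_bd_basis_def numeral_2_eq_2)

text \<open>For \<open>a = b\<close> the four terms cancel in pairs, since
  \<open>us a a = os a a\<close>.\<close>

lemma sb_bd_2_degen: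
  "p \<in> sb_degen B X 2 \<Longrightarrow> Poly_Mapping.keys (sb_bd_basis us os act p) \<subseteq> sb_degen B X 1"
  using subsetD[OF sb_degen_subset, of p 2]
  by (cases p) (auto simp: sb_basis_2 sb_degen_2 sb_bd_2 us_diag)

lemma sb_bd_3_basis:
  "p \<in> sb_basis B X 3 \<Longrightarrow> Poly_Mapping.keys (sb_bd_basis us os act p) \<subseteq> sb_basis B X 2"
proof -
  assume "p \<in> sb_basis B X 3"
  then obtain x a b c where p: "p = (x, [a, b, c])" "x \<in> X" "a \<in> B" "b \<in> B" "c \<in> B"
    by (cases p) (auto simp: sb_basis_3)
  show ?thesis unfolding p(1) sb_bd_3
    by (intro keys_diff_subset) (use p in \<open>auto simp: sb_basis_2\<close>)
qed

text \<open>The two faces that belong to the equal entries cancel each other by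
  \<open>us a a = os a a\<close>. In the remaining face one operation is applied to both equal
  entries, so its terms are again degenerate.\<close>

lemma sb_bd_3_degen:
  assumes "p \<in> sb_degen B X 3"
  shows "Poly_Mapping.keys (sb_bd_basis us os act p) \<subseteq> sb_degen B X 2"
proof -
  from subsetD[OF sb_degen_subset assms] assms obtain x a b c where
    p: "p = (x, [a, b, c])" "x \<in> X" "a \<in> B" "b \<in> B" "c \<in> B" "a = b \<or> b = c"
    by (cases p) (auto simp: sb_basis_3 sb_degen_3)
  from p(6) show ?thesis
  proof
    assume "a = b"
    then have eq: "sb_bd_basis us os act p =
      frag_of (act x c, [us a c, us a c]) - frag_of (x, [a, a])"
      using p by (simp add: sb_bd_3 us_diag)
    show ?thesis unfolding eq
      by (intro keys_diff_subset) (use p in \<open>simp_all add: sb_degen_2\<close>)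
  next
    assume "b = c"
    then have eq: "sb_bd_basis us os act p =
      frag_of (act x a, [os b a, os b a]) - frag_of (x, [b, b])"
      using p by (simp add: sb_bd_3 us_diag)
    show ?thesis unfolding eq
      by (intro keys_diff_subset) (use p in \<open>simp_all add: sb_degen_2\<close>)
  qed
qed

section \<open>The bijection between the generators of the two complexes\<close>

definition nu_basis :: "('x \<times> 'x) list \<Rightarrow> 'x \<times> 'b list" where
  "nu_basis ps = (fst (hd ps), map (\<lambda>p. arrow (fst p) (snd p)) ps)"

lemma mu_basis_basis:
  assumes "p \<in> sb_basis B X n"
  shows "mu_basis act p \<in> lb_basis X n"
proof -
  obtain x as where p: "p = (x, as)" by (cases p)
  with assms have "mu_basis act p = map (Pair x) (map (act x) as)" "map (act x) as \<in> lists X"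
      "length (map (act x) as) = n" "x \<in> X" "n \<ge> 1"
    by (auto simp: mu_basis_def sb_basis_def in_lists_conv_set)
  then show ?thesis unfolding lb_basis_def by blast
qed

text \<open>Generators have length at least 1, so \<open>hd\<close> in \<open>nu_basis\<close> does
  recover the common first component; the other entries are recovered from
  \<open>arrow x (act x a) = a\<close>.\<close>

lemma nu_mu:
  assumes "p \<in> sb_basis B X n"
  shows "nu_basis (mu_basis act p) = p"
proof -
  obtain x as where p: "p = (x, as)" by (cases p)
  with assms have as: "as \<noteq> []" "set as \<subseteq> B" "x \<in> X"
    by (auto simp: sb_basis_def in_lists_conv_set)
  then show ?thesis unfolding p mu_basis_def nu_basis_def
    by (auto simp: hd_map subset_iff o_def intro!: map_idI)
qed

lemma nu_basis_basis:
  assumes "q \<in> lb_basis X n"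
  shows "nu_basis q \<in> sb_basis B X n" and mu_nu: "mu_basis act (nu_basis q) = q"
proof -
  obtain x ys where q: "q = map (Pair x) ys" "n \<ge> 1" "x \<in> X" "set ys \<subseteq> X" "length ys = n"
    using assms by (auto simp: lb_basis_def in_lists_conv_set)
  moreover from q have "ys \<noteq> []" by auto
  ultimately have "nu_basis q = (x, map (arrow x) ys)"
    by (simp add: nu_basis_def hd_map o_def)
  then show "nu_basis q \<in> sb_basis B X n" "mu_basis act (nu_basis q) = q"
    using q by (auto simp: sb_basis_def mu_basis_def in_lists_conv_set subset_iff)
qed

text \<open>By strong connectedness \<open>act x\<close> is injective, so neighbouring entries agree
  after the map exactly if they agreed before. The backward implication is what lets
  \<open>nu_basis\<close> preserve degenerate generators.\<close>

lemma mu_basis_degen_iff: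
  assumes "p \<in> sb_basis B X n"
  shows "mu_basis act p \<in> lb_degen X n \<longleftrightarrow> p \<in> sb_degen B X n"
proof -
  obtain x as where p: "p = (x, as)" by (cases p)
  with assms have as: "set as \<subseteq> B" "x \<in> X" "length as = n"
    by (auto simp: sb_basis_def in_lists_conv_set)
  then have "snd (mu_basis act p ! i) = snd (mu_basis act p ! Suc i) \<longleftrightarrow> as ! i = as ! Suc i"
    if "Suc i < n" for i
    using that unfolding p mu_basis_def by (auto simp: act_inj subset_iff)
  then show ?thesis
    using mu_basis_basis[OF assms] assms unfolding lb_degen_def sb_degen_def p by auto
qed

lemma mu_basis_degen: "p \<in> sb_degen B X n \<Longrightarrow> mu_basis act p \<in> lb_degen X n"
  using mu_basis_degen_iff[OF subsetD[OF sb_degen_subset]] by blast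

text \<open>The terms match one by one. Deleting an entry commutes with \<open>mu_basis\<close>. In
  the other half of a face the base point moves to x*a_i, which is also the first component produced
  by both local operations, and \<open>br_under\<close> and \<open>br_over\<close> identify the
  second components.\<close>

lemma mu_bd_basis:
  assumes "p \<in> sb_basis B X n"
  shows "frag_extend (\<lambda>c. frag_of (mu_basis act c)) (sb_bd_basis us os act p)
    = lb_bd_basis br (mu_basis act p)"
proof -
  obtain x as where p: "p = (x, as)" by (cases p)
  with assms have as: "set as \<subseteq> B" "x \<in> X" "length as = n"
    by (auto simp: sb_basis_def in_lists_conv_set)
  have t: "set (take i as) \<subseteq> B" "set (drop (Suc i) as) \<subseteq> B" for i
    using as(1) set_take_subset set_drop_subset by fast+
  let ?m = "mu_basis act p"
  have 1: "mu_basis act (x, take i as @ drop (Suc i) as) = take i ?m @ drop (Suc i) ?m" for i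
    by (simp add: p mu_basis_def take_map drop_map)
  have 2: "mu_basis act (act x (as ! i),
      map (\<lambda>a. us a (as ! i)) (take i as) @ map (\<lambda>a. os a (as ! i)) (drop (Suc i) as))
    = map (\<lambda>p. lb_under br p (?m ! i)) (take i ?m) @ map (\<lambda>p. lb_over br p (?m ! i)) (drop (Suc i) ?m)"
    if "i < length as" for i
  proof -
    have i: "as ! i \<in> B" using that as by auto
    have m: "?m ! i = (x, act x (as ! i))" using that by (simp add: p mu_basis_def)
    have "lb_under br (x, act x a) (?m ! i) = (act x (as ! i), act (act x (as ! i)) (us a (as ! i)))"
      if "a \<in> B" for a
      using that as i by (simp add: m lb_under_def br_under)
    moreover have "lb_over br (x, act x a) (?m ! i) = (act x (as ! i), act (act x (as ! i)) (os a (as ! i)))"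
      if "a \<in> B" for a
      using that as i by (simp add: m lb_over_def br_over)
    ultimately show ?thesis
      using t[of i] by (simp add: p mu_basis_def take_map drop_map subset_iff)
  qed
  show ?thesis
    unfolding p sb_bd_basis_def lb_bd_basis_def
    using 1 2 by (auto simp: mu_basis_def p frag_extend_sum frag_extend_cmul frag_extend_diff o_def
        intro!: sum.cong)
qed


section \<open>The isomorphism of chain groups and its effect on homology classes\<close>

lemma C_SB_simps:
  "carrier (C_SB B X n) = quot_cls (sb_basis B X n) (sb_degen B X n) ` {c. Poly_Mapping.keys c \<subseteq> sb_basis B X n}"
  "group (C_SB B X n)"
  by (simp_all add: C_SB_def carrier_free_quot group_free_quot sb_degen_subset)

lemma C_LB_simps:
  "carrier (C_LB X n) = quot_cls (lb_basis X n) (lb_degen X n) ` {c. Poly_Mapping.keys c \<subseteq> lb_basis X n}"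
  "group (C_LB X n)"
  by (simp_all add: C_LB_def carrier_free_quot group_free_quot lb_degen_subset)

abbreviation mu_ext :: "('x \<times> 'b list \<Rightarrow>\<^sub>0 int) \<Rightarrow> ('x \<times> 'x) list \<Rightarrow>\<^sub>0 int" where
  "mu_ext \<equiv> frag_extend (\<lambda>c. frag_of (mu_basis act c))"

abbreviation nu_ext :: "(('x \<times> 'x) list \<Rightarrow>\<^sub>0 int) \<Rightarrow> 'x \<times> 'b list \<Rightarrow>\<^sub>0 int" where
  "nu_ext \<equiv> frag_extend (\<lambda>c. frag_of (nu_basis c))"

lemma nu_mu_ext:
  assumes "Poly_Mapping.keys c \<subseteq> sb_basis B X n"
  shows "nu_ext (mu_ext c) = c"
proof -
  have "nu_ext (mu_ext c) = frag_extend (\<lambda>p. frag_of (nu_basis (mu_basis act p))) c"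
    using frag_extend_compose[of "\<lambda>p. frag_of (nu_basis p)" "mu_basis act" c] by (simp add: o_def)
  also have "\<dots> = frag_extend frag_of c"
    by (intro frag_extend_eq) (simp add: nu_mu[OF subsetD[OF assms]])
  finally show ?thesis by (simp flip: frag_expansion)
qed

lemma mu_nu_ext:
  assumes "Poly_Mapping.keys c \<subseteq> lb_basis X n"
  shows "mu_ext (nu_ext c) = c"
proof -
  have "mu_ext (nu_ext c) = frag_extend (\<lambda>p. frag_of (mu_basis act (nu_basis p))) c"
    using frag_extend_compose[of "\<lambda>p. frag_of (mu_basis act p)" nu_basis c] by (simp add: o_def)
  also have "\<dots> = frag_extend frag_of c"
    by (intro frag_extend_eq) (simp add: mu_nu[OF subsetD[OF assms]])
  finally show ?thesis by (simp flip: frag_expansion)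
qed

lemma mu_ext_degen:
  "Poly_Mapping.keys c \<subseteq> sb_degen B X n \<Longrightarrow> Poly_Mapping.keys (mu_ext c) \<subseteq> lb_degen X n"
  using mu_basis_degen by (elim keys_frag_extend_subset[rotated]) auto

lemma nu_ext_basis:
  "Poly_Mapping.keys c \<subseteq> lb_basis X n \<Longrightarrow> Poly_Mapping.keys (nu_ext c) \<subseteq> sb_basis B X n"
  using nu_basis_basis by (elim keys_frag_extend_subset[rotated]) auto

lemma nu_basis_degen: "q \<in> lb_degen X n \<Longrightarrow> nu_basis q \<in> sb_degen B X n"
  using mu_basis_degen_iff[OF nu_basis_basis(1), of q n] mu_nu[of q n] lb_degen_subset by auto

lemma nu_ext_degen:
  "Poly_Mapping.keys c \<subseteq> lb_degen X n \<Longrightarrow> Poly_Mapping.keys (nu_ext c) \<subseteq> sb_degen B X n"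
  using nu_basis_degen by (elim keys_frag_extend_subset[rotated]) auto

lemma mu_quot_cls:
  "mu X act n (quot_cls (sb_basis B X n) (sb_degen B X n) c)
     = quot_cls (lb_basis X n) (lb_degen X n) (mu_ext c)"
  unfolding mu_def
  using mu_basis_degen
  by (intro quot_map_frag_extend sb_degen_subset lb_degen_subset) auto

lemma mu_hom: "mu X act n \<in> hom (C_SB B X n) (C_LB X n)"
  unfolding mu_def C_SB_def C_LB_def
  using mu_basis_degen mu_basis_basis
  by (intro quot_map_frag_extend_hom sb_degen_subset lb_degen_subset) auto

text \<open>Already on the free groups \<open>nu_ext\<close> inverts \<open>mu_ext\<close>, and it
  preserves degenerate chains; hence a difference that becomes degenerate under
  \<open>mu_ext\<close> was degenerate before.\<close>

lemma mu_inj: "inj_on (mu X act n) (carrier (C_SB B X n))"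
proof (rule inj_onI)
  let ?q = "quot_cls (sb_basis B X n) (sb_degen B X n)"
  fix x y assume "x \<in> carrier (C_SB B X n)" "y \<in> carrier (C_SB B X n)" and eq: "mu X act n x = mu X act n y"
  then obtain c d where cd: "x = ?q c" "y = ?q d"
    "Poly_Mapping.keys c \<subseteq> sb_basis B X n" "Poly_Mapping.keys d \<subseteq> sb_basis B X n"
    by (auto simp: C_SB_simps)
  from eq have "Poly_Mapping.keys (mu_ext (c - d)) \<subseteq> lb_degen X n"
    by (simp add: cd mu_quot_cls quot_cls_eq_iff lb_degen_subset frag_extend_diff)
  from nu_ext_degen[OF this] have "Poly_Mapping.keys (c - d) \<subseteq> sb_degen B X n"
    using nu_mu_ext[OF keys_diff_subset[OF cd(3,4)]] by simp
  then show "x = y" by (simp add: cd quot_cls_eq_iff sb_degen_subset)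
qed

lemma mu_surj: "mu X act n ` carrier (C_SB B X n) = carrier (C_LB X n)"
proof
  show "mu X act n ` carrier (C_SB B X n) \<subseteq> carrier (C_LB X n)"
    using mu_hom by (auto simp: hom_def)
  show "carrier (C_LB X n) \<subseteq> mu X act n ` carrier (C_SB B X n)"
  proof
    fix y assume "y \<in> carrier (C_LB X n)"
    then obtain c where c: "y = quot_cls (lb_basis X n) (lb_degen X n) c" "Poly_Mapping.keys c \<subseteq> lb_basis X n"
      by (auto simp: C_LB_simps)
    then have "y = mu X act n (quot_cls (sb_basis B X n) (sb_degen B X n) (nu_ext c))"
      by (simp add: mu_quot_cls mu_nu_ext)
    then show "y \<in> mu X act n ` carrier (C_SB B X n)"
      using nu_ext_basis[OF c(2)] by (auto simp: C_SB_simps)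
  qed
qed

lemma bd_SB_2_quot_cls:
  "bd_SB B us os X act 2 (quot_cls (sb_basis B X 2) (sb_degen B X 2) c)
    = quot_cls (sb_basis B X 1) (sb_degen B X 1) (frag_extend (sb_bd_basis us os act) c)"
  unfolding bd_SB_def
  using quot_map_frag_extend[OF sb_degen_subset sb_degen_subset sb_bd_2_degen] by simp

lemma bd_SB_3_quot_cls:
  "bd_SB B us os X act 3 (quot_cls (sb_basis B X 3) (sb_degen B X 3) c)
    = quot_cls (sb_basis B X 2) (sb_degen B X 2) (frag_extend (sb_bd_basis us os act) c)"
  unfolding bd_SB_def
  using quot_map_frag_extend[OF sb_degen_subset sb_degen_subset sb_bd_3_degen] by simp

lemma bd_SB_3_hom: "bd_SB B us os X act 3 \<in> hom (C_SB B X 3) (C_SB B X 2)"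
  unfolding bd_SB_def C_SB_def
  using quot_map_frag_extend_hom[OF sb_degen_subset sb_degen_subset sb_bd_3_degen sb_bd_3_basis] by simp

lemma mu_bd_ext:
  assumes "Poly_Mapping.keys c \<subseteq> sb_basis B X n"
  shows "mu_ext (frag_extend (sb_bd_basis us os act) c) = frag_extend (lb_bd_basis br) (mu_ext c)"
proof -
  have "frag_extend (lb_bd_basis br) (mu_ext c) = frag_extend (\<lambda>p. lb_bd_basis br (mu_basis act p)) c"
    using frag_extend_compose[of "lb_bd_basis br" "mu_basis act" c] by (simp add: o_def)
  also have "\<dots> = frag_extend (\<lambda>p. mu_ext (sb_bd_basis us os act p)) c"
    by (intro frag_extend_eq) (simp add: mu_bd_basis[OF subsetD[OF assms]])
  also have "\<dots> = mu_ext (frag_extend (sb_bd_basis us os act) c)"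
    by (simp add: frag_extend_def[of "\<lambda>p. mu_ext (sb_bd_basis us os act p)"]
        frag_extend_def[of "sb_bd_basis us os act"] frag_extend_sum frag_extend_cmul o_def)
  finally show ?thesis by simp
qed

text \<open>Transported from the shadow complex instead of computed with brackets: the generator is
  the image of a degenerate shadow generator, and \<open>mu_basis\<close> commutes with the
  boundaries.\<close>

lemma lb_bd_3_degen:
  assumes "q \<in> lb_degen X 3"
  shows "Poly_Mapping.keys (lb_bd_basis br q) \<subseteq> lb_degen X 2"
proof -
  have q: "nu_basis q \<in> sb_degen B X 3" using nu_basis_degen[OF assms] .
  have "lb_bd_basis br q = mu_ext (sb_bd_basis us os act (nu_basis q))"
    using mu_bd_basis[OF subsetD[OF sb_degen_subset q]] mu_nu[OF subsetD[OF lb_degen_subset assms]] by simp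
  then show ?thesis using mu_ext_degen[OF sb_bd_3_degen[OF q]] by simp
qed

lemma mu_bd:
  assumes "x \<in> carrier (C_SB B X 3)"
  shows "mu X act 2 (bd_SB B us os X act 3 x) = bd_LB X br 3 (mu X act 3 x)"
proof -
  obtain c where c: "x = quot_cls (sb_basis B X 3) (sb_degen B X 3) c" "Poly_Mapping.keys c \<subseteq> sb_basis B X 3"
    using assms by (auto simp: C_SB_simps)
  have "bd_LB X br 3 (quot_cls (lb_basis X 3) (lb_degen X 3) d)
      = quot_cls (lb_basis X 2) (lb_degen X 2) (frag_extend (lb_bd_basis br) d)" for d
    unfolding bd_LB_def
    using quot_map_frag_extend[OF lb_degen_subset lb_degen_subset lb_bd_3_degen] by simp
  then show ?thesis
    by (simp add: c(1) mu_quot_cls bd_SB_3_quot_cls mu_bd_ext[OF c(2)])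
qed

lemma mu_boundaries:
  "mu X act 2 ` (bd_SB B us os X act 3 ` carrier (C_SB B X 3)) = bd_LB X br 3 ` carrier (C_LB X 3)"
  by (simp add: image_image mu_bd flip: mu_surj cong: image_cong_simp)

text \<open>The local boundaries form a subgroup because they are the image of the shadow boundaries
  under the homomorphism \<open>mu X act 2\<close>.\<close>

lemma boundaries_subgroup:
  "subgroup (bd_SB B us os X act 3 ` carrier (C_SB B X 3)) (C_SB B X 2)"
  "subgroup (bd_LB X br 3 ` carrier (C_LB X 3)) (C_LB X 2)"
proof -
  have h: "group_hom (C_SB B X 3) (C_SB B X 2) (bd_SB B us os X act 3)"
    by (simp add: group_hom_def group_hom_axioms_def C_SB_simps bd_SB_3_hom)
  show s: "subgroup (bd_SB B us os X act 3 ` carrier (C_SB B X 3)) (C_SB B X 2)"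
    by (rule group_hom.img_is_subgroup[OF h])
  have h': "group_hom (C_SB B X 2) (C_LB X 2) (mu X act 2)"
    by (simp add: group_hom_def group_hom_axioms_def C_SB_simps C_LB_simps mu_hom)
  show "subgroup (bd_LB X br 3 ` carrier (C_LB X 3)) (C_LB X 2)"
    using group_hom.subgroup_img_is_subgroup[OF h' s] by (simp add: mu_boundaries)
qed

text \<open>Instance of \<open>induced_coset_map\<close> with the boundaries as subgroup. Both parts
  hold for all 2-chains, not only for cycles.\<close>

lemma mu_star_cls:
  assumes "w \<in> carrier (C_SB B X 2)"
  shows "mu_star X act br 2 (cls_SB B us os X act 2 w) = cls_LB X br 2 (mu X act 2 w)"
    and "w' \<in> carrier (C_SB B X 2) \<Longrightarrow> cls_LB X br 2 (mu X act 2 w) = cls_LB X br 2 (mu X act 2 w')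
      \<Longrightarrow> cls_SB B us os X act 2 w = cls_SB B us os X act 2 w'"
  using induced_coset_map[OF C_SB_simps(2) C_LB_simps(2) mu_hom mu_inj boundaries_subgroup(1) _ assms]
    boundaries_subgroup(2)
  by (simp_all only: mu_star_def cls_SB_def cls_LB_def homology_cls_def mu_boundaries Suc_2)

lemma carrier_H_SB:
  "carrier (H_SB B us os X act 2) = cls_SB B us os X act 2 `
     kernel (C_SB B X 2) (C_SB B X 1) (bd_SB B us os X act 2)"
  by (auto simp: H_SB_def homology_def cycles_def carrier_FactGroup cls_SB_def homology_cls_def r_coset_def)

lemma cycle_in_kernel:
  assumes "Poly_Mapping.keys c \<subseteq> sb_basis B X 2" "frag_extend (sb_bd_basis us os act) c = 0"
  shows "quot_cls (sb_basis B X 2) (sb_degen B X 2) c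
    \<in> kernel (C_SB B X 2) (C_SB B X 1) (bd_SB B us os X act 2)"
proof -
  have "\<one>\<^bsub>C_SB B X 1\<^esub> = quot_cls (sb_basis B X 1) (sb_degen B X 1) 0"
    unfolding C_SB_def by (rule one_free_quot[OF sb_degen_subset])
  then have "bd_SB B us os X act 2 (quot_cls (sb_basis B X 2) (sb_degen B X 2) c) = \<one>\<^bsub>C_SB B X 1\<^esub>"
    by (simp only: bd_SB_2_quot_cls assms(2))
  then show ?thesis
    using assms by (simp add: kernel_def C_SB_simps)
qed

text \<open>\<open>inv_into\<close> returns a class only if it lies in the carrier of the homology
  group, so here w has to be a cycle. This is where the cycle property of weights enters.\<close>

lemma inv_mu_star_cls:
  assumes "w \<in> kernel (C_SB B X 2) (C_SB B X 1) (bd_SB B us os X act 2)"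
  shows "inv_into (carrier (H_SB B us os X act 2)) (mu_star X act br 2) (cls_LB X br 2 (mu X act 2 w))
    = cls_SB B us os X act 2 w"
proof -
  have "inj_on (mu_star X act br 2) (carrier (H_SB B us os X act 2))"
  proof (rule inj_onI)
    fix U V assume "U \<in> carrier (H_SB B us os X act 2)" "V \<in> carrier (H_SB B us os X act 2)"
      and eq: "mu_star X act br 2 U = mu_star X act br 2 V"
    then obtain u v where "u \<in> carrier (C_SB B X 2)" "v \<in> carrier (C_SB B X 2)"
      "U = cls_SB B us os X act 2 u" "V = cls_SB B us os X act 2 v"
      by (auto simp: carrier_H_SB kernel_def)
    with eq show "U = V" by (metis mu_star_cls)
  qed
  moreover have "w \<in> carrier (C_SB B X 2)" using assms by (simp add: kernel_def)
  moreover have "cls_SB B us os X act 2 w \<in> carrier (H_SB B us os X act 2)"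
    using assms by (simp add: carrier_H_SB)
  ultimately show ?thesis
    by (metis inv_into_f_f mu_star_cls(1))
qed

end

section \<open>Plane geometry\<close>

lemma normal_simps [simp]:
  "normal (v + w) = normal v + normal w" "normal (v - w) = normal v - normal w"
  "normal (- v) = - normal v" "normal (c *\<^sub>R v) = c *\<^sub>R normal v" "normal 0 = 0"
  by (simp_all add: normal_def algebra_simps)

lemma inner_normal [simp]:
  "v \<bullet> normal v = 0" "normal v \<bullet> v = 0" "normal v \<bullet> normal w = v \<bullet> w"
  by (simp_all add: normal_def inner_complex_def)

lemma inner_normal_swap: "v \<bullet> normal w = - (w \<bullet> normal v)"
  by (simp add: normal_def inner_complex_def)

lemma inner_normal_eq_0:
  assumes "w \<bullet> normal v = 0" "v \<noteq> 0"
  obtains s where "w = s *\<^sub>R v"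
proof -
  \<comment> \<open>The coefficient is that of the orthogonal projection of w to the line spanned by
    v.\<close>
  have "w = ((w \<bullet> v) / (v \<bullet> v)) *\<^sub>R v"
  proof -
    have nz: "Re v * Re v + Im v * Im v \<noteq> 0"
      using assms(2) by (simp add: complex_eq_iff sum_squares_eq_zero_iff)
    have "Im w * Re v = Re w * Im v"
      using assms(1) by (simp add: normal_def inner_complex_def)
    then show ?thesis
      using nz by (simp add: complex_eq_iff inner_complex_def field_simps)
  qed
  then show ?thesis by (rule that)
qed

lemma half_plane:
  fixes p w :: complex
  shows "convex {z. (z - p) \<bullet> w < 0}" "convex {z. (z - p) \<bullet> w > 0}"
      "open {z. (z - p) \<bullet> w < 0}" "open {z. (z - p) \<bullet> w > 0}"
  using convex_halfspace_lt[of w "p \<bullet> w"] convex_halfspace_gt[of "p \<bullet> w" w]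
      open_halfspace_lt[of w "p \<bullet> w"] open_halfspace_gt[of "p \<bullet> w" w]
  by (simp_all add: inner_diff_left inner_diff_right inner_commute)

text \<open>The sign near 0 is the lexicographic sign of (A, B). In the germ computations A is the
  position of the base point relative to an oriented line and B the slope of the direction relative
  to it.\<close>

lemma eventually_affine_pos:
  fixes A B :: real
  assumes "A > 0 \<or> A = 0 \<and> B > 0"
  shows "\<forall>\<^sub>F t in at_right 0. A + t * B > 0"
  using assms
proof
  assume "A > 0"
  have "((\<lambda>t. A + t * B) \<longlongrightarrow> A + 0 * B) (at_right 0)" by (intro tendsto_intros)
  then show ?thesis using order_tendstoD(1)[of _ "A + 0 * B" _ 0] \<open>A > 0\<close> by simp
next
  assume "A = 0 \<and> B > 0"
  then show ?thesis by (auto simp: eventually_at_filter)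
qed

section \<open>Germs of sets along a direction, and the two sides of a corner\<close>

lemma germ_in_Int: "germ_in p w S \<Longrightarrow> germ_in p w T \<Longrightarrow> germ_in p w (S \<inter> T)"
  unfolding germ_in_def by (simp add: eventually_conj)

lemma germ_in_mono: "germ_in p w S \<Longrightarrow> S \<subseteq> T \<Longrightarrow> germ_in p w T"
  unfolding germ_in_def by (erule eventually_mono) auto

lemma germ_in_open:
  assumes "open S" "p \<in> S"
  shows "germ_in p w S"
proof -
  have "((\<lambda>t. p + t *\<^sub>R w) \<longlongrightarrow> p + 0 *\<^sub>R w) (at_right 0)" by (intro tendsto_intros)
  then show ?thesis unfolding germ_in_def using topological_tendstoD[OF _ assms(1)] assms(2) by fastforce
qed

lemma germ_in_nonempty:
  assumes "germ_in p w S"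
  shows "S \<noteq> {}"
  using assms eventually_happens[of _ "at_right (0::real)"] by (auto simp: germ_in_def)

text \<open>The two sides of the path that arrives at \<open>p\<close> with direction \<open>v1\<close> and leaves with direction \<open>v2\<close>.\<close>

definition corner_sides :: "complex \<Rightarrow> complex \<Rightarrow> complex \<Rightarrow> complex set \<Rightarrow> complex set \<Rightarrow> bool" where
  "corner_sides p v1 v2 L R \<longleftrightarrow>
     open L \<and> open R \<and> L \<inter> R = {} \<and>
     L \<union> R = - {z. \<exists>s\<ge>0. z = p - s *\<^sub>R v1 \<or> z = p + s *\<^sub>R v2} \<and>
     (\<forall>\<delta>>0. connected (L \<inter> ball p \<delta>) \<and> connected (R \<inter> ball p \<delta>)) \<and>
     (\<forall>s. s > 0 \<or> s = 0 \<and> v1 = v2 \<longrightarrow>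
        germ_in (p - s *\<^sub>R v1) (normal v1) L \<and> germ_in (p - s *\<^sub>R v1) (- normal v1) R \<and>
        germ_in (p + s *\<^sub>R v2) (normal v2) L \<and> germ_in (p + s *\<^sub>R v2) (- normal v2) R)"

text \<open>For a left turn or a straight path the left side is the intersection of the two left
  half-planes, hence convex, and the right side is the union of the two right half-planes, which
  stays connected in every ball about p because the two halves overlap there.\<close>

lemma corner_sides_left:
  assumes "v1 \<noteq> 0" "v2 \<noteq> 0" "v2 \<bullet> normal v1 > 0 \<or> (\<exists>c>0. v2 = c *\<^sub>R v1)"
  shows "\<exists>L R. corner_sides p v1 v2 L R"
proof -
  define a where "a = v2 \<bullet> normal v1"
  define L where "L = {z. (z - p) \<bullet> normal v1 > 0} \<inter> {z. (z - p) \<bullet> normal v2 > 0}"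
  define R where "R = {z. (z - p) \<bullet> normal v1 < 0} \<union> {z. (z - p) \<bullet> normal v2 < 0}"
  have n: "normal v1 \<bullet> normal v1 > 0" "normal v2 \<bullet> normal v2 > 0"
    using assms by simp_all
  have a: "a > 0 \<or> a = 0 \<and> normal v1 \<bullet> normal v2 > 0"
    using assms n unfolding a_def by auto
  then have a0: "a \<ge> 0" by auto
  have a': "v1 \<bullet> normal v2 = - a" unfolding a_def by (rule inner_normal_swap)
  have "connected (L \<inter> ball p \<delta>)" for \<delta>
    unfolding L_def by (intro convex_connected convex_Int half_plane convex_ball)
  moreover have "connected (R \<inter> ball p \<delta>)" if "\<delta> > 0" for \<delta>
  proof -
    \<comment> \<open>A direction in both right half-planes. For a proper left turn
      \<open>v1 - v2\<close> points out of the corner, with both products equal to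
      \<open>- a\<close>; for a straight path the negative normal serves.\<close>
    obtain w where w: "w \<bullet> normal v1 < 0" "w \<bullet> normal v2 < 0"
    proof (cases "a > 0")
      case True
      then show ?thesis using that[of "v1 - v2"] a' by (simp add: inner_diff_left a_def)
    next
      case False
      then show ?thesis using that[of "- normal v1"] a n by simp
    qed
    have "w \<noteq> 0" using w by auto
    define z where "z = p + (\<delta> / (2 * norm w)) *\<^sub>R w"
    have "z \<in> ball p \<delta>" using \<open>w \<noteq> 0\<close> \<open>\<delta> > 0\<close> by (simp add: z_def dist_norm)
    moreover have "(z - p) \<bullet> normal v1 < 0" "(z - p) \<bullet> normal v2 < 0"
      using w \<open>w \<noteq> 0\<close> \<open>\<delta> > 0\<close> by (auto simp: z_def mult_pos_neg divide_neg_pos)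
    ultimately show ?thesis
      unfolding R_def Int_Un_distrib2
      by (intro connected_Un convex_connected convex_Int half_plane convex_ball) blast
  qed
  moreover have "L \<union> R = - {z. \<exists>s\<ge>0. z = p - s *\<^sub>R v1 \<or> z = p + s *\<^sub>R v2}"
  proof (intro subset_antisym subsetI)
    fix z assume z: "z \<in> L \<union> R"
    show "z \<in> - {z. \<exists>s\<ge>0. z = p - s *\<^sub>R v1 \<or> z = p + s *\<^sub>R v2}"
      using z a0 a' by (auto simp: L_def R_def mult_less_0_iff simp flip: a_def)
  next
    fix z assume z: "z \<in> - {z. \<exists>s\<ge>0. z = p - s *\<^sub>R v1 \<or> z = p + s *\<^sub>R v2}"
    have zn: "z \<noteq> p - s *\<^sub>R v1" "z \<noteq> p + s *\<^sub>R v2" if "s \<ge> 0" for s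
      using z that by auto
    show "z \<in> L \<union> R"
    proof (rule ccontr)
      assume "z \<notin> L \<union> R"
      then have h: "(z - p) \<bullet> normal v1 \<ge> 0" "(z - p) \<bullet> normal v2 \<ge> 0"
        "(z - p) \<bullet> normal v1 = 0 \<or> (z - p) \<bullet> normal v2 = 0"
        by (auto simp: L_def R_def)
      from h(3) show False
      proof
        assume "(z - p) \<bullet> normal v1 = 0"
        then obtain s where s: "z - p = s *\<^sub>R v1" using inner_normal_eq_0 assms(1) by blast
        show False
        proof (cases "a = 0")
          case True
          with assms(3) obtain c where c: "c > 0" "v2 = c *\<^sub>R v1" by (auto simp: a_def)
          then have "z = p - (- s) *\<^sub>R v1" "z = p + (s / c) *\<^sub>R v2" using s by (auto simp: algebra_simps)
          then show False using zn(1)[of "- s"] zn(2)[of "s / c"] c(1) by (cases "s \<ge> 0") auto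
        next
          case False
          then have "s \<le> 0" using h(2) a0 a' s by (simp add: mult_le_0_iff)
          moreover have "z = p - (- s) *\<^sub>R v1" using s by (simp add: algebra_simps)
          ultimately show False using zn(1)[of "- s"] by simp
        qed
      next
        assume "(z - p) \<bullet> normal v2 = 0"
        then obtain s where s: "z - p = s *\<^sub>R v2" using inner_normal_eq_0 assms(2) by blast
        show False
        proof (cases "a = 0")
          case True
          with assms(3) obtain c where c: "c > 0" "v2 = c *\<^sub>R v1" by (auto simp: a_def)
          then have "z = p + s *\<^sub>R v2" "z = p - (- s * c) *\<^sub>R v1" using s by (auto simp: algebra_simps)
          then show False using zn(1)[of "- s * c"] zn(2)[of s] c(1)
            by (cases "s \<ge> 0") (auto simp: mult_le_0_iff)
        next
          case False
          then have "s \<ge> 0" using h(1) a0 s by (simp add: zero_le_mult_iff flip: a_def)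
          moreover have "z = p + s *\<^sub>R v2" using s by (simp add: algebra_simps)
          ultimately show False using zn(2)[of s] by simp
        qed
      qed
    qed
  qed
  moreover have "germ_in (p - s *\<^sub>R v1) (normal v1) L \<and> germ_in (p - s *\<^sub>R v1) (- normal v1) R \<and>
        germ_in (p + s *\<^sub>R v2) (normal v2) L \<and> germ_in (p + s *\<^sub>R v2) (- normal v2) R"
    if s: "s > 0 \<or> s = 0 \<and> v1 = v2" for s
  proof -
    \<comment> \<open>At parameter s on one arm, the position relative to the line of the other arm
      is \<open>s * a\<close>. If that vanishes, the direction of the normal decides.\<close>
    have sa: "s * a > 0 \<or> s * a = 0 \<and> normal v1 \<bullet> normal v2 > 0"
      using s a n by auto
    have ev: "\<forall>\<^sub>F t in at_right 0. t * (normal v1 \<bullet> normal v1) > 0"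
       "\<forall>\<^sub>F t in at_right 0. t * (normal v2 \<bullet> normal v2) > 0"
      using eventually_affine_pos[of 0] n by auto
    have "\<forall>\<^sub>F t in at_right 0. s * a + t * (normal v1 \<bullet> normal v2) > 0"
      using eventually_affine_pos[OF sa] .
    then have E: "\<forall>\<^sub>F t in at_right 0. t * (v1 \<bullet> v1) > 0 \<and> t * (v2 \<bullet> v2) > 0 \<and> s * a + t * (v1 \<bullet> v2) > 0"
      using ev by (simp add: eventually_conj)
    note simps = inner_add_left inner_diff_left a' a_def[symmetric] inner_commute[of v2 v1]
    show ?thesis
      unfolding germ_in_def L_def R_def
      by (intro conjI; rule eventually_mono[OF E]) (simp_all add: simps)
  qed
  ultimately have "corner_sides p v1 v2 L R"
    unfolding corner_sides_def using half_plane by (auto simp: L_def R_def)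
  then show ?thesis by blast
qed

text \<open>Travelled backwards, the path arrives with direction \<open>- v2\<close> and leaves with
  \<open>- v1\<close>, and its left and right sides change places.\<close>

lemma corner_sides_reverse:
  assumes "corner_sides p (- v2) (- v1) L R"
  shows "corner_sides p v1 v2 R L"
  using assms unfolding corner_sides_def by (simp add: ac_simps) blast

text \<open>A right turn is a left turn travelled backwards. The hypothesis excludes a path that
  folds back onto itself and has only one side.\<close>

lemma corner_sides_exist:
  assumes "v1 \<noteq> 0" "v2 \<noteq> 0" "\<And>c. c > 0 \<Longrightarrow> v2 \<noteq> - c *\<^sub>R v1"
  shows "\<exists>L R. corner_sides p v1 v2 L R"
proof -
  consider "v2 \<bullet> normal v1 > 0" | "v2 \<bullet> normal v1 < 0" | "v2 \<bullet> normal v1 = 0" by linarith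
  then show ?thesis
  proof cases
    case 1 then show ?thesis using corner_sides_left assms by blast
  next
    case 2
    then have "(- v1) \<bullet> normal (- v2) > 0" using inner_normal_swap[of v1 v2] by simp
    then show ?thesis using corner_sides_left[of "- v2" "- v1"] assms corner_sides_reverse by fastforce
  next
    case 3
    then obtain s where s: "v2 = s *\<^sub>R v1" using inner_normal_eq_0 assms(1) by blast
    have "s > 0"
    proof (rule ccontr)
      assume "\<not> s > 0"
      moreover have "s \<noteq> 0" using s assms(2) by auto
      ultimately show False using assms(3)[of "- s"] s by simp
    qed
    then show ?thesis using corner_sides_left assms s by blast
  qed
qed

section \<open>Local structure of a diagram\<close>

definition dir :: "pt \<times> pt \<Rightarrow> complex" where
  "dir e = fst (snd e) - fst (fst e)"

definition lift_at :: "pt \<times> pt \<Rightarrow> real \<Rightarrow> pt" where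
  "lift_at e t = fst e + t *\<^sub>R (snd e - fst e)"

definition pnt :: "pt \<times> pt \<Rightarrow> real \<Rightarrow> complex" where
  "pnt e t = fst (fst e) + t *\<^sub>R dir e"

definition oseg :: "pt \<times> pt \<Rightarrow> complex set" where
  "oseg e = open_segment (fst (fst e)) (fst (snd e))"

lemma fst_lift_at: "fst (lift_at e t) = pnt e t"
  by (simp add: lift_at_def pnt_def dir_def)

lemma seg_eq: "seg e = lift_at e ` {0..1}"
  unfolding seg_def closed_segment_image_interval
  by (intro image_cong refl) (simp add: lift_at_def algebra_simps)

lemma lift_at_0 [simp]: "lift_at e 0 = fst e" and lift_at_1 [simp]: "lift_at e 1 = snd e"
  by (simp_all add: lift_at_def)

lemma pnt_add: "pnt e (t + x) = pnt e t + x *\<^sub>R dir e"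
  by (simp add: pnt_def algebra_simps)

lemma oseg_eq: "dir e \<noteq> 0 \<Longrightarrow> oseg e = pnt e ` {0<..<1}"
  unfolding oseg_def open_segment_image_interval
  by (auto simp: dir_def pnt_def algebra_simps intro!: image_cong)

lemma pnt_inj: "dir e \<noteq> 0 \<Longrightarrow> pnt e s = pnt e t \<longleftrightarrow> s = t"
  by (auto simp: pnt_def)

text \<open>L and R are the local left and right sides. Connectedness is recorded for all smaller
  concentric balls because overlapping charts are later compared in a ball of a third of the radius.
  The last clause supplies interior points of an edge arbitrarily near p even if p is the image of a
  vertex.\<close>

definition noncrossing_chart ::
  "edges \<Rightarrow> complex \<Rightarrow> real \<Rightarrow> complex set \<Rightarrow> complex set \<Rightarrow> bool" where
  "noncrossing_chart D p \<epsilon> L R \<longleftrightarrow>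
     0 < \<epsilon> \<and> open L \<and> open R \<and> L \<inter> R = {} \<and> L \<union> R = ball p \<epsilon> - projection D \<and>
     ball p \<epsilon> \<inter> crossings D = {} \<and>
     (\<forall>\<delta>. 0 < \<delta> \<longrightarrow> \<delta> \<le> \<epsilon> \<longrightarrow> connected (L \<inter> ball p \<delta>) \<and> connected (R \<inter> ball p \<delta>) \<and>
        connected (projection D \<inter> ball p \<delta>)) \<and>
     (\<forall>e\<in>D. \<forall>q\<in>ball p \<epsilon> \<inter> oseg e.
        germ_in q (normal (dir e)) L \<and> germ_in q (- normal (dir e)) R) \<and>
     (\<exists>e\<in>D. \<forall>\<delta>>0. ball p \<delta> \<inter> oseg e \<noteq> {})"

text \<open>In the ball the diagram is a pair of transverse lines, given as zero sets of two linear
  forms whose signs will number the four quadrants. \<open>eu\<close> carries the under-strand and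
  \<open>ev\<close> the over-strand.\<close>

definition crossing_chart ::
  "edges \<Rightarrow> complex \<Rightarrow> real \<Rightarrow> pt \<times> pt \<Rightarrow> pt \<times> pt \<Rightarrow> bool" where
  "crossing_chart D p \<epsilon> eu ev \<longleftrightarrow>
     0 < \<epsilon> \<and> eu \<in> D \<and> ev \<in> D \<and> under_dir D p = dir eu \<and> over_dir D p = dir ev \<and>
     dir eu \<bullet> normal (dir ev) \<noteq> 0 \<and> ball p \<epsilon> \<inter> crossings D = {p} \<and>
     ball p \<epsilon> \<inter> projection D =
       ball p \<epsilon> \<inter> {z. (z - p) \<bullet> normal (dir eu) = 0 \<or> (z - p) \<bullet> normal (dir ev) = 0} \<and>
     (\<forall>q\<in>ball p \<epsilon>. (q \<in> oseg eu \<longleftrightarrow> (q - p) \<bullet> normal (dir eu) = 0) \<and>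
        (q \<in> oseg ev \<longleftrightarrow> (q - p) \<bullet> normal (dir ev) = 0) \<and>
        (\<forall>e\<in>D. q \<in> oseg e \<longrightarrow> e = eu \<or> e = ev))"

lemma param_near:
  fixes t :: real
  assumes "t \<in> {0..1}"
  shows "\<exists>\<delta>>0. \<forall>x. \<bar>x\<bar> < \<delta> \<longrightarrow>
    (t + x \<in> {0..1} \<longleftrightarrow> (t = 0 \<longrightarrow> x \<ge> 0) \<and> (t = 1 \<longrightarrow> x \<le> 0)) \<and>
    (t + x \<in> {0<..<1} \<longleftrightarrow> (t = 0 \<longrightarrow> x > 0) \<and> (t = 1 \<longrightarrow> x < 0))"
\<comment> \<open>The distance to the nearer end of the unit interval; at an end itself only the
  opposite end limits the displacement, whence 1.\<close>
proof (rule exI[of _ "if t = 0 \<or> t = 1 then 1 else min t (1 - t)"])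
qed (use assms in \<open>auto simp: abs_less_iff\<close>)

locale regular_diagram =
  fixes D :: edges
  assumes regular: "regular_position D"
begin

abbreviation K :: "complex set" where "K \<equiv> projection D"

lemma finite_D: "finite D" and D_nonempty: "D \<noteq> {}"
  and edge_neq: "e \<in> D \<Longrightarrow> fst e \<noteq> snd e"
  and fst_snd_D: "fst ` D = snd ` D" and inj_fst: "inj_on fst D" and inj_snd: "inj_on snd D"
  and seg_Int: "e \<in> D \<Longrightarrow> e' \<in> D \<Longrightarrow> e \<noteq> e' \<Longrightarrow> seg e \<inter> seg e' \<subseteq> {fst e, snd e} \<inter> {fst e', snd e'}"
  and finite_preimages: "finite (preimages D p)" and card_preimages: "card (preimages D p) \<le> 2"
  and finite_crossings: "finite (crossings D)"
  and tail_not_crossing: "e \<in> D \<Longrightarrow> fst (fst e) \<notin> crossings D"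
  using regular by (auto simp: regular_position_def oriented_link_def split: prod.splits)

lemma head_not_crossing: "e \<in> D \<Longrightarrow> fst (snd e) \<notin> crossings D"
proof -
  assume "e \<in> D"
  then obtain e' where "e' \<in> D" "fst e' = snd e" using fst_snd_D by (metis image_iff)
  then show ?thesis using tail_not_crossing[of e'] by simp
qed

lemma body_iff: "q \<in> body D \<longleftrightarrow> (\<exists>e\<in>D. \<exists>t\<in>{0..1}. q = lift_at e t)"
  by (auto simp: body_def seg_eq)

lemma K_iff: "p \<in> K \<longleftrightarrow> (\<exists>e\<in>D. \<exists>t\<in>{0..1}. p = pnt e t)"
  unfolding projection_def image_iff by (metis body_iff fst_lift_at)

lemma lift_at_preimages: "e \<in> D \<Longrightarrow> t \<in> {0..1} \<Longrightarrow> lift_at e t \<in> preimages D (pnt e t)"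
  unfolding preimages_def body_iff by (auto simp: fst_lift_at simp del: atLeastAtMost_iff)

lemma lift_at_inj: "e \<in> D \<Longrightarrow> lift_at e s = lift_at e t \<longleftrightarrow> s = t"
  using edge_neq[of e, symmetric] by (auto simp: lift_at_def)

lemma lift_at_eq:
  assumes "e \<in> D" "e' \<in> D" "e \<noteq> e'" "s \<in> {0..1}" "t \<in> {0..1}" "lift_at e s = lift_at e' t"
  shows "s \<in> {0, 1}" "t \<in> {0, 1}"
proof -
  have "lift_at e s \<in> seg e" unfolding seg_eq using assms(4) by (rule imageI)
  moreover have "lift_at e s \<in> seg e'" unfolding seg_eq assms(6) using assms(5) by (rule imageI)
  ultimately
  have "lift_at e s \<in> {lift_at e 0, lift_at e 1}" "lift_at e' t \<in> {lift_at e' 0, lift_at e' 1}"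
    using subsetD[OF seg_Int[OF assms(1-3)], of "lift_at e s"] assms(6) by auto
  then show "s \<in> {0, 1}" "t \<in> {0, 1}"
    using lift_at_inj[OF assms(1), of s 0] lift_at_inj[OF assms(1), of s 1]
      lift_at_inj[OF assms(2), of t 0] lift_at_inj[OF assms(2), of t 1] by auto
qed

lemma lift_at_eq_interior:
  assumes "e \<in> D" "e' \<in> D" "s \<in> {0<..<1}" "t \<in> {0..1}" "lift_at e s = lift_at e' t"
  shows "e = e' \<and> s = t"
proof -
  have "e = e'" using lift_at_eq(1)[OF assms(1,2) _ _ assms(4,5)] assms(3) by fastforce
  then show ?thesis using assms(5) lift_at_inj[OF assms(1)] by simp
qed

lemma dir_nonzero: "e \<in> D \<Longrightarrow> dir e \<noteq> 0"
proof
  assume e: "e \<in> D" "dir e = 0"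
  then have "lift_at e ` {0..1} \<subseteq> preimages D (pnt e 0)"
    using lift_at_preimages[of e] by (auto simp: pnt_def)
  moreover have "infinite (lift_at e ` {0..1})"
    using e(1) by (subst finite_image_iff) (auto simp: inj_on_def lift_at_inj)
  ultimately show False using finite_preimages finite_subset by blast
qed

section \<open>The edges that pass over a given point of the plane\<close>

lemma crossingI:
  assumes "q \<in> preimages D p" "q' \<in> preimages D p" "q \<noteq> q'"
  shows "p \<in> crossings D" "preimages D p = {q, q'}"
proof -
  have "{q, q'} \<subseteq> preimages D p" "card {q, q'} = 2" using assms by auto
  then have "preimages D p = {q, q'}"
    using card_preimages[of p] finite_preimages[of p] card_subset_eq card_mono
    by (metis le_antisym)
  then show "p \<in> crossings D" "preimages D p = {q, q'}"
    using \<open>card {q, q'} = 2\<close> by (auto simp: crossings_def)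
qed

text \<open>Different edges meet in space at common vertices only, so an interior point of one and a
  point of the other with the same projection are two distinct preimages.\<close>

lemma pnt_eq_interior:
  assumes "e \<in> D" "e' \<in> D" "e \<noteq> e'" "s \<in> {0<..<1}" "t \<in> {0..1}" "pnt e s = pnt e' t"
  shows "pnt e s \<in> crossings D"
proof -
  have s: "s \<in> {0..1}" using assms(4) by auto
  moreover have "lift_at e s \<noteq> lift_at e' t"
    using lift_at_eq(1)[OF assms(1-3) s assms(5)] assms(4) by auto
  ultimately show ?thesis
    using crossingI(1) lift_at_preimages[OF assms(1)] lift_at_preimages[OF assms(2,5)] assms(6) by metis
qed

text \<open>Vertices do not project to crossings, so both preimages are interior points of edges,
  and an edge projects injectively, so the two edges differ. Two points over the same p differ in
  height, which orders them.\<close>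

lemma crossing_edges:
  assumes "p \<in> crossings D"
  obtains eu ev t u where "eu \<in> D" "ev \<in> D" "eu \<noteq> ev" "t \<in> {0<..<1}" "u \<in> {0<..<1}"
    "pnt eu t = p" "pnt ev u = p" "snd (lift_at eu t) < snd (lift_at ev u)"
    "\<And>e s. e \<in> D \<Longrightarrow> s \<in> {0..1} \<Longrightarrow> pnt e s = p \<Longrightarrow> (e, s) = (eu, t) \<or> (e, s) = (ev, u)"
proof -
  have "card (preimages D p) = 2" using assms by (simp add: crossings_def)
  then obtain q1 q2 where q: "preimages D p = {q1, q2}" "q1 \<noteq> q2" by (auto simp: card_2_iff)
  then have "fst q1 = p" "fst q2 = p" by (auto simp: preimages_def)
  then have "snd q1 \<noteq> snd q2" using q(2) by (auto simp: prod_eq_iff)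
  then obtain q q' where q: "preimages D p = {q, q'}" "snd q < snd q'"
    using q by (metis insert_commute linorder_neqE)
  then have "q \<in> preimages D p" "q' \<in> preimages D p" by auto
  then obtain eu ev t u where e: "eu \<in> D" "ev \<in> D" "t \<in> {0..1}" "u \<in> {0..1}"
     "q = lift_at eu t" "q' = lift_at ev u" "pnt eu t = p" "pnt ev u = p"
    by (auto simp: preimages_def body_iff fst_lift_at)
  have int: "t \<in> {0<..<1}" if "e \<in> D" "t \<in> {0..1}" "pnt e t = p" for e t
  proof -
    have "t \<noteq> 0" using tail_not_crossing[OF that(1)] assms that by (auto simp: pnt_def)
    moreover have "t \<noteq> 1" using head_not_crossing[OF that(1)] assms that by (auto simp: pnt_def dir_def)
    ultimately show ?thesis using that(2) by auto
  qed
  have "eu \<noteq> ev"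
  proof
    assume "eu = ev"
    then have "t = u" using e(7,8) pnt_inj[OF dir_nonzero[OF e(1)], of t u] by simp
    then show False using \<open>eu = ev\<close> e(5,6) q(2) by simp
  qed
  moreover have "(e, s) = (eu, t) \<or> (e, s) = (ev, u)"
    if es: "e \<in> D" "s \<in> {0..1}" "pnt e s = p" for e s
  proof -
    have "lift_at e s \<in> {q, q'}" using lift_at_preimages[OF es(1,2)] q es by simp
    then show ?thesis
      using lift_at_eq_interior[OF es(1) e(1) int[OF es] e(3)]
        lift_at_eq_interior[OF es(1) e(2) int[OF es] e(4)] e(5,6) by blast
  qed
  ultimately show ?thesis using that e q int by blast
qed

text \<open>An interior point of an edge is treated as a straight corner with
  \<open>e1 = e2\<close>, so that in every case the diagram arrives at p along \<open>e1\<close> and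
  leaves along \<open>e2\<close>. At a vertex these are the edges with parameters 1 and 0.\<close>

lemma noncrossing_edges:
  assumes "p \<in> K" "p \<notin> crossings D"
  obtains e1 e2 t1 t2 where "e1 \<in> D" "e2 \<in> D" "t1 \<in> {0..1}" "t2 \<in> {0..1}"
    "pnt e1 t1 = p" "pnt e2 t2 = p"
    "e1 = e2 \<and> t1 = t2 \<and> t1 \<in> {0<..<1} \<or> e1 \<noteq> e2 \<and> t1 = 1 \<and> t2 = 0"
    "\<And>e s. e \<in> D \<Longrightarrow> s \<in> {0..1} \<Longrightarrow> pnt e s = p \<Longrightarrow> (e, s) = (e1, t1) \<or> (e, s) = (e2, t2)"
proof -
  obtain e t where e: "e \<in> D" "t \<in> {0..1}" "p = pnt e t" using assms(1) K_iff by auto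
  have same: "lift_at e' s = lift_at e t" if "e' \<in> D" "s \<in> {0..1}" "pnt e' s = p" for e' s
    using that e assms(2)
    by (metis crossingI(1) lift_at_preimages)
  show ?thesis
  proof (cases "t \<in> {0<..<1}")
    case True
    have u: "(e', s) = (e, t)" if "e' \<in> D" "s \<in> {0..1}" "pnt e' s = p" for e' s
      using lift_at_eq_interior[OF e(1) that(1) True that(2)] same[OF that] by simp
    show ?thesis
      by (rule that[OF e(1) e(1) e(2) e(2)]) (use True e(3) u in blast)+
  next
    case False
    then have "t = 0 \<or> t = 1" using e(2) by auto
    then have "lift_at e t \<in> {fst e, snd e}" by auto
    then have "lift_at e t \<in> fst ` D" "lift_at e t \<in> snd ` D" using fst_snd_D e(1) by auto
    then obtain e1 e2 where e12: "e1 \<in> D" "snd e1 = lift_at e t" "e2 \<in> D" "fst e2 = lift_at e t"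
      unfolding image_iff by metis
    then have neq: "e1 \<noteq> e2" using edge_neq[OF e12(1)] by metis
    have u: "(e', s) = (e1, 1) \<or> (e', s) = (e2, 0)" if e': "e' \<in> D" "s \<in> {0..1}" "pnt e' s = p" for e' s
    proof (cases "e' = e1")
      case True
      then show ?thesis using same[OF e'] e12 lift_at_inj[OF e12(1), of s 1] by simp
    next
      case False
      then have "s \<in> {0, 1}"
        using lift_at_eq(1)[OF e'(1) e12(1) _ e'(2), of 1] same[OF e'] e12 by simp
      moreover have "s \<noteq> 1"
        using same[OF e'] False e12(2) inj_onD[OF inj_snd _ e'(1) e12(1)] by auto
      ultimately have "s = 0" by simp
      then show ?thesis using same[OF e'] e12(4) inj_onD[OF inj_fst _ e'(1) e12(3)] by simp
    qed
    have p: "pnt e1 1 = p" "pnt e2 0 = p"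
      using e12 e(3) fst_lift_at[of e1 1] fst_lift_at[of e2 0] fst_lift_at[of e t] by simp_all
    show ?thesis
    proof (rule that[OF e12(1) e12(3) _ _ p])
      show "e1 = e2 \<and> (1::real) = 0 \<and> (1::real) \<in> {0<..<1} \<or> e1 \<noteq> e2 \<and> (1::real) = 1 \<and> (0::real) = 0"
        using neq by simp
    qed (use u in simp_all)
  qed
qed

text \<open>Two arms at \<open>p\<close> with the same direction would overlap in infinitely many crossings.\<close>

lemma no_overlap:
  assumes "e \<in> D" "e' \<in> D" "e \<noteq> e'" "t \<in> {0..1}" "t' \<in> {0..1}" "pnt e t = pnt e' t'"
    and "c > 0" "\<sigma>' *\<^sub>R dir e' = c *\<^sub>R \<sigma> *\<^sub>R dir e" "\<sigma> \<in> {1, - 1}" "\<sigma>' \<in> {1, - 1}"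
    and "\<sigma> = 1 \<Longrightarrow> t < 1" "\<sigma> = - 1 \<Longrightarrow> t > 0" "\<sigma>' = 1 \<Longrightarrow> t' < 1" "\<sigma>' = - 1 \<Longrightarrow> t' > 0"
  shows False
proof -
  have room: "\<exists>\<delta>>0. \<forall>x\<in>{0<..<\<delta>}. t + \<sigma> * x \<in> {0<..<1}" if "t \<in> {0..1}" "\<sigma> \<in> {1, - 1}"
    "\<sigma> = 1 \<Longrightarrow> t < 1" "\<sigma> = - 1 \<Longrightarrow> t > 0" for t \<sigma> :: real
    using that by (intro exI[of _ "if \<sigma> = 1 then 1 - t else t"]) auto
  obtain \<delta> where d: "\<delta> > 0" "\<forall>x\<in>{0<..<\<delta>}. t + \<sigma> * x \<in> {0<..<1}"
    using room[OF assms(4,9,11,12)] by blast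
  obtain \<delta>' where d': "\<delta>' > 0" "\<forall>x\<in>{0<..<\<delta>'}. t' + \<sigma>' * x \<in> {0<..<1}"
    using room[OF assms(5,10,13,14)] by blast
  \<comment> \<open>A displacement x along the arm of \<open>e\<close> is the displacement x/c along
    the arm of \<open>e'\<close>, so the range of the second arm is scaled by c.\<close>
  define m where "m = min \<delta> (c * \<delta>')"
  have m: "m > 0" using d(1) d'(1) assms(7) by (simp add: m_def)
  have "pnt e (t + \<sigma> * x) \<in> crossings D" if x: "x \<in> {0<..<m}" for x
  proof -
    have "x / c \<in> {0<..<\<delta>'}" using x assms(7) by (auto simp: m_def field_simps)
    then have "t' + \<sigma>' * (x / c) \<in> {0..1}" using bspec[OF d'(2)] by fastforce
    moreover have "t + \<sigma> * x \<in> {0<..<1}" using bspec[OF d(2), of x] x by (simp add: m_def)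
    moreover have "pnt e (t + \<sigma> * x) = pnt e' (t' + \<sigma>' * (x / c))"
    proof -
      have "(\<sigma>' * (x / c)) *\<^sub>R dir e' = (x / c) *\<^sub>R (\<sigma>' *\<^sub>R dir e')" by (simp add: mult.commute)
      also have "\<dots> = (\<sigma> * x) *\<^sub>R dir e" using assms(7,8) by (simp add: mult.commute)
      finally show ?thesis using assms(6) by (simp only: pnt_add)
    qed
    ultimately show ?thesis using pnt_eq_interior assms(1-3) by blast
  qed
  then have "(\<lambda>x. pnt e (t + \<sigma> * x)) ` {0<..<m} \<subseteq> crossings D" by blast
  moreover have "inj_on (\<lambda>x. pnt e (t + \<sigma> * x)) {0<..<m}"
    using assms(9) by (auto simp: inj_on_def pnt_inj dir_nonzero[OF assms(1)])
  ultimately show False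
    using m finite_crossings by (metis finite_imageD finite_subset infinite_Ioo)
qed

text \<open>Each of the conditions holds for all small radii and there are finitely many edges, so
  they hold together. Writing parameters as \<open>t + x\<close> covers interior points and both
  ends in one statement: inside the ball only the end at p itself can restrict x.\<close>

lemma near_point:
  obtains \<epsilon> where "\<epsilon> > 0"
    "\<And>e t x. e \<in> D \<Longrightarrow> t \<in> {0..1} \<Longrightarrow> pnt e t = p \<Longrightarrow> pnt e (t + x) \<in> ball p \<epsilon> \<Longrightarrow>
      (t + x \<in> {0..1} \<longleftrightarrow> (t = 0 \<longrightarrow> x \<ge> 0) \<and> (t = 1 \<longrightarrow> x \<le> 0)) \<and>
      (t + x \<in> {0<..<1} \<longleftrightarrow> (t = 0 \<longrightarrow> x > 0) \<and> (t = 1 \<longrightarrow> x < 0))"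
    "\<And>e. e \<in> D \<Longrightarrow> p \<notin> pnt e ` {0..1} \<Longrightarrow> ball p \<epsilon> \<inter> pnt e ` {0..1} = {}"
    "ball p \<epsilon> \<inter> crossings D \<subseteq> {p}"
proof -
  let ?P = "\<lambda>e \<epsilon>. \<forall>t\<in>{0..1}. \<forall>x. pnt e t = p \<longrightarrow> pnt e (t + x) \<in> ball p \<epsilon> \<longrightarrow>
      (t + x \<in> {0..1} \<longleftrightarrow> (t = 0 \<longrightarrow> x \<ge> 0) \<and> (t = 1 \<longrightarrow> x \<le> 0)) \<and>
      (t + x \<in> {0<..<1} \<longleftrightarrow> (t = 0 \<longrightarrow> x > 0) \<and> (t = 1 \<longrightarrow> x < 0))"
  let ?Q = "\<lambda>e \<epsilon>. p \<notin> pnt e ` {0..1} \<longrightarrow> ball p \<epsilon> \<inter> pnt e ` {0..1} = {}"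
  have small: "\<forall>\<^sub>F \<epsilon> in at_right 0. \<epsilon> < d" if "d > 0" for d :: real
    using that eventually_at_right_real by (auto simp: eventually_at_right[of 0 1])
  have "\<forall>\<^sub>F \<epsilon> in at_right 0. ?P e \<epsilon>" if e: "e \<in> D" for e
  proof (cases "\<exists>t\<in>{0..1}. pnt e t = p")
    case True
    then obtain t where t: "t \<in> {0..1}" "pnt e t = p" by auto
    from param_near[OF t(1)] obtain \<delta> where \<delta>: "\<delta> > 0" "\<And>x. \<bar>x\<bar> < \<delta> \<Longrightarrow>
      (t + x \<in> {0..1} \<longleftrightarrow> (t = 0 \<longrightarrow> x \<ge> 0) \<and> (t = 1 \<longrightarrow> x \<le> 0)) \<and>
      (t + x \<in> {0<..<1} \<longleftrightarrow> (t = 0 \<longrightarrow> x > 0) \<and> (t = 1 \<longrightarrow> x < 0))" by metis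
    have H: "?P e \<epsilon>" if "\<epsilon> < \<delta> * norm (dir e)" for \<epsilon>
    proof (intro ballI allI impI)
      fix t' x assume t': "t' \<in> {0..1}" "pnt e t' = p" "pnt e (t' + x) \<in> ball p \<epsilon>"
      then have "t' = t" using t pnt_inj[OF dir_nonzero[OF e], of t' t] by simp
      have "\<bar>x\<bar> * norm (dir e) < \<delta> * norm (dir e)" using t' that by (simp add: pnt_add dist_norm)
      then have "\<bar>x\<bar> < \<delta>" using dir_nonzero[OF e] by simp
      then show "(t' + x \<in> {0..1} \<longleftrightarrow> (t' = 0 \<longrightarrow> x \<ge> 0) \<and> (t' = 1 \<longrightarrow> x \<le> 0)) \<and>
        (t' + x \<in> {0<..<1} \<longleftrightarrow> (t' = 0 \<longrightarrow> x > 0) \<and> (t' = 1 \<longrightarrow> x < 0))"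
        using \<delta>(2) \<open>t' = t\<close> by simp
    qed
    have pos: "\<delta> * norm (dir e) > 0" using \<delta>(1) dir_nonzero[OF e] by simp
    show ?thesis by (rule eventually_mono[OF small[OF pos] H])
  qed auto
  moreover have "\<forall>\<^sub>F \<epsilon> in at_right 0. ?Q e \<epsilon>" if e: "e \<in> D" for e
  proof (cases "p \<in> pnt e ` {0..1}")
    case False
    have "compact (pnt e ` {0..1})"
      unfolding pnt_def by (intro compact_continuous_image continuous_intros) auto
    then have "open (- pnt e ` {0..1})" by (simp add: compact_imp_closed open_Compl)
    then obtain d where d: "d > 0" "ball p d \<subseteq> - pnt e ` {0..1}"
      using False by (meson ComplI open_contains_ball)
    have H: "?Q e \<epsilon>" if "\<epsilon> < d" for \<epsilon>
      using subset_ball[of \<epsilon> d p] d(2) that by fastforce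
    show ?thesis by (rule eventually_mono[OF small[OF d(1)] H])
  qed auto
  moreover have "\<forall>\<^sub>F \<epsilon> in at_right 0. ball p \<epsilon> \<inter> crossings D \<subseteq> {p}"
  proof -
    have "open (- (crossings D - {p}))"
      by (intro open_Compl finite_imp_closed finite_Diff finite_crossings)
    then obtain d where d: "d > 0" "ball p d \<subseteq> - (crossings D - {p})"
      by (meson ComplI DiffD2 open_contains_ball singletonI)
    have H: "ball p \<epsilon> \<inter> crossings D \<subseteq> {p}" if "\<epsilon> < d" for \<epsilon>
      using subset_ball[of \<epsilon> d p] d(2) that by fastforce
    show ?thesis by (rule eventually_mono[OF small[OF d(1)] H])
  qed
  moreover have "\<forall>\<^sub>F \<epsilon> in at_right (0::real). \<epsilon> > 0" by (simp add: eventually_at_right_less)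
  ultimately have "\<forall>\<^sub>F \<epsilon> in at_right 0. (\<forall>e\<in>D. ?P e \<epsilon>) \<and> (\<forall>e\<in>D. ?Q e \<epsilon>) \<and>
      ball p \<epsilon> \<inter> crossings D \<subseteq> {p} \<and> \<epsilon> > 0"
    by (intro eventually_conj) (simp_all add: eventually_ball_finite_distrib[OF finite_D])
  then have "\<exists>\<epsilon>. (\<forall>e\<in>D. ?P e \<epsilon>) \<and> (\<forall>e\<in>D. ?Q e \<epsilon>) \<and> ball p \<epsilon> \<inter> crossings D \<subseteq> {p} \<and> \<epsilon> > 0"
    by (rule eventually_happens'[OF trivial_limit_at_right_real])
  then obtain \<epsilon> where \<epsilon>: "\<forall>e\<in>D. ?P e \<epsilon>" "\<forall>e\<in>D. ?Q e \<epsilon>" "ball p \<epsilon> \<inter> crossings D \<subseteq> {p}" "\<epsilon> > 0"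
    by blast
  show ?thesis
  proof (rule that[OF \<epsilon>(4)])
    fix e t x assume "e \<in> D" "t \<in> {0..1}" "pnt e t = p" "pnt e (t + x) \<in> ball p \<epsilon>"
    with bspec[OF \<epsilon>(1)] show "(t + x \<in> {0..1} \<longleftrightarrow> (t = 0 \<longrightarrow> x \<ge> 0) \<and> (t = 1 \<longrightarrow> x \<le> 0)) \<and>
      (t + x \<in> {0<..<1} \<longleftrightarrow> (t = 0 \<longrightarrow> x > 0) \<and> (t = 1 \<longrightarrow> x < 0))" by blast
  qed (use \<epsilon> in blast)+
qed


text \<open>Once folding is excluded, the corner of the incoming and the outgoing direction has two
  sides. In a small ball the diagram coincides with the two arms of this corner, and the chart is
  the intersection of the two sides with the ball.\<close>

lemma noncrossing_chart_exists:
  assumes "p \<in> K" "p \<notin> crossings D"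
  shows "\<exists>\<epsilon> L R. noncrossing_chart D p \<epsilon> L R"
proof -
  obtain e1 e2 t1 t2 where e: "e1 \<in> D" "e2 \<in> D" "t1 \<in> {0..1}" "t2 \<in> {0..1}"
    "pnt e1 t1 = p" "pnt e2 t2 = p"
    "e1 = e2 \<and> t1 = t2 \<and> t1 \<in> {0<..<1} \<or> e1 \<noteq> e2 \<and> t1 = 1 \<and> t2 = 0"
    and inc: "\<And>e s. e \<in> D \<Longrightarrow> s \<in> {0..1} \<Longrightarrow> pnt e s = p \<Longrightarrow> (e, s) = (e1, t1) \<or> (e, s) = (e2, t2)"
    by (rule noncrossing_edges[OF assms], rule that)
  \<comment> \<open>At a vertex, a fold would make the arm of \<open>e1\<close>, which leaves p
    backwards from parameter 1, run along the arm of \<open>e2\<close>, which leaves p forwards from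
    parameter 0. Hence the signs -1 and 1 passed to \<open>no_overlap\<close>.\<close>
  have nofold: "dir e2 \<noteq> - c *\<^sub>R dir e1" if "c > 0" for c
  proof (cases "e1 = e2")
    case True
    show ?thesis
    proof
      assume h: "dir e2 = - c *\<^sub>R dir e1"
      have "(1 + c) *\<^sub>R dir e1 = dir e2 + c *\<^sub>R dir e1" using True by (simp add: scaleR_add_left)
      also have "\<dots> = 0" unfolding h by simp
      finally show False using that dir_nonzero[OF e(1)] by simp
    qed
  next
    case False
    then have "t1 = 1" "t2 = 0" using e(7) by auto
    show ?thesis
    proof
      assume "dir e2 = - c *\<^sub>R dir e1"
      then have "1 *\<^sub>R dir e2 = c *\<^sub>R (- 1) *\<^sub>R dir e1" by simp
      moreover have "pnt e1 t1 = pnt e2 t2" using e(5,6) by simp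
      ultimately show False
        using no_overlap[OF e(1,2) False e(3,4) _ that, of 1 "- 1"] \<open>t1 = 1\<close> \<open>t2 = 0\<close> by simp
    qed
  qed
  obtain L R where LR: "corner_sides p (dir e1) (dir e2) L R"
    using corner_sides_exist[OF dir_nonzero[OF e(1)] dir_nonzero[OF e(2)] nofold] by blast
  obtain \<epsilon> where \<epsilon>: "\<epsilon> > 0"
    and near: "\<And>e t x. e \<in> D \<Longrightarrow> t \<in> {0..1} \<Longrightarrow> pnt e t = p \<Longrightarrow> pnt e (t + x) \<in> ball p \<epsilon> \<Longrightarrow>
      (t + x \<in> {0..1} \<longleftrightarrow> (t = 0 \<longrightarrow> x \<ge> 0) \<and> (t = 1 \<longrightarrow> x \<le> 0)) \<and>
      (t + x \<in> {0<..<1} \<longleftrightarrow> (t = 0 \<longrightarrow> x > 0) \<and> (t = 1 \<longrightarrow> x < 0))"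
    and far: "\<And>e. e \<in> D \<Longrightarrow> p \<notin> pnt e ` {0..1} \<Longrightarrow> ball p \<epsilon> \<inter> pnt e ` {0..1} = {}"
    and cr: "ball p \<epsilon> \<inter> crossings D \<subseteq> {p}"
    by (rule near_point[of p], rule that)
  define arms where "arms = {z. \<exists>s\<ge>0. z = p - s *\<^sub>R dir e1 \<or> z = p + s *\<^sub>R dir e2}"
  \<comment> \<open>Each diagram point in the ball is written as a displacement x from p, with the
    sign of x restricted at the ends. This places it on the incoming or on the outgoing arm.\<close>
  have on_edge: "\<exists>s x. r = s + x \<and> z = p + x *\<^sub>R dir e \<and> ((e, s) = (e1, t1) \<or> (e, s) = (e2, t2)) \<and>
      (s = 0 \<longrightarrow> x \<ge> 0) \<and> (s = 1 \<longrightarrow> x \<le> 0) \<and>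
      (r \<in> {0<..<1} \<longrightarrow> (s = 0 \<longrightarrow> x > 0) \<and> (s = 1 \<longrightarrow> x < 0))"
    if z: "z \<in> ball p \<epsilon>" "e \<in> D" "r \<in> {0..1}" "z = pnt e r" for z e r
  proof -
    obtain s where s: "s \<in> {0..1}" "pnt e s = p" using far[OF z(2)] z by blast
    have "pnt e (s + (r - s)) \<in> ball p \<epsilon>" using z by simp
    from near[OF z(2) s this] z(3) have
      "(s = 0 \<longrightarrow> r - s \<ge> 0) \<and> (s = 1 \<longrightarrow> r - s \<le> 0)"
      "r \<in> {0<..<1} \<longrightarrow> (s = 0 \<longrightarrow> r - s > 0) \<and> (s = 1 \<longrightarrow> r - s < 0)" by simp_all
    moreover have "z = p + (r - s) *\<^sub>R dir e" using z(4) s(2) pnt_add[of e s "r - s"] by simp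
    ultimately show ?thesis using inc[OF z(2) s] by (intro exI[of _ s] exI[of _ "r - s"]) simp
  qed
  have K: "K \<inter> ball p \<epsilon> = arms \<inter> ball p \<epsilon>"
  proof (intro subset_antisym subsetI)
    fix z assume z: "z \<in> K \<inter> ball p \<epsilon>"
    then obtain e r where "e \<in> D" "r \<in> {0..1}" "z = pnt e r" using K_iff by auto
    from on_edge[OF _ this] z obtain s x where sx: "z = p + x *\<^sub>R dir e"
      "(e, s) = (e1, t1) \<or> (e, s) = (e2, t2)" "s = 0 \<longrightarrow> x \<ge> 0" "s = 1 \<longrightarrow> x \<le> 0" by blast
    then have "(e = e1 \<and> x \<le> 0) \<or> (e = e2 \<and> x \<ge> 0)" using e(7) by (cases "x \<ge> 0") auto
    then have "z \<in> arms"
    proof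
      assume "e = e1 \<and> x \<le> 0"
      then show ?thesis using sx(1) by (auto simp: arms_def intro!: exI[of _ "- x"])
    next
      assume "e = e2 \<and> x \<ge> 0"
      then show ?thesis using sx(1) by (auto simp: arms_def)
    qed
    then show "z \<in> arms \<inter> ball p \<epsilon>" using z by simp
  next
    fix z assume z: "z \<in> arms \<inter> ball p \<epsilon>"
    then obtain s where s: "s \<ge> 0" "z = p - s *\<^sub>R dir e1 \<or> z = p + s *\<^sub>R dir e2"
      by (auto simp: arms_def)
    from s(2) have "z \<in> K"
    proof
      assume "z = p - s *\<^sub>R dir e1"
      then have *: "z = pnt e1 (t1 + - s)" using e(5) by (simp only: pnt_add) simp
      from near[OF e(1,3,5), of "- s"] z * e(7) s(1) have "t1 + - s \<in> {0..1}" by auto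
      then show ?thesis using * e(1) K_iff by blast
    next
      assume "z = p + s *\<^sub>R dir e2"
      then have *: "z = pnt e2 (t2 + s)" using e(6) by (simp only: pnt_add)
      from near[OF e(2,4,6), of s] z * e(7) s(1) have "t2 + s \<in> {0..1}" by auto
      then show ?thesis using * e(2) K_iff by blast
    qed
    then show "z \<in> K \<inter> ball p \<epsilon>" using z by simp
  qed
  have conn: "connected (K \<inter> ball p \<delta>)" if "0 < \<delta>" "\<delta> \<le> \<epsilon>" for \<delta>
  proof -
    have "K \<inter> ball p \<delta> = arms \<inter> ball p \<delta>" using K subset_ball[OF that(2), of p] by blast
    moreover have "starlike (arms \<inter> ball p \<delta>)"
      unfolding starlike_def
    proof (intro bexI ballI)
      show "p \<in> arms \<inter> ball p \<delta>" using that by (auto simp: arms_def intro!: exI[of _ 0])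
      fix z assume z: "z \<in> arms \<inter> ball p \<delta>"
      then obtain s where s: "s \<ge> 0" "z = p - s *\<^sub>R dir e1 \<or> z = p + s *\<^sub>R dir e2"
        by (auto simp: arms_def)
      have "closed_segment p z \<subseteq> arms"
      proof
        fix y assume "y \<in> closed_segment p z"
        then obtain u where u: "u \<ge> 0" "y = p + u *\<^sub>R (z - p)"
          by (auto simp: in_segment algebra_simps)
        then have "u * s \<ge> 0" "y = p - (u * s) *\<^sub>R dir e1 \<or> y = p + (u * s) *\<^sub>R dir e2"
          using s by auto
        then show "y \<in> arms" unfolding arms_def by blast
      qed
      moreover have "closed_segment p z \<subseteq> ball p \<delta>"
        using z that by (intro closed_segment_subset convex_ball) auto
      ultimately show "closed_segment p z \<subseteq> arms \<inter> ball p \<delta>" by blast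
    qed
    ultimately show ?thesis using starlike_imp_connected by metis
  qed
  have germs: "germ_in q (normal (dir e)) (L \<inter> ball p \<epsilon>) \<and> germ_in q (- normal (dir e)) (R \<inter> ball p \<epsilon>)"
    if q: "e \<in> D" "q \<in> ball p \<epsilon> \<inter> oseg e" for e q
  proof -
    obtain r where r: "r \<in> {0<..<1}" "q = pnt e r"
      using q(2) oseg_eq[OF dir_nonzero[OF q(1)]] by auto
    then have "r \<in> {0..1}" by auto
    from on_edge[OF _ q(1) this r(2)] q(2) r(1) obtain s x where sx: "q = p + x *\<^sub>R dir e"
      "(e, s) = (e1, t1) \<or> (e, s) = (e2, t2)" "s = 0 \<longrightarrow> x > 0" "s = 1 \<longrightarrow> x < 0" by blast
    have c: "germ_in (p - s *\<^sub>R dir e1) (normal (dir e1)) L \<and> germ_in (p - s *\<^sub>R dir e1) (- normal (dir e1)) R \<and>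
        germ_in (p + s *\<^sub>R dir e2) (normal (dir e2)) L \<and> germ_in (p + s *\<^sub>R dir e2) (- normal (dir e2)) R"
      if "s > 0 \<or> s = 0 \<and> e1 = e2" for s
      using LR that unfolding corner_sides_def by blast
    have "(e = e1 \<and> (- x > 0 \<or> - x = 0 \<and> e1 = e2)) \<or> (e = e2 \<and> (x > 0 \<or> x = 0 \<and> e1 = e2))"
      using sx e(7) by (cases "x > 0"; cases "x = 0") auto
    then have "germ_in q (normal (dir e)) L \<and> germ_in q (- normal (dir e)) R"
    proof
      assume "e = e1 \<and> (- x > 0 \<or> - x = 0 \<and> e1 = e2)"
      then show ?thesis using c[of "- x"] sx(1) by auto
    next
      assume "e = e2 \<and> (x > 0 \<or> x = 0 \<and> e1 = e2)"
      then show ?thesis using c[of x] sx(1) by auto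
    qed
    then show ?thesis using q(2) germ_in_Int germ_in_open[OF open_ball, of q p \<epsilon>] by blast
  qed
  have acc: "ball p \<delta> \<inter> oseg e2 \<noteq> {}" if "\<delta> > 0" for \<delta>
  proof -
    \<comment> \<open>Chosen so that the point at parameter \<open>t2 + s\<close> has distance half
      of \<open>min \<delta> \<epsilon>\<close> from p.\<close>
    define s where "s = min \<delta> \<epsilon> / (2 * norm (dir e2))"
    have s: "s > 0" using that \<epsilon> dir_nonzero[OF e(2)] by (simp add: s_def)
    have "dist p (pnt e2 (t2 + s)) < min \<delta> \<epsilon>"
      using that \<epsilon> dir_nonzero[OF e(2)] e(6) by (simp add: pnt_add dist_norm s_def min_def)
    then have b: "pnt e2 (t2 + s) \<in> ball p \<delta>" "pnt e2 (t2 + s) \<in> ball p \<epsilon>" by auto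
    from near[OF e(2,4,6) b(2)] s e(7) have "t2 + s \<in> {0<..<1}" by auto
    then have "pnt e2 (t2 + s) \<in> oseg e2" using oseg_eq[OF dir_nonzero[OF e(2)]] by blast
    then show ?thesis using b(1) by blast
  qed
  have "L \<union> R = - arms" "open L" "open R" "L \<inter> R = {}"
    using LR by (simp_all add: corner_sides_def arms_def)
  moreover have "connected (L \<inter> ball p \<epsilon> \<inter> ball p \<delta>)" "connected (R \<inter> ball p \<epsilon> \<inter> ball p \<delta>)"
    if "0 < \<delta>" "\<delta> \<le> \<epsilon>" for \<delta>
  proof -
    have "ball p \<epsilon> \<inter> ball p \<delta> = ball p \<delta>" using subset_ball[OF that(2)] by blast
    then show "connected (L \<inter> ball p \<epsilon> \<inter> ball p \<delta>)" "connected (R \<inter> ball p \<epsilon> \<inter> ball p \<delta>)"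
      using LR that(1) by (simp_all add: corner_sides_def Int_assoc)
  qed
  moreover have "ball p \<epsilon> \<inter> crossings D = {}" using cr assms(2) by auto
  moreover have "L \<inter> ball p \<epsilon> \<union> R \<inter> ball p \<epsilon> = ball p \<epsilon> - K"
    using \<open>L \<union> R = - arms\<close> K by blast
  ultimately have "noncrossing_chart D p \<epsilon> (L \<inter> ball p \<epsilon>) (R \<inter> ball p \<epsilon>)"
    unfolding noncrossing_chart_def using \<epsilon> germs conn acc e(2)
    by (intro conjI) (blast | auto)+
  then show ?thesis by blast
qed

text \<open>Exactly two pairs of an edge and a parameter lie over p, and their heights decide which
  is the lower; this makes the description in \<open>strand_dirs\<close> unique. Both parameters are
  interior, so in a small ball each strand fills a whole diameter.\<close>

lemma crossing_chart_exists:
  assumes "p \<in> crossings D"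
  shows "\<exists>\<epsilon> eu ev. crossing_chart D p \<epsilon> eu ev"
proof -
  obtain eu ev t u where e: "eu \<in> D" "ev \<in> D" "eu \<noteq> ev" "t \<in> {0<..<1}" "u \<in> {0<..<1}"
    "pnt eu t = p" "pnt ev u = p" "snd (lift_at eu t) < snd (lift_at ev u)"
    and inc: "\<And>e s. e \<in> D \<Longrightarrow> s \<in> {0..1} \<Longrightarrow> pnt e s = p \<Longrightarrow> (e, s) = (eu, t) \<or> (e, s) = (ev, u)"
    by (rule crossing_edges[OF assms], rule that)
  have tu: "t \<in> {0..1}" "u \<in> {0..1}" using e(4,5) by auto
  have "strand_dirs D p = (dir eu, dir ev)"
    unfolding strand_dirs_def
  proof (rule the_equality)
    show "case (dir eu, dir ev) of (u, v) \<Rightarrow> \<exists>a b c d q q'.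
     (a, b) \<in> D \<and> (c, d) \<in> D \<and> q \<in> closed_segment a b \<and> q' \<in> closed_segment c d \<and>
     fst q = p \<and> fst q' = p \<and> snd q < snd q' \<and> u = fst b - fst a \<and> v = fst d - fst c"
      unfolding prod.case
    proof (intro exI conjI)
      show "(fst eu, snd eu) \<in> D" "(fst ev, snd ev) \<in> D" using e(1,2) by simp_all
      show "lift_at eu t \<in> closed_segment (fst eu) (snd eu)" "lift_at ev u \<in> closed_segment (fst ev) (snd ev)"
        using seg_eq[of eu] seg_eq[of ev] tu unfolding seg_def by blast+
      show "fst (lift_at eu t) = p" "fst (lift_at ev u) = p" using e(6,7) by (simp_all add: fst_lift_at)
    qed (simp_all add: e(8) dir_def)
    fix uv assume "case uv of (u, v) \<Rightarrow> \<exists>a b c d q q'.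
     (a, b) \<in> D \<and> (c, d) \<in> D \<and> q \<in> closed_segment a b \<and> q' \<in> closed_segment c d \<and>
     fst q = p \<and> fst q' = p \<and> snd q < snd q' \<and> u = fst b - fst a \<and> v = fst d - fst c"
    then obtain a b c d q q' where ab: "(a, b) \<in> D" "q \<in> closed_segment a b" "fst q = p"
      and cd: "(c, d) \<in> D" "q' \<in> closed_segment c d" "fst q' = p"
      and lt: "snd q < snd q'" and uv: "uv = (dir (a, b), dir (c, d))"
      by (auto simp: dir_def)
    obtain s where s: "s \<in> {0..1}" "q = lift_at (a, b) s" using ab(2) seg_eq[of "(a, b)"] by (auto simp: seg_def)
    obtain s' where s': "s' \<in> {0..1}" "q' = lift_at (c, d) s'" using cd(2) seg_eq[of "(c, d)"] by (auto simp: seg_def)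
    have "((a, b), s) = (eu, t) \<or> ((a, b), s) = (ev, u)" "((c, d), s') = (eu, t) \<or> ((c, d), s') = (ev, u)"
      using inc[OF ab(1) s(1)] inc[OF cd(1) s'(1)] ab(3) cd(3) s(2) s'(2) by (simp_all add: fst_lift_at)
    then have "(a, b) = eu" "(c, d) = ev" using lt s(2) s'(2) e(8) by auto
    then show "uv = (dir eu, dir ev)" using uv by simp
  qed
  then have dirs: "under_dir D p = dir eu" "over_dir D p = dir ev"
    by (simp_all add: under_dir_def over_dir_def)
  \<comment> \<open>Parallel strands may run in the same or in opposite directions. In either case
    the forward arm of \<open>eu\<close> overlaps one of the two arms of \<open>ev\<close>, selected
    by \<open>sgn s\<close>.\<close>
  have nonpar: "dir eu \<bullet> normal (dir ev) \<noteq> 0"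
  proof
    assume "dir eu \<bullet> normal (dir ev) = 0"
    then obtain s where s: "dir eu = s *\<^sub>R dir ev" using inner_normal_eq_0 dir_nonzero[OF e(2)] by blast
    then have "s \<noteq> 0" using dir_nonzero[OF e(1)] by auto
    then have "1 *\<^sub>R dir eu = \<bar>s\<bar> *\<^sub>R sgn s *\<^sub>R dir ev" "\<bar>s\<bar> > 0" "sgn s \<in> {1, - 1}"
      using s by (auto simp: sgn_if)
    then show False
      using no_overlap[OF e(2,1) e(3)[symmetric] tu(2,1), of "\<bar>s\<bar>" 1 "sgn s"] e(4-7) by auto
  qed
  obtain \<epsilon> where \<epsilon>: "\<epsilon> > 0"
    and near: "\<And>e t x. e \<in> D \<Longrightarrow> t \<in> {0..1} \<Longrightarrow> pnt e t = p \<Longrightarrow> pnt e (t + x) \<in> ball p \<epsilon> \<Longrightarrow>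
      (t + x \<in> {0..1} \<longleftrightarrow> (t = 0 \<longrightarrow> x \<ge> 0) \<and> (t = 1 \<longrightarrow> x \<le> 0)) \<and>
      (t + x \<in> {0<..<1} \<longleftrightarrow> (t = 0 \<longrightarrow> x > 0) \<and> (t = 1 \<longrightarrow> x < 0))"
    and far: "\<And>e. e \<in> D \<Longrightarrow> p \<notin> pnt e ` {0..1} \<Longrightarrow> ball p \<epsilon> \<inter> pnt e ` {0..1} = {}"
    and cr: "ball p \<epsilon> \<inter> crossings D \<subseteq> {p}"
    by (rule near_point[of p], rule that)
  have line: "q \<in> oseg e \<longleftrightarrow> (q - p) \<bullet> normal (dir e) = 0"
    if q: "q \<in> ball p \<epsilon>" and et: "e \<in> D" "t \<in> {0<..<1}" "pnt e t = p" for q e t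
  proof
    assume "q \<in> oseg e"
    then obtain r where "q = pnt e r" using oseg_eq[OF dir_nonzero[OF et(1)]] by blast
    then have "q = p + (r - t) *\<^sub>R dir e" using et(3) pnt_add[of e t "r - t"] by simp
    then show "(q - p) \<bullet> normal (dir e) = 0" by simp
  next
    assume "(q - p) \<bullet> normal (dir e) = 0"
    then obtain x where "q - p = x *\<^sub>R dir e" using inner_normal_eq_0 dir_nonzero[OF et(1)] by blast
    then have *: "q = pnt e (t + x)" using et(3) by (simp add: pnt_add algebra_simps)
    have "t \<in> {0..1}" using et(2) by auto
    from near[OF et(1) this et(3), of x] q * et(2) have "t + x \<in> {0<..<1}" by auto
    then show "q \<in> oseg e" using oseg_eq[OF dir_nonzero[OF et(1)]] * by blast
  qed
  have edges: "e = eu \<or> e = ev" if q: "q \<in> ball p \<epsilon>" "e \<in> D" "q \<in> pnt e ` {0..1}" for q e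
  proof -
    obtain s where s: "s \<in> {0..1}" "pnt e s = p" using far[OF q(2)] q by blast
    from inc[OF q(2) this] show ?thesis by auto
  qed
  have oseg_sub: "oseg e \<subseteq> pnt e ` {0..1}" if "e \<in> D" for e
    using oseg_eq[OF dir_nonzero[OF that]] by auto
  have "ball p \<epsilon> \<inter> K = ball p \<epsilon> \<inter> {z. (z - p) \<bullet> normal (dir eu) = 0 \<or> (z - p) \<bullet> normal (dir ev) = 0}"
  proof (intro subset_antisym subsetI)
    fix z assume z: "z \<in> ball p \<epsilon> \<inter> K"
    then obtain e r where er: "e \<in> D" "r \<in> {0..1}" "z = pnt e r" using K_iff by auto
    then have e_cases: "e = eu \<or> e = ev" using edges z by blast
    then have "\<exists>x. z = p + x *\<^sub>R dir e"
    proof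
      assume "e = eu"
      then have "z = p + (r - t) *\<^sub>R dir e" using er(3) e(6) pnt_add[of e t "r - t"] by simp
      then show ?thesis by blast
    next
      assume "e = ev"
      then have "z = p + (r - u) *\<^sub>R dir e" using er(3) e(7) pnt_add[of e u "r - u"] by simp
      then show ?thesis by blast
    qed
    then show "z \<in> ball p \<epsilon> \<inter> {z. (z - p) \<bullet> normal (dir eu) = 0 \<or> (z - p) \<bullet> normal (dir ev) = 0}"
      using z e_cases by auto
  next
    fix z assume z: "z \<in> ball p \<epsilon> \<inter> {z. (z - p) \<bullet> normal (dir eu) = 0 \<or> (z - p) \<bullet> normal (dir ev) = 0}"
    then have "z \<in> oseg eu \<or> z \<in> oseg ev"
      using line[of z eu t] line[of z ev u] e by blast
    then show "z \<in> ball p \<epsilon> \<inter> K" using z oseg_sub[OF e(1)] oseg_sub[OF e(2)] K_iff e(1,2) by blast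
  qed
  moreover have "\<forall>q\<in>ball p \<epsilon>. (q \<in> oseg eu \<longleftrightarrow> (q - p) \<bullet> normal (dir eu) = 0) \<and>
        (q \<in> oseg ev \<longleftrightarrow> (q - p) \<bullet> normal (dir ev) = 0) \<and>
        (\<forall>e\<in>D. q \<in> oseg e \<longrightarrow> e = eu \<or> e = ev)"
    using line[OF _ e(1,4,6)] line[OF _ e(2,5,7)] edges oseg_sub by blast
  moreover have "ball p \<epsilon> \<inter> crossings D = {p}" using cr assms \<epsilon> by auto
  ultimately have "crossing_chart D p \<epsilon> eu ev"
    unfolding crossing_chart_def using \<epsilon> e(1,2) dirs nonpar by simp
  then show ?thesis by blast
qed

end

section \<open>Regions and semi-arcs\<close>

lemma component_germ_unique:
  assumes "c \<in> components U" "c' \<in> components U" "germ_in p w c" "germ_in p w c'"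
  shows "c = c'"
proof -
  have "c \<inter> c' \<noteq> {}" using germ_in_nonempty[OF germ_in_Int[OF assms(3,4)]] .
  then show ?thesis using components_eq[OF assms(1,2)] by blast
qed

lemma the_component_germ:
  assumes "c \<in> components U" "germ_in p w c"
  shows "(THE c. c \<in> components U \<and> germ_in p w c) = c"
  using assms component_germ_unique by (intro the_equality) blast+

context regular_diagram
begin

lemma oseg_subset: "e \<in> D \<Longrightarrow> oseg e \<subseteq> K"
proof -
  assume e: "e \<in> D"
  have "oseg e = pnt e ` {0<..<1}" by (rule oseg_eq[OF dir_nonzero[OF e]])
  also have "\<dots> \<subseteq> pnt e ` {0..1}" by (intro image_mono) auto
  finally show ?thesis using K_iff e by blast
qed

lemma compact_K: "compact K"
proof -
  have "K = (\<Union>e\<in>D. pnt e ` {0..1})" using K_iff by blast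
  moreover have "compact (pnt e ` {0..1})" for e
    unfolding pnt_def by (intro compact_continuous_image continuous_intros) auto
  ultimately show ?thesis using finite_D by auto
qed

lemma open_region: "r \<in> regions D \<Longrightarrow> open r"
  unfolding regions_def
  using open_components compact_imp_closed[OF compact_K] by blast

lemma semi_arc_subset: "s \<in> semi_arcs D \<Longrightarrow> s \<subseteq> K - crossings D"
  unfolding semi_arcs_def by (rule in_components_subset)

lemma in_semi_arc:
  assumes "q \<in> K - crossings D"
  obtains s where "s \<in> semi_arcs D" "q \<in> s"
  using assms unfolding semi_arcs_def by (metis UnionE Union_components)

lemma connected_in_region:
  assumes "connected S" "S \<noteq> {}" "S \<inter> K = {}"
  obtains r where "r \<in> regions D" "S \<subseteq> r"
proof -
  have "- K \<noteq> {}" "S \<subseteq> - K" using assms by auto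
  then show ?thesis using that exists_component_superset[of S "- K"] assms(1) unfolding regions_def by blast
qed

lemma connected_in_semi_arc:
  assumes "connected S" "S \<noteq> {}" "S \<subseteq> K - crossings D"
  obtains s where "s \<in> semi_arcs D" "S \<subseteq> s"
proof -
  have "K - crossings D \<noteq> {}" using assms by auto
  then show ?thesis using that exists_component_superset[OF assms(3)] assms(1) unfolding semi_arcs_def by blast
qed

lemma semi_arc_superset:
  assumes "s \<in> semi_arcs D" "connected S" "S \<subseteq> K - crossings D" "q \<in> S" "q \<in> s"
  shows "S \<subseteq> s"
  using assms components_maximal[of s _ S] unfolding semi_arcs_def by blast

lemma semi_arc_eq:
  "s \<in> semi_arcs D \<Longrightarrow> s' \<in> semi_arcs D \<Longrightarrow> q \<in> s \<Longrightarrow> q \<in> s' \<Longrightarrow> s = s'"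
  unfolding semi_arcs_def using components_eq by blast

lemma chart_in_semi_arc:
  assumes "noncrossing_chart D p \<epsilon> L R" "s \<in> semi_arcs D" "p \<in> s" "0 < \<delta>" "\<delta> \<le> \<epsilon>"
  shows "K \<inter> ball p \<delta> \<subseteq> s"
proof (rule semi_arc_superset[OF assms(2) _ _ _ assms(3)])
  show "connected (K \<inter> ball p \<delta>)" using assms(1,4,5) by (simp add: noncrossing_chart_def)
  have "ball p \<delta> \<subseteq> ball p \<epsilon>" "ball p \<epsilon> \<inter> crossings D = {}"
    using assms(1,5) by (auto simp: noncrossing_chart_def)
  then show "K \<inter> ball p \<delta> \<subseteq> K - crossings D" by blast
  show "p \<in> K \<inter> ball p \<delta>" using semi_arc_subset[OF assms(2)] assms(3,4) by auto
qed

section \<open>The two sides of a semi-arc\<close>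

lemma chart_regions:
  assumes "noncrossing_chart D p \<epsilon> L R"
  obtains r1 r2 where "r1 \<in> regions D" "r2 \<in> regions D" "R \<subseteq> r1" "L \<subseteq> r2"
proof -
  from assms obtain e q where eq: "e \<in> D" "q \<in> ball p \<epsilon> \<inter> oseg e" "0 < \<epsilon>"
    unfolding noncrossing_chart_def by blast
  have c: "germ_in q (normal (dir e)) L" "germ_in q (- normal (dir e)) R" "L \<union> R = ball p \<epsilon> - K"
    using assms eq unfolding noncrossing_chart_def by blast+
  have "L \<inter> ball p \<epsilon> = L" "R \<inter> ball p \<epsilon> = R" using c(3) by blast+
  then have "connected L" "connected R"
    using assms eq(3) unfolding noncrossing_chart_def by (metis order_refl)+
  then show ?thesis
    using germ_in_nonempty[OF c(1)] germ_in_nonempty[OF c(2)] c(3)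
    by (metis Diff_disjoint Int_Un_distrib2 Int_commute Un_empty connected_in_region that)
qed

text \<open>Even if the chosen point of s is the image of a vertex, its chart contains interior
  points of an edge, and the part of the diagram inside the chart belongs to s.\<close>

lemma semi_arc_oseg:
  assumes "s \<in> semi_arcs D"
  obtains e q where "e \<in> D" "q \<in> s \<inter> oseg e"
proof -
  obtain p where p: "p \<in> s" using assms in_components_nonempty unfolding semi_arcs_def by blast
  then have "p \<in> K" "p \<notin> crossings D" using semi_arc_subset[OF assms] by auto
  then obtain \<epsilon> L R where ch: "noncrossing_chart D p \<epsilon> L R" using noncrossing_chart_exists by blast
  then obtain e q where "e \<in> D" "q \<in> ball p \<epsilon> \<inter> oseg e" "0 < \<epsilon>"
    unfolding noncrossing_chart_def by blast
  then show ?thesis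
    using that[of e q] chart_in_semi_arc[OF ch assms p] oseg_subset by blast
qed

text \<open>The pair of regions on both sides is locally constant along the semi-arc by the charts,
  and semi-arcs are connected.\<close>

lemma semi_arc_sides:
  assumes s: "s \<in> semi_arcs D"
  obtains r1 r2 where "r1 \<in> regions D" "r2 \<in> regions D"
    "\<And>e q. e \<in> D \<Longrightarrow> q \<in> s \<inter> oseg e \<Longrightarrow> germ_in q (- normal (dir e)) r1 \<and> germ_in q (normal (dir e)) r2"
proof -
  \<comment> \<open>The pair of regions at p is described through all interior edge points in a
    neighbourhood, since p itself may have no normal vector.\<close>
  define P where "P p rr \<longleftrightarrow> fst rr \<in> regions D \<and> snd rr \<in> regions D \<and>
    (\<exists>\<delta>>0. \<forall>e\<in>D. \<forall>q\<in>ball p \<delta> \<inter> oseg e.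
       germ_in q (- normal (dir e)) (fst rr) \<and> germ_in q (normal (dir e)) (snd rr))" for p rr
  have ex: "\<exists>rr. P p rr" if "p \<in> s" for p
  proof -
    have "p \<in> K" "p \<notin> crossings D" using semi_arc_subset[OF s] that by auto
    then obtain \<epsilon> L R where ch: "noncrossing_chart D p \<epsilon> L R" using noncrossing_chart_exists by blast
    obtain r1 r2 where r: "r1 \<in> regions D" "r2 \<in> regions D" "R \<subseteq> r1" "L \<subseteq> r2"
      by (rule chart_regions[OF ch])
    have "\<epsilon> > 0" and g: "\<And>e q. e \<in> D \<Longrightarrow> q \<in> ball p \<epsilon> \<inter> oseg e \<Longrightarrow>
        germ_in q (- normal (dir e)) R \<and> germ_in q (normal (dir e)) L"
      using ch unfolding noncrossing_chart_def by blast+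
    have "P p (r1, r2)"
      unfolding P_def fst_conv snd_conv
      using r(1,2) \<open>\<epsilon> > 0\<close> germ_in_mono[OF conjunct1[OF g] r(3)] germ_in_mono[OF conjunct2[OF g] r(4)]
      by (intro conjI exI[of _ \<epsilon>] ballI) assumption+
    then show ?thesis by blast
  qed
  have uniq: "rr = rr'" if p: "p \<in> s" and P: "P p rr" "P p rr'" for p rr rr'
  proof -
    from P obtain \<delta> \<delta>' where d: "\<delta> > 0" "\<delta>' > 0"
      "\<And>e q. e \<in> D \<Longrightarrow> q \<in> ball p \<delta> \<inter> oseg e \<Longrightarrow>
        germ_in q (- normal (dir e)) (fst rr) \<and> germ_in q (normal (dir e)) (snd rr)"
      "\<And>e q. e \<in> D \<Longrightarrow> q \<in> ball p \<delta>' \<inter> oseg e \<Longrightarrow>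
        germ_in q (- normal (dir e)) (fst rr') \<and> germ_in q (normal (dir e)) (snd rr')"
      unfolding P_def by blast
    have "p \<in> K" "p \<notin> crossings D" using semi_arc_subset[OF s] p by auto
    then obtain \<epsilon> L R where "noncrossing_chart D p \<epsilon> L R" using noncrossing_chart_exists by blast
    moreover have "min \<delta> \<delta>' > 0" using d by simp
    ultimately obtain e q where e: "e \<in> D" "q \<in> ball p (min \<delta> \<delta>') \<inter> oseg e"
      unfolding noncrossing_chart_def by blast
    then have "q \<in> ball p \<delta> \<inter> oseg e" "q \<in> ball p \<delta>' \<inter> oseg e" by auto
    note g = d(3)[OF e(1) this(1)] d(4)[OF e(1) this(2)]
    have R: "fst rr \<in> regions D" "snd rr \<in> regions D" "fst rr' \<in> regions D" "snd rr' \<in> regions D"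
      using P by (simp_all add: P_def)
    show ?thesis
    proof (rule prod_eqI)
      show "fst rr = fst rr'"
        using component_germ_unique[OF R(1,3)[unfolded regions_def]] g by blast
      show "snd rr = snd rr'"
        using component_germ_unique[OF R(2,4)[unfolded regions_def]] g by blast
    qed
  qed
  \<comment> \<open>The choice is immaterial: by \<open>uniq\<close> the predicate determines the
    pair.\<close>
  define f where "f p = (SOME rr. P p rr)" for p
  have f: "P p (f p)" if "p \<in> s" for p
    unfolding f_def using someI_ex[OF ex[OF that]] .
  have "connected s" using s in_components_connected unfolding semi_arcs_def by blast
  have loc: "\<forall>a\<in>s. eventually (\<lambda>b. f a = f b) (at a within s)"
  proof
    fix a assume a: "a \<in> s"
    obtain \<delta> where d: "\<delta> > 0" "\<And>e q. e \<in> D \<Longrightarrow> q \<in> ball a \<delta> \<inter> oseg e \<Longrightarrow>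
        germ_in q (- normal (dir e)) (fst (f a)) \<and> germ_in q (normal (dir e)) (snd (f a))"
      using f[OF a] unfolding P_def by blast
    have "f a = f b" if b: "b \<in> s" "b \<in> ball a \<delta>" for b
    proof (rule uniq[OF b(1) _ f[OF b(1)]])
      obtain \<delta>' where "\<delta>' > 0" "ball b \<delta>' \<subseteq> ball a \<delta>"
        by (rule openE[OF open_ball b(2)])
      then show "P b (f a)" using f[OF a] d(2) unfolding P_def by blast
    qed
    then show "eventually (\<lambda>b. f a = f b) (at a within s)"
      unfolding eventually_at_topological using d(1) by (intro exI[of _ "ball a \<delta>"]) auto
  qed
  obtain p where p: "p \<in> s" using s in_components_nonempty unfolding semi_arcs_def by blast
  show ?thesis
  proof (rule that[of "fst (f p)" "snd (f p)"])
    show "fst (f p) \<in> regions D" "snd (f p) \<in> regions D" using f[OF p] by (simp_all add: P_def)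
    fix e q assume e: "e \<in> D" and q: "q \<in> s \<inter> oseg e"
    then have "f p = f q" using connected_local_const[OF \<open>connected s\<close> p _ loc] by blast
    moreover obtain \<delta> where "\<delta> > 0" "\<And>e q'. e \<in> D \<Longrightarrow> q' \<in> ball q \<delta> \<inter> oseg e \<Longrightarrow>
        germ_in q' (- normal (dir e)) (fst (f q)) \<and> germ_in q' (normal (dir e)) (snd (f q))"
      using f[of q] q unfolding P_def by blast
    ultimately show "germ_in q (- normal (dir e)) (fst (f p)) \<and> germ_in q (normal (dir e)) (snd (f p))"
      using e q by simp
  qed
qed

text \<open>Turns the relation \<open>normal_points\<close> into functions: the normal vector of s
  points from \<open>neg_side s\<close> to \<open>pos_side s\<close>. Any interior edge point on s
  may serve as test point, because the sides are constant along s.\<close>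

definition neg_side :: "complex set \<Rightarrow> complex set" where
  "neg_side s = (THE r. r \<in> regions D \<and> (\<exists>e\<in>D. \<exists>q\<in>s \<inter> oseg e. germ_in q (- normal (dir e)) r))"

definition pos_side :: "complex set \<Rightarrow> complex set" where
  "pos_side s = (THE r. r \<in> regions D \<and> (\<exists>e\<in>D. \<exists>q\<in>s \<inter> oseg e. germ_in q (normal (dir e)) r))"

lemma sides:
  assumes "s \<in> semi_arcs D"
  shows "neg_side s \<in> regions D" "pos_side s \<in> regions D"
    and "\<And>e q. e \<in> D \<Longrightarrow> q \<in> s \<inter> oseg e \<Longrightarrow> germ_in q (- normal (dir e)) (neg_side s)"
    and "\<And>e q. e \<in> D \<Longrightarrow> q \<in> s \<inter> oseg e \<Longrightarrow> germ_in q (normal (dir e)) (pos_side s)"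
proof -
  obtain r1 r2 where r: "r1 \<in> regions D" "r2 \<in> regions D" and
    g: "\<And>e q. e \<in> D \<Longrightarrow> q \<in> s \<inter> oseg e \<Longrightarrow> germ_in q (- normal (dir e)) r1 \<and> germ_in q (normal (dir e)) r2"
    by (rule semi_arc_sides[OF assms], rule that)
  obtain e q where eq: "e \<in> D" "q \<in> s \<inter> oseg e" by (rule semi_arc_oseg[OF assms])
  have "neg_side s = r1" unfolding neg_side_def
    by (rule the_equality) (use r g eq component_germ_unique regions_def in blast)+
  moreover have "pos_side s = r2" unfolding pos_side_def
    by (rule the_equality) (use r g eq component_germ_unique regions_def in blast)+
  ultimately show "neg_side s \<in> regions D" "pos_side s \<in> regions D"
    "\<And>e q. e \<in> D \<Longrightarrow> q \<in> s \<inter> oseg e \<Longrightarrow> germ_in q (- normal (dir e)) (neg_side s)"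
    "\<And>e q. e \<in> D \<Longrightarrow> q \<in> s \<inter> oseg e \<Longrightarrow> germ_in q (normal (dir e)) (pos_side s)"
    using r g by auto
qed

lemma side_eqI:
  assumes "s \<in> semi_arcs D" "r \<in> regions D" "e \<in> D" "q \<in> s \<inter> oseg e"
  shows "germ_in q (- normal (dir e)) r \<Longrightarrow> neg_side s = r"
    and "germ_in q (normal (dir e)) r \<Longrightarrow> pos_side s = r"
  using component_germ_unique sides[OF assms(1)] assms(2-4) unfolding regions_def by blast+

lemma normal_points_iff:
  assumes "s \<in> semi_arcs D" "r1 \<in> regions D" "r2 \<in> regions D"
  shows "normal_points D s r1 r2 \<longleftrightarrow> r1 = neg_side s \<and> r2 = pos_side s"
proof
  assume "normal_points D s r1 r2"
  then obtain e q where "e \<in> D" "q \<in> s \<inter> oseg e" "germ_in q (- normal (dir e)) r1" "germ_in q (normal (dir e)) r2"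
    unfolding normal_points_def dir_def oseg_def by fastforce
  then show "r1 = neg_side s \<and> r2 = pos_side s" using side_eqI[OF assms(1)] assms(2,3) by metis
next
  assume r: "r1 = neg_side s \<and> r2 = pos_side s"
  obtain e q where eq: "e \<in> D" "q \<in> s \<inter> oseg e" by (rule semi_arc_oseg[OF assms(1)])
  have "germ_in q (- normal (dir e)) r1" "germ_in q (normal (dir e)) r2"
    using sides[OF assms(1)] eq r by auto
  then show "normal_points D s r1 r2"
    unfolding normal_points_def using eq
    by (intro bexI[of _ e]) (auto simp: dir_def oseg_def split: prod.splits)
qed


section \<open>Quadrants and half-strands at a crossing\<close>

definition xchart :: "complex \<Rightarrow> real \<Rightarrow> pt \<times> pt \<Rightarrow> pt \<times> pt \<Rightarrow> bool" where
  "xchart p \<epsilon> e f \<longleftrightarrow>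
     0 < \<epsilon> \<and> e \<in> D \<and> dir e \<bullet> normal (dir f) \<noteq> 0 \<and> ball p \<epsilon> \<inter> crossings D = {p} \<and>
     ball p \<epsilon> \<inter> K =
       ball p \<epsilon> \<inter> {z. (z - p) \<bullet> normal (dir e) = 0 \<or> (z - p) \<bullet> normal (dir f) = 0} \<and>
     (\<forall>q\<in>ball p \<epsilon>. q \<in> oseg e \<longleftrightarrow> (q - p) \<bullet> normal (dir e) = 0)"

text \<open>The signs \<sigma> and \<tau> select sides of the strands e and f; the sign 1 is the
  side into which the normal vector points.\<close>

definition quad :: "complex \<Rightarrow> real \<Rightarrow> pt \<times> pt \<Rightarrow> pt \<times> pt \<Rightarrow> real \<Rightarrow> real \<Rightarrow> complex set" where
  "quad p \<epsilon> e f \<sigma> \<tau> =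
     ball p \<epsilon> \<inter> {z. \<sigma> * ((z - p) \<bullet> normal (dir e)) > 0} \<inter> {z. \<tau> * ((z - p) \<bullet> normal (dir f)) > 0}"

definition half_strand :: "complex \<Rightarrow> real \<Rightarrow> pt \<times> pt \<Rightarrow> pt \<times> pt \<Rightarrow> real \<Rightarrow> complex set" where
  "half_strand p \<epsilon> e f \<tau> =
     ball p \<epsilon> \<inter> {z. (z - p) \<bullet> normal (dir e) = 0} \<inter> {z. \<tau> * ((z - p) \<bullet> normal (dir f)) > 0}"

text \<open>\<open>xchart\<close> looks at the strand of its first edge as cut by that of the second
  and ignores which one is over. Facts about half-strands are thus proved once and used for both
  strands.\<close>

lemma crossing_chart_xchart:
  assumes "crossing_chart D p \<epsilon> eu ev"
  shows "xchart p \<epsilon> eu ev" "xchart p \<epsilon> ev eu"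
  using assms inner_normal_swap[of "dir ev" "dir eu"]
  unfolding crossing_chart_def xchart_def by (simp_all add: disj_commute)

lemma quad_swap: "quad p \<epsilon> e f \<sigma> \<tau> = quad p \<epsilon> f e \<tau> \<sigma>"
  by (auto simp: quad_def)

lemma convex_signed_half_plane: "convex {z::complex. \<sigma> * ((z - p) \<bullet> w) > 0}"
  using half_plane(2)[of p "\<sigma> *\<^sub>R w"] by simp

lemma germ_quad:
  assumes "q \<in> ball p \<epsilon>"
    "\<sigma> * ((q - p) \<bullet> normal (dir e)) > 0 \<or> \<sigma> * ((q - p) \<bullet> normal (dir e)) = 0 \<and> \<sigma> * (w \<bullet> normal (dir e)) > 0"
    "\<tau> * ((q - p) \<bullet> normal (dir f)) > 0 \<or> \<tau> * ((q - p) \<bullet> normal (dir f)) = 0 \<and> \<tau> * (w \<bullet> normal (dir f)) > 0"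
  shows "germ_in q w (quad p \<epsilon> e f \<sigma> \<tau>)"
  unfolding quad_def
proof (intro germ_in_Int germ_in_open[OF open_ball assms(1)])
  show "germ_in q w {z. \<sigma> * ((z - p) \<bullet> normal (dir e)) > 0}"
    using eventually_affine_pos[OF assms(2)] unfolding germ_in_def
    by (rule eventually_mono) (simp add: inner_diff_left inner_add_left algebra_simps)
  show "germ_in q w {z. \<tau> * ((z - p) \<bullet> normal (dir f)) > 0}"
    using eventually_affine_pos[OF assms(3)] unfolding germ_in_def
    by (rule eventually_mono) (simp add: inner_diff_left inner_add_left algebra_simps)
qed

lemma quad_dir_exists:
  assumes "xchart p \<epsilon> e f" "\<sigma> \<in> {1, - 1}" "\<tau> \<in> {1, - 1}"
  obtains w where "\<sigma> * (w \<bullet> normal (dir e)) > 0" "\<tau> * (w \<bullet> normal (dir f)) > 0"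
proof -
  let ?a = "dir e \<bullet> normal (dir f)" and ?b = "dir f \<bullet> normal (dir e)"
  \<comment> \<open>Each direction is orthogonal to its own normal, so pairing w with one normal
    leaves a single term, and the coefficients are chosen to make it \<sigma> or \<tau> times a
    square.\<close>
  define w where "w = (\<tau> * ?a) *\<^sub>R dir e + (\<sigma> * ?b) *\<^sub>R dir f"
  have nz: "?a \<noteq> 0" "?b \<noteq> 0"
    using assms(1) inner_normal_swap[of "dir f" "dir e"] by (simp_all add: xchart_def)
  have "\<sigma> * (w \<bullet> normal (dir e)) = (\<sigma> * \<sigma>) * (?b * ?b)"
    "\<tau> * (w \<bullet> normal (dir f)) = (\<tau> * \<tau>) * (?a * ?a)"
    by (simp_all add: w_def inner_add_left)
  moreover have "\<sigma> * \<sigma> = 1" "\<tau> * \<tau> = 1" "?a * ?a > 0" "?b * ?b > 0"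
    using assms(2,3) nz by (auto simp: zero_less_mult_iff linorder_neq_iff)
  ultimately show ?thesis using that[of w] by simp
qed

lemma quad_region:
  assumes "xchart p \<epsilon> e f" "\<sigma> \<in> {1, - 1}" "\<tau> \<in> {1, - 1}"
  obtains r where "r \<in> regions D" "quad p \<epsilon> e f \<sigma> \<tau> \<subseteq> r"
proof (rule connected_in_region)
  show "connected (quad p \<epsilon> e f \<sigma> \<tau>)"
    unfolding quad_def
    by (intro convex_connected convex_Int convex_signed_half_plane convex_ball)
  obtain w where "\<sigma> * (w \<bullet> normal (dir e)) > 0" "\<tau> * (w \<bullet> normal (dir f)) > 0"
    by (rule quad_dir_exists[OF assms])
  moreover have "p \<in> ball p \<epsilon>" using assms(1) by (simp add: xchart_def)
  ultimately have "germ_in p w (quad p \<epsilon> e f \<sigma> \<tau>)" by (intro germ_quad) auto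
  then show "quad p \<epsilon> e f \<sigma> \<tau> \<noteq> {}" by (rule germ_in_nonempty)
  have bK: "ball p \<epsilon> \<inter> K = ball p \<epsilon> \<inter> {z. (z - p) \<bullet> normal (dir e) = 0 \<or> (z - p) \<bullet> normal (dir f) = 0}"
    using assms(1) unfolding xchart_def by (elim conjE)
  show "quad p \<epsilon> e f \<sigma> \<tau> \<inter> K = {}"
  proof (rule equals0I)
    fix z assume z: "z \<in> quad p \<epsilon> e f \<sigma> \<tau> \<inter> K"
    then have "z \<in> ball p \<epsilon> \<inter> K" by (simp add: quad_def)
    then have "z \<in> ball p \<epsilon> \<inter> {z. (z - p) \<bullet> normal (dir e) = 0 \<or> (z - p) \<bullet> normal (dir f) = 0}"
      by (simp only: bK)
    then show False using z by (auto simp: quad_def)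
  qed
qed

text \<open>A half-strand is convex and avoids p, so it lies in one semi-arc. At any of its points
  the normal vector of e leads into the quadrant with sign 1 and its negative into the one with sign
  -1, which identifies both sides.\<close>

lemma half_strand_arc:
  assumes x: "xchart p \<epsilon> e f" and \<tau>: "\<tau> \<in> {1, - 1}"
    and w: "w \<in> {dir e, - dir e}" "\<tau> * (w \<bullet> normal (dir f)) > 0"
  obtains s where "s \<in> semi_arcs D" "germ_in p w s" "half_strand p \<epsilon> e f \<tau> \<subseteq> s"
    "\<And>r. r \<in> regions D \<Longrightarrow> quad p \<epsilon> e f (- 1) \<tau> \<subseteq> r \<Longrightarrow> neg_side s = r"
    "\<And>r. r \<in> regions D \<Longrightarrow> quad p \<epsilon> e f 1 \<tau> \<subseteq> r \<Longrightarrow> pos_side s = r"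
proof -
  let ?A = "half_strand p \<epsilon> e f \<tau>"
  have \<epsilon>: "\<epsilon> > 0" and e: "e \<in> D" using x by (simp_all add: xchart_def)
  have we: "w \<bullet> normal (dir e) = 0" using w(1) by auto
  have germ: "germ_in p w ?A"
    unfolding half_strand_def
  proof (intro germ_in_Int germ_in_open[OF open_ball])
    show "p \<in> ball p \<epsilon>" using \<epsilon> by simp
    show "germ_in p w {z. (z - p) \<bullet> normal (dir e) = 0}" using we by (simp add: germ_in_def)
    have "\<forall>\<^sub>F t in at_right 0. 0 + t * (\<tau> * (w \<bullet> normal (dir f))) > 0"
      using w(2) by (intro eventually_affine_pos) simp
    then show "germ_in p w {z. \<tau> * ((z - p) \<bullet> normal (dir f)) > 0}"
      unfolding germ_in_def by (rule eventually_mono) (simp add: algebra_simps)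
  qed
  have line: "{z. (z - p) \<bullet> normal (dir e) = 0} = {z. normal (dir e) \<bullet> z = normal (dir e) \<bullet> p}"
    by (auto simp: inner_diff_left inner_diff_right inner_commute)
  have conn: "connected ?A"
    unfolding half_strand_def line
    by (intro convex_connected convex_Int convex_signed_half_plane convex_ball convex_hyperplane)
  have bK: "ball p \<epsilon> \<inter> K = ball p \<epsilon> \<inter> {z. (z - p) \<bullet> normal (dir e) = 0 \<or> (z - p) \<bullet> normal (dir f) = 0}"
    and bc: "ball p \<epsilon> \<inter> crossings D = {p}"
    and bo: "\<And>q. q \<in> ball p \<epsilon> \<Longrightarrow> q \<in> oseg e \<longleftrightarrow> (q - p) \<bullet> normal (dir e) = 0"
    using x unfolding xchart_def by simp_all
  have sub: "?A \<subseteq> K - crossings D"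
  proof
    fix z assume z: "z \<in> ?A"
    then have "z \<in> ball p \<epsilon> \<inter> {z. (z - p) \<bullet> normal (dir e) = 0 \<or> (z - p) \<bullet> normal (dir f) = 0}"
      by (simp add: half_strand_def)
    then have "z \<in> ball p \<epsilon> \<inter> K" by (simp only: bK)
    moreover have "z \<noteq> p" using z by (auto simp: half_strand_def)
    ultimately show "z \<in> K - crossings D" using bc by (metis Diff_iff Int_iff singletonD)
  qed
  obtain s where s: "s \<in> semi_arcs D" "?A \<subseteq> s"
    by (rule connected_in_semi_arc[OF conn germ_in_nonempty[OF germ] sub])
  obtain q where q: "q \<in> ?A" using germ_in_nonempty[OF germ] by blast
  then have qq: "q \<in> ball p \<epsilon>" "(q - p) \<bullet> normal (dir e) = 0" "\<tau> * ((q - p) \<bullet> normal (dir f)) > 0"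
    by (simp_all add: half_strand_def)
  have qs: "q \<in> s \<inter> oseg e" using subsetD[OF s(2) q] bo[OF qq(1)] qq(2) by simp
  have nn: "dir e \<bullet> dir e > 0" using dir_nonzero[OF e] by simp
  have g: "germ_in q (- normal (dir e)) (quad p \<epsilon> e f (- 1) \<tau>)" "germ_in q (normal (dir e)) (quad p \<epsilon> e f 1 \<tau>)"
    using qq nn by (auto intro!: germ_quad)
  show ?thesis
  proof (rule that[OF s(1) germ_in_mono[OF germ s(2)] s(2)])
    show "neg_side s = r" if "r \<in> regions D" "quad p \<epsilon> e f (- 1) \<tau> \<subseteq> r" for r
      using side_eqI(1)[OF s(1) that(1) e qs] germ_in_mono[OF g(1) that(2)] .
    show "pos_side s = r" if "r \<in> regions D" "quad p \<epsilon> e f 1 \<tau> \<subseteq> r" for r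
      using side_eqI(2)[OF s(1) that(1) e qs] germ_in_mono[OF g(2) that(2)] .
  qed
qed

text \<open>At most one of v and -v makes a negative product with m, so the direction, and with it
  the semi-arc, is determined.\<close>

lemma branch_eq:
  assumes "s \<in> semi_arcs D" "germ_in p w s" "w \<in> {v, - v}" "w \<bullet> m < 0"
  shows "branch D p v m = s"
  unfolding branch_def
proof (rule the_equality)
  show "s \<in> semi_arcs D \<and> (\<exists>w\<in>{v, - v}. w \<bullet> m < 0 \<and> germ_in p w s)" using assms by blast
  fix s' assume s': "s' \<in> semi_arcs D \<and> (\<exists>w\<in>{v, - v}. w \<bullet> m < 0 \<and> germ_in p w s')"
  then obtain w' where w': "w' \<in> {v, - v}" "w' \<bullet> m < 0" "germ_in p w' s'" by blast
  then have "w' = w" using assms(3,4) by auto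
  then show "s' = s" using s' w' assms component_germ_unique unfolding semi_arcs_def by blast
qed

text \<open>\<open>w\<close> is the direction of the half of \<open>e\<close> that starts at \<open>p\<close> and lies on the \<open>\<tau>\<close>-side of \<open>f\<close>.\<close>

lemma branch_half_strand:
  assumes x: "xchart p \<epsilon> e f" and \<tau>: "\<tau> \<in> {1, - 1}"
    and w: "w \<in> {dir e, - dir e}" "\<tau> * (w \<bullet> normal (dir f)) > 0"
  defines "s \<equiv> branch D p (dir e) (- \<tau> *\<^sub>R normal (dir f))"
  shows "s \<in> semi_arcs D" "germ_in p w s" "half_strand p \<epsilon> e f \<tau> \<subseteq> s"
    and "\<And>r. r \<in> regions D \<Longrightarrow> quad p \<epsilon> e f (- 1) \<tau> \<subseteq> r \<Longrightarrow> neg_side s = r"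
    and "\<And>r. r \<in> regions D \<Longrightarrow> quad p \<epsilon> e f 1 \<tau> \<subseteq> r \<Longrightarrow> pos_side s = r"
proof -
  obtain s' where s': "s' \<in> semi_arcs D" "germ_in p w s'" "half_strand p \<epsilon> e f \<tau> \<subseteq> s'"
    "\<And>r. r \<in> regions D \<Longrightarrow> quad p \<epsilon> e f (- 1) \<tau> \<subseteq> r \<Longrightarrow> neg_side s' = r"
    "\<And>r. r \<in> regions D \<Longrightarrow> quad p \<epsilon> e f 1 \<tau> \<subseteq> r \<Longrightarrow> pos_side s' = r"
    by (rule half_strand_arc[OF x \<tau> w], rule that)
  have "s = s'" unfolding s_def using w s' by (intro branch_eq) auto
  then show "s \<in> semi_arcs D" "germ_in p w s" "half_strand p \<epsilon> e f \<tau> \<subseteq> s"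
    "\<And>r. r \<in> regions D \<Longrightarrow> quad p \<epsilon> e f (- 1) \<tau> \<subseteq> r \<Longrightarrow> neg_side s = r"
    "\<And>r. r \<in> regions D \<Longrightarrow> quad p \<epsilon> e f 1 \<tau> \<subseteq> r \<Longrightarrow> pos_side s = r"
    using s' by simp_all
qed

lemma strand_direction:
  assumes "xchart p \<epsilon> e f" "\<tau> \<in> {1, - 1}"
  obtains w where "w \<in> {dir e, - dir e}" "\<tau> * (w \<bullet> normal (dir f)) > 0"
proof (cases "\<tau> * (dir e \<bullet> normal (dir f)) > 0")
  case True
  show ?thesis by (rule that[OF _ True]) simp
next
  case False
  have "dir e \<bullet> normal (dir f) \<noteq> 0" using assms(1) unfolding xchart_def by (elim conjE)
  moreover have "\<tau> \<noteq> 0" using assms(2) by auto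
  ultimately have "\<tau> * (dir e \<bullet> normal (dir f)) \<noteq> 0" by simp
  then have "\<tau> * (dir e \<bullet> normal (dir f)) < 0" using False by linarith
  then have "\<tau> * ((- dir e) \<bullet> normal (dir f)) > 0" by simp
  then show ?thesis by (rule that[rotated]) simp
qed

context
  fixes p \<epsilon> eu ev assumes chart: "crossing_chart D p \<epsilon> eu ev"
begin

text \<open>The index 1 belongs to \<tau> = -1, the half from which the normal of the other strand
  points away, and the index 2 to \<tau> = 1. The signs stay unevaluated to match
  \<open>branch_half_strand\<close>.\<close>

lemma branch_defs:
  "under1 D p = branch D p (dir eu) (- (- 1) *\<^sub>R normal (dir ev))"
  "under2 D p = branch D p (dir eu) (- 1 *\<^sub>R normal (dir ev))"
  "over1 D p = branch D p (dir ev) (- (- 1) *\<^sub>R normal (dir eu))"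
  "over2 D p = branch D p (dir ev) (- 1 *\<^sub>R normal (dir eu))"
  using chart by (simp_all add: crossing_chart_def under1_def under2_def over1_def over2_def)

lemma crossing_branches:
  "under1 D p \<in> semi_arcs D" "under2 D p \<in> semi_arcs D" "over1 D p \<in> semi_arcs D" "over2 D p \<in> semi_arcs D"
  "half_strand p \<epsilon> eu ev (- 1) \<subseteq> under1 D p" "half_strand p \<epsilon> eu ev 1 \<subseteq> under2 D p"
  "half_strand p \<epsilon> ev eu (- 1) \<subseteq> over1 D p" "half_strand p \<epsilon> ev eu 1 \<subseteq> over2 D p"
proof -
  note x = crossing_chart_xchart[OF chart]
  have t: "- 1 \<in> {1, - 1::real}" "1 \<in> {1, - 1::real}" by auto
  obtain w1 where w1: "w1 \<in> {dir eu, - dir eu}" "- 1 * (w1 \<bullet> normal (dir ev)) > 0"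
    by (rule strand_direction[OF x(1) t(1)])
  obtain w2 where w2: "w2 \<in> {dir eu, - dir eu}" "1 * (w2 \<bullet> normal (dir ev)) > 0"
    by (rule strand_direction[OF x(1) t(2)])
  obtain w3 where w3: "w3 \<in> {dir ev, - dir ev}" "- 1 * (w3 \<bullet> normal (dir eu)) > 0"
    by (rule strand_direction[OF x(2) t(1)])
  obtain w4 where w4: "w4 \<in> {dir ev, - dir ev}" "1 * (w4 \<bullet> normal (dir eu)) > 0"
    by (rule strand_direction[OF x(2) t(2)])
  show "under1 D p \<in> semi_arcs D" "half_strand p \<epsilon> eu ev (- 1) \<subseteq> under1 D p"
    unfolding branch_defs by (rule branch_half_strand[OF x(1) t(1) w1])+
  show "under2 D p \<in> semi_arcs D" "half_strand p \<epsilon> eu ev 1 \<subseteq> under2 D p"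
    unfolding branch_defs by (rule branch_half_strand[OF x(1) t(2) w2])+
  show "over1 D p \<in> semi_arcs D" "half_strand p \<epsilon> ev eu (- 1) \<subseteq> over1 D p"
    unfolding branch_defs by (rule branch_half_strand[OF x(2) t(1) w3])+
  show "over2 D p \<in> semi_arcs D" "half_strand p \<epsilon> ev eu 1 \<subseteq> over2 D p"
    unfolding branch_defs by (rule branch_half_strand[OF x(2) t(2) w4])+
qed

text \<open>Each quadrant lies in a region, and each half-strand separates two adjacent quadrants.
  The equations compare the two half-strands that bound a common quadrant;
  \<open>cr_region D p\<close> contains the quadrant with both signs negative.\<close>

lemma crossing_sides:
  "cr_region D p \<in> regions D"
  "neg_side (under1 D p) = cr_region D p" "neg_side (over1 D p) = cr_region D p"
  "pos_side (under1 D p) = neg_side (over2 D p)" "pos_side (over1 D p) = neg_side (under2 D p)"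
  "pos_side (under2 D p) = pos_side (over2 D p)"
  "quad p \<epsilon> eu ev (- 1) (- 1) \<subseteq> neg_side (under1 D p)" "quad p \<epsilon> eu ev 1 (- 1) \<subseteq> pos_side (under1 D p)"
  "quad p \<epsilon> eu ev (- 1) 1 \<subseteq> pos_side (over1 D p)" "quad p \<epsilon> eu ev 1 1 \<subseteq> pos_side (under2 D p)"
proof -
  note x = crossing_chart_xchart[OF chart]
  have t: "- 1 \<in> {1, - 1::real}" "1 \<in> {1, - 1::real}" by auto
  obtain rmm where mm: "rmm \<in> regions D" "quad p \<epsilon> eu ev (- 1) (- 1) \<subseteq> rmm" by (rule quad_region[OF x(1) t(1) t(1)])
  obtain rpm where pm: "rpm \<in> regions D" "quad p \<epsilon> eu ev 1 (- 1) \<subseteq> rpm" by (rule quad_region[OF x(1) t(2) t(1)])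
  obtain rmp where mp: "rmp \<in> regions D" "quad p \<epsilon> eu ev (- 1) 1 \<subseteq> rmp" by (rule quad_region[OF x(1) t(1) t(2)])
  obtain rpp where pp: "rpp \<in> regions D" "quad p \<epsilon> eu ev 1 1 \<subseteq> rpp" by (rule quad_region[OF x(1) t(2) t(2)])
  have p: "p \<in> ball p \<epsilon>" using x(1) by (simp add: xchart_def)
  have dirs: "under_dir D p = dir eu" "over_dir D p = dir ev" using chart by (simp_all add: crossing_chart_def)
  have cr: "cr_region D p = rmm"
    unfolding cr_region_def dirs
  proof (rule the_equality)
    have g: "germ_in p w rmm" if "w \<bullet> normal (dir eu) < 0" "w \<bullet> normal (dir ev) < 0" for w
      using that by (intro germ_in_mono[OF germ_quad mm(2)] p) auto
    obtain w where "- 1 * (w \<bullet> normal (dir eu)) > 0" "- 1 * (w \<bullet> normal (dir ev)) > 0"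
      by (rule quad_dir_exists[OF x(1) t(1) t(1)])
    then show "rmm \<in> regions D \<and> (\<exists>w. w \<bullet> normal (dir eu) < 0 \<and> w \<bullet> normal (dir ev) < 0 \<and> germ_in p w rmm)"
      using g mm(1) by auto
    fix r assume "r \<in> regions D \<and> (\<exists>w. w \<bullet> normal (dir eu) < 0 \<and> w \<bullet> normal (dir ev) < 0 \<and> germ_in p w r)"
    then show "r = rmm" using g mm(1) component_germ_unique unfolding regions_def by blast
  qed
  obtain w1 where w1: "w1 \<in> {dir eu, - dir eu}" "- 1 * (w1 \<bullet> normal (dir ev)) > 0"
    by (rule strand_direction[OF x(1) t(1)])
  obtain w2 where w2: "w2 \<in> {dir eu, - dir eu}" "1 * (w2 \<bullet> normal (dir ev)) > 0"
    by (rule strand_direction[OF x(1) t(2)])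
  obtain w3 where w3: "w3 \<in> {dir ev, - dir ev}" "- 1 * (w3 \<bullet> normal (dir eu)) > 0"
    by (rule strand_direction[OF x(2) t(1)])
  obtain w4 where w4: "w4 \<in> {dir ev, - dir ev}" "1 * (w4 \<bullet> normal (dir eu)) > 0"
    by (rule strand_direction[OF x(2) t(2)])
  have "neg_side (under1 D p) = rmm" "pos_side (under1 D p) = rpm"
    using branch_half_strand(4,5)[OF x(1) t(1) w1] mm pm unfolding branch_defs by blast+
  moreover have "neg_side (under2 D p) = rmp" "pos_side (under2 D p) = rpp"
    using branch_half_strand(4,5)[OF x(1) t(2) w2] mp pp unfolding branch_defs by blast+
  moreover have "neg_side (over1 D p) = rmm" "pos_side (over1 D p) = rmp"
    using branch_half_strand(4,5)[OF x(2) t(1) w3] mm mp unfolding branch_defs quad_swap[of p \<epsilon> ev] by blast+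
  moreover have "neg_side (over2 D p) = rpm" "pos_side (over2 D p) = rpp"
    using branch_half_strand(4,5)[OF x(2) t(2) w4] pm pp unfolding branch_defs quad_swap[of p \<epsilon> ev] by blast+
  ultimately show "cr_region D p \<in> regions D"
    "neg_side (under1 D p) = cr_region D p" "neg_side (over1 D p) = cr_region D p"
    "pos_side (under1 D p) = neg_side (over2 D p)" "pos_side (over1 D p) = neg_side (under2 D p)"
    "pos_side (under2 D p) = pos_side (over2 D p)"
    "quad p \<epsilon> eu ev (- 1) (- 1) \<subseteq> neg_side (under1 D p)" "quad p \<epsilon> eu ev 1 (- 1) \<subseteq> pos_side (under1 D p)"
    "quad p \<epsilon> eu ev (- 1) 1 \<subseteq> pos_side (over1 D p)" "quad p \<epsilon> eu ev 1 1 \<subseteq> pos_side (under2 D p)"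
    using cr mm pm mp pp by simp_all
qed

text \<open>At a positive crossing the under-strand runs from \<open>under1\<close> to
  \<open>under2\<close> but the over-strand from \<open>over2\<close> to \<open>over1\<close>; at a
  negative crossing both are reversed. This is the link between the sign and the direction of
  travel.\<close>

lemma crossing_germs_positive:
  assumes "dir eu \<bullet> normal (dir ev) > 0"
  shows "germ_in p (- dir eu) (under1 D p)" "germ_in p (dir eu) (under2 D p)"
    "germ_in p (dir ev) (over1 D p)" "germ_in p (- dir ev) (over2 D p)"
proof -
  note x = crossing_chart_xchart[OF chart]
  have t: "- 1 \<in> {1, - 1::real}" "1 \<in> {1, - 1::real}" by auto
  have a: "dir ev \<bullet> normal (dir eu) < 0" using assms inner_normal_swap[of "dir ev" "dir eu"] by simp
  show "germ_in p (- dir eu) (under1 D p)"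
    unfolding branch_defs by (rule branch_half_strand(2)[OF x(1) t(1)]) (use assms a in simp_all)
  show "germ_in p (dir eu) (under2 D p)"
    unfolding branch_defs by (rule branch_half_strand(2)[OF x(1) t(2)]) (use assms a in simp_all)
  show "germ_in p (dir ev) (over1 D p)"
    unfolding branch_defs by (rule branch_half_strand(2)[OF x(2) t(1)]) (use assms a in simp_all)
  show "germ_in p (- dir ev) (over2 D p)"
    unfolding branch_defs by (rule branch_half_strand(2)[OF x(2) t(2)]) (use assms a in simp_all)
qed

lemma crossing_germs_negative:
  assumes "\<not> dir eu \<bullet> normal (dir ev) > 0"
  shows "germ_in p (dir eu) (under1 D p)" "germ_in p (- dir eu) (under2 D p)"
    "germ_in p (- dir ev) (over1 D p)" "germ_in p (dir ev) (over2 D p)"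
proof -
  note x = crossing_chart_xchart[OF chart]
  have t: "- 1 \<in> {1, - 1::real}" "1 \<in> {1, - 1::real}" by auto
  have b: "dir eu \<bullet> normal (dir ev) < 0" using assms x(1) unfolding xchart_def by linarith
  then have a: "dir ev \<bullet> normal (dir eu) > 0" using inner_normal_swap[of "dir ev" "dir eu"] by simp
  show "germ_in p (dir eu) (under1 D p)"
    unfolding branch_defs by (rule branch_half_strand(2)[OF x(1) t(1)]) (use a b in simp_all)
  show "germ_in p (- dir eu) (under2 D p)"
    unfolding branch_defs by (rule branch_half_strand(2)[OF x(1) t(2)]) (use a b in simp_all)
  show "germ_in p (- dir ev) (over1 D p)"
    unfolding branch_defs by (rule branch_half_strand(2)[OF x(2) t(1)]) (use a b in simp_all)
  show "germ_in p (dir ev) (over2 D p)"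
    unfolding branch_defs by (rule branch_half_strand(2)[OF x(2) t(2)]) (use a b in simp_all)
qed

end

end

section \<open>Gluing local colourings\<close>

context regular_diagram
begin

text \<open>The components of \<open>C s\<close> are read as proposed colours of the negative and
  the positive side of s. Each equation belongs to one quadrant and says that its two bounding
  half-strands make the same proposal.\<close>

definition corner_compatible :: "(complex set \<Rightarrow> 'x \<times> 'x) \<Rightarrow> bool" where
  "corner_compatible C \<longleftrightarrow> (\<forall>p\<in>crossings D.
     fst (C (under1 D p)) = fst (C (over1 D p)) \<and> snd (C (under1 D p)) = fst (C (over2 D p)) \<and>
     snd (C (over1 D p)) = fst (C (under2 D p)) \<and> snd (C (under2 D p)) = snd (C (over2 D p)))"

text \<open>Only the values of \<open>F\<close> off the diagram are constrained: locally constant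
  there, with the prescribed limits on both sides of each semi-arc. The radius is also that of a
  chart if p is not a crossing, so that two such functions can be compared.\<close>

definition local_colouring ::
  "(complex set \<Rightarrow> 'x \<times> 'x) \<Rightarrow> complex \<Rightarrow> real \<Rightarrow> (complex \<Rightarrow> 'x) \<Rightarrow> bool" where
  "local_colouring C p \<epsilon> F \<longleftrightarrow> 0 < \<epsilon> \<and> ball p \<epsilon> \<inter> crossings D \<subseteq> {p} \<and>
     (p \<notin> crossings D \<longrightarrow> (\<exists>L R. noncrossing_chart D p \<epsilon> L R)) \<and>
     (\<forall>z\<in>ball p \<epsilon> - K. \<exists>U. open U \<and> z \<in> U \<and> (\<forall>y\<in>U. F z = F y)) \<and>
     (\<forall>e\<in>D. \<forall>s\<in>semi_arcs D. \<forall>q\<in>ball p \<epsilon> \<inter> oseg e \<inter> s.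
        germ_in q (normal (dir e)) {z. F z = snd (C s)} \<and>
        germ_in q (- normal (dir e)) {z. F z = fst (C s)})"

lemma local_colouring_noncrossing:
  assumes "p \<in> K" "p \<notin> crossings D"
  shows "\<exists>\<epsilon> F. local_colouring C p \<epsilon> F"
proof -
  obtain \<epsilon> L R where ch: "noncrossing_chart D p \<epsilon> L R" using noncrossing_chart_exists[OF assms] by blast
  have pK: "p \<in> K - crossings D" using assms by blast
  obtain s0 where s0: "s0 \<in> semi_arcs D" "p \<in> s0" by (rule in_semi_arc[OF pK])
  have \<epsilon>: "0 < \<epsilon>" and LR: "open L" "open R" "L \<inter> R = {}" "L \<union> R = ball p \<epsilon> - K"
    and cr: "ball p \<epsilon> \<inter> crossings D = {}"
    and g: "\<And>e q. e \<in> D \<Longrightarrow> q \<in> ball p \<epsilon> \<inter> oseg e \<Longrightarrow> germ_in q (normal (dir e)) L \<and> germ_in q (- normal (dir e)) R"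
    using ch unfolding noncrossing_chart_def by simp_all
  define F where "F z = (if z \<in> L then snd (C s0) else fst (C s0))" for z
  have FL': "F z = snd (C s0)" if "z \<in> L" for z using that by (simp add: F_def)
  have FR': "F z = fst (C s0)" if "z \<in> R" for z using that LR(3) unfolding F_def by (metis disjoint_iff)
  have FL: "L \<subseteq> {z. F z = snd (C s0)}" and FR: "R \<subseteq> {z. F z = fst (C s0)}"
    using FL' FR' by blast+
  have "\<exists>U. open U \<and> z \<in> U \<and> (\<forall>y\<in>U. F z = F y)" if "z \<in> ball p \<epsilon> - K" for z
  proof -
    have "z \<in> L \<or> z \<in> R" using that LR(4) by blast
    then show ?thesis
    proof
      assume "z \<in> L"
      then show ?thesis using LR(1) FL' by (intro exI[of _ L]) simp
    next
      assume "z \<in> R"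
      then show ?thesis using LR(2) FR' by (intro exI[of _ R]) simp
    qed
  qed
  moreover have "germ_in q (normal (dir e)) {z. F z = snd (C s)} \<and>
        germ_in q (- normal (dir e)) {z. F z = fst (C s)}"
    if q: "e \<in> D" "s \<in> semi_arcs D" "q \<in> ball p \<epsilon> \<inter> oseg e \<inter> s" for e s q
  proof -
    have "q \<in> s0" using chart_in_semi_arc[OF ch s0 \<epsilon> order_refl] q oseg_subset[OF q(1)] by blast
    then have "s = s0" using semi_arc_eq[OF q(2) s0(1)] q(3) by blast
    moreover have "q \<in> ball p \<epsilon> \<inter> oseg e" using q(3) by blast
    ultimately show ?thesis
      using germ_in_mono[OF conjunct1[OF g[OF q(1)]] FL] germ_in_mono[OF conjunct2[OF g[OF q(1)]] FR] by simp
  qed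
  ultimately have "local_colouring C p \<epsilon> F"
    unfolding local_colouring_def using \<epsilon> cr ch by blast
  then show ?thesis by blast
qed

text \<open>One value is given to each quadrant. It is taken from one of the two bounding
  half-strands, and compatibility ensures that it is also right for the other.\<close>

lemma local_colouring_crossing:
  assumes p: "p \<in> crossings D" and C: "corner_compatible C"
  shows "\<exists>\<epsilon> F. local_colouring C p \<epsilon> F"
proof -
  obtain \<epsilon> eu ev where ch: "crossing_chart D p \<epsilon> eu ev" using crossing_chart_exists[OF p] by blast
  note x = crossing_chart_xchart[OF ch]
  note br = crossing_branches[OF ch]
  let ?h = "\<lambda>z. (z - p) \<bullet> normal (dir eu)" and ?k = "\<lambda>z. (z - p) \<bullet> normal (dir ev)"
  let ?Q = "quad p \<epsilon> eu ev"
  have \<epsilon>: "0 < \<epsilon>" and D: "eu \<in> D" "ev \<in> D" and cr: "ball p \<epsilon> \<inter> crossings D = {p}"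
    and bK: "ball p \<epsilon> \<inter> K = ball p \<epsilon> \<inter> {z. ?h z = 0 \<or> ?k z = 0}"
    and nonpar: "dir eu \<bullet> normal (dir ev) \<noteq> 0"
    and os: "\<And>q. q \<in> ball p \<epsilon> \<Longrightarrow> (q \<in> oseg eu \<longleftrightarrow> ?h q = 0) \<and> (q \<in> oseg ev \<longleftrightarrow> ?k q = 0) \<and>
        (\<forall>e\<in>D. q \<in> oseg e \<longrightarrow> e = eu \<or> e = ev)"
    using ch unfolding crossing_chart_def by simp_all
  have c: "fst (C (under1 D p)) = fst (C (over1 D p))" "snd (C (under1 D p)) = fst (C (over2 D p))"
    "snd (C (over1 D p)) = fst (C (under2 D p))" "snd (C (under2 D p)) = snd (C (over2 D p))"
    using C p unfolding corner_compatible_def by blast+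
  define F where "F z = (if ?h z < 0 then (if ?k z < 0 then fst (C (under1 D p)) else snd (C (over1 D p)))
     else (if ?k z < 0 then snd (C (under1 D p)) else snd (C (under2 D p))))" for z
  have F: "?Q (- 1) (- 1) \<subseteq> {z. F z = fst (C (under1 D p))}" "?Q 1 (- 1) \<subseteq> {z. F z = snd (C (under1 D p))}"
    "?Q (- 1) 1 \<subseteq> {z. F z = snd (C (over1 D p))}" "?Q 1 1 \<subseteq> {z. F z = snd (C (under2 D p))}"
    by (auto simp: quad_def F_def)
  have oQ: "open (?Q \<sigma> \<tau>)" for \<sigma> \<tau>
    unfolding quad_def using half_plane(4)[of p "\<sigma> *\<^sub>R normal (dir eu)"] half_plane(4)[of p "\<tau> *\<^sub>R normal (dir ev)"]
    by (intro open_Int open_ball) simp_all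
  have "\<exists>U. open U \<and> z \<in> U \<and> (\<forall>y\<in>U. F z = F y)" if z: "z \<in> ball p \<epsilon> - K" for z
  proof -
    have "z \<notin> ball p \<epsilon> \<inter> {z. ?h z = 0 \<or> ?k z = 0}" using z unfolding bK[symmetric] by simp
    then have "?h z \<noteq> 0" "?k z \<noteq> 0" using z by simp_all
    then have "z \<in> ?Q (- 1) (- 1) \<or> z \<in> ?Q 1 (- 1) \<or> z \<in> ?Q (- 1) 1 \<or> z \<in> ?Q 1 1"
      using z by (auto simp: quad_def linorder_neq_iff)
    then obtain \<sigma> \<tau> v where Q: "z \<in> ?Q \<sigma> \<tau>" "?Q \<sigma> \<tau> \<subseteq> {z. F z = v}" using F by blast
    have "F y = v" if "y \<in> ?Q \<sigma> \<tau>" for y using subsetD[OF Q(2) that] by simp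
    then show ?thesis using oQ Q(1) by (intro exI[of _ "?Q \<sigma> \<tau>"]) simp
  qed
  moreover have "germ_in q (normal (dir e)) {z. F z = snd (C s)} \<and>
        germ_in q (- normal (dir e)) {z. F z = fst (C s)}"
    if e: "e \<in> D" and s: "s \<in> semi_arcs D" and qq: "q \<in> ball p \<epsilon> \<inter> oseg e \<inter> s" for e s q
  proof -
    have q: "q \<in> ball p \<epsilon>" "q \<in> oseg e" "q \<in> s" using qq by auto
    have "q \<noteq> p" using q(3) semi_arc_subset[OF s] p by blast
    \<comment> \<open>The two linear forms vanish together only at p, which lies on no
      semi-arc.\<close>
    have nz: "\<not> (?h q = 0 \<and> ?k q = 0)"
    proof
      assume a: "?h q = 0 \<and> ?k q = 0"
      then obtain t where "q - p = t *\<^sub>R dir eu" using inner_normal_eq_0 dir_nonzero[OF D(1)] by blast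
      then show False using a nonpar \<open>q \<noteq> p\<close> by simp
    qed
    have nn: "dir eu \<bullet> dir eu > 0" "dir ev \<bullet> dir ev > 0" using dir_nonzero D by simp_all
    note gQ = germ_in_mono[OF germ_quad[OF q(1)]]
    have "e = eu \<or> e = ev" using os[OF q(1)] e q(2) by blast
    then show ?thesis
    proof
      assume [simp]: "e = eu"
      have h: "?h q = 0" using os[OF q(1)] q(2) by simp
      then consider "?k q < 0" | "?k q > 0" using nz by linarith
      then show ?thesis
      proof cases
        case 1
        then have "q \<in> half_strand p \<epsilon> eu ev (- 1)" using q h by (simp add: half_strand_def)
        then have "s = under1 D p" using semi_arc_eq[OF s br(1) q(3)] br(5) by blast
        then show ?thesis
          using gQ[of 1 eu "normal (dir eu)" "- 1" ev, OF _ _ F(2)]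
            gQ[of "- 1" eu "- normal (dir eu)" "- 1" ev, OF _ _ F(1)] h nn 1 by simp
      next
        case 2
        then have "q \<in> half_strand p \<epsilon> eu ev 1" using q h by (simp add: half_strand_def)
        then have "s = under2 D p" using semi_arc_eq[OF s br(2) q(3)] br(6) by blast
        then show ?thesis
          using gQ[of 1 eu "normal (dir eu)" 1 ev, OF _ _ F(4)]
            gQ[of "- 1" eu "- normal (dir eu)" 1 ev, OF _ _ F(3)] h nn 2 c by simp
      qed
    next
      assume [simp]: "e = ev"
      have k: "?k q = 0" using os[OF q(1)] q(2) by simp
      then consider "?h q < 0" | "?h q > 0" using nz by linarith
      then show ?thesis
      proof cases
        case 1
        then have "q \<in> half_strand p \<epsilon> ev eu (- 1)" using q k by (simp add: half_strand_def)
        then have "s = over1 D p" using semi_arc_eq[OF s br(3) q(3)] br(7) by blast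
        then show ?thesis
          using gQ[of "- 1" eu "normal (dir ev)" 1 ev, OF _ _ F(3)]
            gQ[of "- 1" eu "- normal (dir ev)" "- 1" ev, OF _ _ F(1)] k nn 1 c by simp
      next
        case 2
        then have "q \<in> half_strand p \<epsilon> ev eu 1" using q k by (simp add: half_strand_def)
        then have "s = over2 D p" using semi_arc_eq[OF s br(4) q(3)] br(8) by blast
        then show ?thesis
          using gQ[of 1 eu "normal (dir ev)" 1 ev, OF _ _ F(4)]
            gQ[of 1 eu "- normal (dir ev)" "- 1" ev, OF _ _ F(2)] k nn 2 c by simp
      qed
    qed
  qed
  ultimately have "local_colouring C p \<epsilon> F"
    unfolding local_colouring_def using \<epsilon> cr p by blast
  then show ?thesis by blast
qed

section \<open>Agreement of local colourings on overlaps\<close>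

lemma locally_constant_on_connected:
  assumes "connected S" "a \<in> S" "b \<in> S" "\<And>z. z \<in> S \<Longrightarrow> \<exists>U. open U \<and> z \<in> U \<and> (\<forall>y\<in>U. F z = F y)"
  shows "F a = F b"
proof (rule connected_local_const[OF assms(1-3)], rule ballI)
  fix x assume "x \<in> S"
  then obtain U where "open U" "x \<in> U" "\<forall>y\<in>U. F x = F y" using assms(4) by blast
  then show "\<forall>\<^sub>F y in at x within S. F x = F y"
    unfolding eventually_at_topological by blast
qed

text \<open>The smaller ball lies in the larger one, whose only possible crossing is its own centre,
  so q is no crossing and has two connected local sides. On each side both functions are constant,
  and next to an interior edge point both take the value prescribed by the semi-arc.\<close>

lemma local_colourings_agree_aux:
  assumes p: "local_colouring C p \<epsilon> F" and q: "q \<in> K" "local_colouring C q \<delta> G" and "\<delta> \<le> \<epsilon>"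
    and z: "z \<in> ball p (\<epsilon> / 3)" "z \<in> ball q (\<delta> / 3)" "z \<notin> K" and "p \<noteq> q"
  shows "F z = G z"
proof -
  have \<delta>: "0 < \<delta>" using q(2) unfolding local_colouring_def by blast
  \<comment> \<open>The thirds are chosen for this: a point of the small ball has distance less than
    \<epsilon>/3 + \<delta>/3 + \<delta>/3 from p, and \<delta> is at most \<epsilon>.\<close>
  have sub: "ball q (\<delta> / 3) \<subseteq> ball p \<epsilon>"
  proof
    fix y assume "y \<in> ball q (\<delta> / 3)"
    then have "dist p y \<le> dist p z + dist z q + dist q y" "dist p z < \<epsilon> / 3" "dist z q < \<delta> / 3" "dist q y < \<delta> / 3"
      using z dist_triangle[of p y z] dist_triangle[of z y q] by (auto simp: dist_commute)
    then show "y \<in> ball p \<epsilon>" using assms(4) by simp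
  qed
  have sub': "ball q (\<delta> / 3) \<subseteq> ball q \<delta>" using \<delta> by (intro subset_ball) simp
  have "q \<in> ball p \<epsilon>" using subsetD[OF sub, of q] \<delta> by simp
  then have "q \<notin> crossings D" using p \<open>p \<noteq> q\<close> unfolding local_colouring_def by blast
  then obtain L R where ch: "noncrossing_chart D q \<delta> L R" using q(2) unfolding local_colouring_def by blast
  have d3: "0 < \<delta> / 3" "\<delta> / 3 \<le> \<delta>" using \<delta> by simp_all
  have LR: "L \<union> R = ball q \<delta> - K" "connected (L \<inter> ball q (\<delta> / 3))" "connected (R \<inter> ball q (\<delta> / 3))"
    using ch d3 unfolding noncrossing_chart_def by simp_all
  obtain e q' where e: "e \<in> D" "q' \<in> ball q (\<delta> / 3) \<inter> oseg e"
    using ch d3(1) unfolding noncrossing_chart_def by blast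
  have g: "germ_in q' (normal (dir e)) L" "germ_in q' (- normal (dir e)) R"
    using ch e sub' unfolding noncrossing_chart_def by blast+
  have "q' \<in> K - crossings D"
    using e oseg_subset sub' ch unfolding noncrossing_chart_def by blast
  then obtain s where s: "s \<in> semi_arcs D" "q' \<in> s" by (rule in_semi_arc)
  have qb: "q' \<in> ball p \<epsilon> \<inter> oseg e \<inter> s" "q' \<in> ball q \<delta> \<inter> oseg e \<inter> s" using e s sub sub' by blast+
  have gF: "germ_in q' (normal (dir e)) {z. F z = snd (C s)} \<and> germ_in q' (- normal (dir e)) {z. F z = fst (C s)}"
    using p e(1) s(1) qb(1) unfolding local_colouring_def by blast
  have gG: "germ_in q' (normal (dir e)) {z. G z = snd (C s)} \<and> germ_in q' (- normal (dir e)) {z. G z = fst (C s)}"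
    using q(2) e(1) s(1) qb(2) unfolding local_colouring_def by blast
  have gb: "germ_in q' w (ball q (\<delta> / 3))" for w using e(2) by (intro germ_in_open) auto
  have lF: "\<And>z. z \<in> ball p \<epsilon> - K \<Longrightarrow> \<exists>U. open U \<and> z \<in> U \<and> (\<forall>y\<in>U. F z = F y)"
    using p unfolding local_colouring_def by blast
  have lG: "\<And>z. z \<in> ball q \<delta> - K \<Longrightarrow> \<exists>U. open U \<and> z \<in> U \<and> (\<forall>y\<in>U. G z = G y)"
    using q(2) unfolding local_colouring_def by blast
  have key: "F z = G z"
    if S: "connected (S \<inter> ball q (\<delta> / 3))" "S \<subseteq> ball q \<delta> - K" "z \<in> S"
      and gS: "germ_in q' w S" "germ_in q' w {z. F z = v}" "germ_in q' w {z. G z = v}" for S w v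
  proof -
    obtain y where y: "y \<in> S \<inter> ball q (\<delta> / 3)" "F y = v" "G y = v"
      using germ_in_nonempty[OF germ_in_Int[OF germ_in_Int[OF gS(1) gb] germ_in_Int[OF gS(2,3)]]] by blast
    have zS: "z \<in> S \<inter> ball q (\<delta> / 3)" using S(3) z(2) by blast
    have "F z = F y"
      by (rule locally_constant_on_connected[OF S(1) zS y(1) lF]) (use sub S(2) in blast)
    moreover have "G z = G y"
      by (rule locally_constant_on_connected[OF S(1) zS y(1) lG]) (use S(2) in blast)
    ultimately show ?thesis using y by simp
  qed
  have "z \<in> L \<or> z \<in> R" using LR(1) z sub' by blast
  then show ?thesis
  proof
    assume "z \<in> L"
    then show ?thesis using key[OF LR(2) _ _ g(1)] LR(1) gF gG by blast
  next
    assume "z \<in> R"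
    then show ?thesis using key[OF LR(3) _ _ g(2)] LR(1) gF gG by blast
  qed
qed

lemma local_colourings_agree:
  assumes "p \<in> K" "local_colouring C p \<epsilon> F" "q \<in> K" "local_colouring C q \<delta> G" "p \<noteq> q"
    and "z \<in> ball p (\<epsilon> / 3)" "z \<in> ball q (\<delta> / 3)" "z \<notin> K"
  shows "F z = G z"
proof (cases "\<delta> \<le> \<epsilon>")
  case True
  show ?thesis by (rule local_colourings_agree_aux[OF assms(2-4) True assms(6-8,5)])
next
  case False
  then have "\<epsilon> \<le> \<delta>" by simp
  from local_colourings_agree_aux[OF assms(4,1,2) this assms(7,6,8) assms(5)[symmetric]]
  show ?thesis by (rule sym)
qed

section \<open>Regions near the diagram\<close>

lemma K_nonempty: "K \<noteq> {}"
proof -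
  obtain e where "e \<in> D" using D_nonempty by blast
  then have "pnt e 0 \<in> K" using K_iff by force
  then show ?thesis by blast
qed

text \<open>A region is open and not the whole plane, so it is not closed. A closure point outside
  it that missed the diagram would lie in another open region, which would then meet this
  one.\<close>

lemma region_closure_meets:
  assumes "r \<in> regions D"
  obtains p where "p \<in> K" "p \<in> closure r"
proof -
  have ne: "r \<noteq> {}" "r \<subseteq> - K" using assms in_components_nonempty in_components_subset unfolding regions_def by blast+
  then have "r \<noteq> UNIV" using K_nonempty by blast
  then have "\<not> closed r" using ne(1) open_region[OF assms] clopen by blast
  then obtain p where p: "p \<in> closure r" "p \<notin> r" using closure_subset_eq[of r] by blast
  have "p \<in> K"
  proof (rule ccontr)
    assume "p \<notin> K"
    then have "{p} \<inter> K = {}" by blast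
    then obtain r' where r': "r' \<in> regions D" "{p} \<subseteq> r'" by (rule connected_in_region[OF connected_sing insert_not_empty])
    then have "r' \<inter> r \<noteq> {}" using p(1) open_region[OF r'(1)] open_Int_closure_eq_empty by blast
    then have "r' = r" using r'(1) assms components_eq unfolding regions_def by blast
    then show False using r'(2) p(2) by blast
  qed
  then show ?thesis using that p(1) by blast
qed

text \<open>The plane is the union of two open connected sets, r and the set V of \<open>N\<close>
  with all other regions. Unicoherence makes their intersection connected, and it equals the collar
  since regions are disjoint.\<close>

lemma connected_region_collar:
  assumes K: "connected K" and N: "open N" "connected N" "K \<subseteq> N" and r: "r \<in> regions D"
  shows "connected (r \<inter> N)"
proof -
  \<comment> \<open>Each piece is joined with \<open>N\<close>, so all pieces are connected and have
    \<open>N\<close> in common; the inserted \<open>N\<close> keeps it in the union even without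
    another region.\<close>
  define V where "V = \<Union> (insert N ((\<lambda>r'. N \<union> r') ` (regions D - {r})))"
  have meets: "N \<inter> r' \<noteq> {}" if r': "r' \<in> regions D" for r'
  proof -
    obtain p where "p \<in> K" "p \<in> closure r'" by (rule region_closure_meets[OF r'])
    then show ?thesis using N open_Int_closure_eq_empty[OF N(1), of r'] by blast
  qed
  have conn: "connected r'" if "r' \<in> regions D" for r'
    using that in_components_connected unfolding regions_def by blast
  have "connected V"
    unfolding V_def
  proof (rule connected_Union)
    show "connected S" if "S \<in> insert N ((\<lambda>r'. N \<union> r') ` (regions D - {r}))" for S
      using that N(2) connected_Un[OF N(2) conn meets] by auto
    show "\<Inter> (insert N ((\<lambda>r'. N \<union> r') ` (regions D - {r}))) \<noteq> {}"
      using K_nonempty N(3) by auto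
  qed
  moreover have "open V" unfolding V_def using N(1) open_region by auto
  moreover have "r \<union> V = UNIV"
  proof -
    have "\<Union> (regions D) = - K" unfolding regions_def by simp
    then have "z \<in> r \<union> V" for z
      using N(3) unfolding V_def by (cases "z \<in> K") blast+
    then show ?thesis by blast
  qed
  ultimately have "connected (r \<inter> V)"
    using open_unicoherent_UNIV[OF open_region[OF r]] conn[OF r] by blast
  moreover have "r \<inter> r' = {}" if "r' \<in> regions D - {r}" for r'
    using that r components_eq unfolding regions_def by blast
  then have "r \<inter> V = r \<inter> N" unfolding V_def by blast
  ultimately show ?thesis by simp
qed

text \<open>The local colourings fit together to one function on a neighbourhood of the diagram. It
  is constant on the collar of each region, and that constant becomes the colour of the
  region.\<close>

lemma corner_compatible_region_colouring:
  assumes K: "connected K" and C: "corner_compatible C"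
  shows "\<exists>CR. \<forall>s\<in>semi_arcs D. C s = (CR (neg_side s), CR (pos_side s))"
proof -
  have "\<forall>p\<in>K. \<exists>\<epsilon>F. local_colouring C p (fst \<epsilon>F) (snd \<epsilon>F)"
    using local_colouring_noncrossing local_colouring_crossing[OF _ C] by (metis fst_conv snd_conv)
  then obtain h where h: "\<And>p. p \<in> K \<Longrightarrow> local_colouring C p (fst (h p)) (snd (h p))" by metis
  \<comment> \<open>Balls of a third of the radius, as required for agreement on overlaps.\<close>
  define B where "B p = ball p (fst (h p) / 3)" for p
  define N where "N = \<Union> (B ` K)"
  have pos: "0 < fst (h p)" if "p \<in> K" for p using h[OF that] unfolding local_colouring_def by blast
  have self: "p \<in> B p" if "p \<in> K" for p using pos[OF that] by (simp add: B_def)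
  have "N = \<Union> ((\<lambda>p. K \<union> B p) ` K)" using self unfolding N_def by blast
  moreover have "connected (\<Union> ((\<lambda>p. K \<union> B p) ` K))"
  proof (rule connected_Union)
    show "connected S" if "S \<in> (\<lambda>p. K \<union> B p) ` K" for S
      using that self by (auto intro!: connected_Un[OF K] simp: B_def)
    show "\<Inter> ((\<lambda>p. K \<union> B p) ` K) \<noteq> {}" using K_nonempty by auto
  qed
  ultimately have N: "open N" "connected N" "K \<subseteq> N" using self by (auto simp: N_def B_def)
  have agree: "snd (h p) z = snd (h q) z" if "p \<in> K" "q \<in> K" "z \<in> B p" "z \<in> B q" "z \<notin> K" for p q z
  proof (cases "p = q")
    case False
    show ?thesis
      by (rule local_colourings_agree[OF that(1) h[OF that(1)] that(2) h[OF that(2)] False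
            that(3,4)[unfolded B_def] that(5)])
  qed simp
  \<comment> \<open>By \<open>agree\<close> the value does not depend on which ball containing z is
    chosen.\<close>
  define F where "F z = snd (h (SOME p. p \<in> K \<and> z \<in> B p)) z" for z
  have F: "F z = snd (h p) z" if "p \<in> K" "z \<in> B p" "z \<notin> K" for p z
  proof -
    have "(SOME p. p \<in> K \<and> z \<in> B p) \<in> K \<and> z \<in> B (SOME p. p \<in> K \<and> z \<in> B p)"
      by (rule someI[of "\<lambda>p. p \<in> K \<and> z \<in> B p" p]) (use that in blast)
    then show ?thesis unfolding F_def using agree that by blast
  qed
  have const: "F a = F b" if r: "r \<in> regions D" and ab: "a \<in> r \<inter> N" "b \<in> r \<inter> N" for r a b
  proof (rule locally_constant_on_connected[OF connected_region_collar[OF K N r] ab])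
    fix z assume z: "z \<in> r \<inter> N"
    have rK: "r \<inter> K = {}" using r in_components_subset unfolding regions_def by blast
    obtain p where p: "p \<in> K" "z \<in> B p" using z unfolding N_def by blast
    have "B p \<subseteq> ball p (fst (h p))" unfolding B_def using pos[OF p(1)] by (intro subset_ball) simp
    then obtain U where U: "open U" "z \<in> U" "\<forall>y\<in>U. snd (h p) z = snd (h p) y"
      using h[OF p(1)] p z rK unfolding local_colouring_def by blast
    have "F z = F y" if y: "y \<in> U \<inter> B p \<inter> r" for y
    proof -
      have "y \<in> U" "y \<in> B p" "y \<notin> K" "z \<notin> K" using y z rK by blast+
      then show ?thesis using F[OF p(1), of y] F[OF p] U(3) by simp
    qed
    moreover have "open (U \<inter> B p \<inter> r)" unfolding B_def using U(1) open_region[OF r] by (intro open_Int open_ball)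
    moreover have "z \<in> U \<inter> B p \<inter> r" using U(2) p(2) z by blast
    ultimately show "\<exists>U. open U \<and> z \<in> U \<and> (\<forall>y\<in>U. F z = F y)" by blast
  qed
  define CR where "CR r = F (SOME z. z \<in> r \<inter> N)" for r
  have CR: "CR r = F y" if "r \<in> regions D" "y \<in> r \<inter> N" for r y
    unfolding CR_def using const[OF that(1) someI[of "\<lambda>z. z \<in> r \<inter> N", OF that(2)] that(2)] .
  have "C s = (CR (neg_side s), CR (pos_side s))" if s: "s \<in> semi_arcs D" for s
  proof -
    obtain e q where eq: "e \<in> D" "q \<in> s \<inter> oseg e" by (rule semi_arc_oseg[OF s])
    have qK: "q \<in> K" using eq oseg_subset by blast
    have "q \<in> ball q (fst (h q)) \<inter> oseg e \<inter> s" using eq pos[OF qK] by simp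
    then have g: "germ_in q (normal (dir e)) {z. snd (h q) z = snd (C s)}"
        "germ_in q (- normal (dir e)) {z. snd (h q) z = fst (C s)}"
      using h[OF qK] eq(1) s unfolding local_colouring_def by blast+
    have gb: "germ_in q w (B q)" for w using self[OF qK] by (intro germ_in_open) (simp_all add: B_def)
    have reg: "CR r = v" if r: "r \<in> regions D" "germ_in q w r" "germ_in q w {z. snd (h q) z = v}" for r w v
    proof -
      obtain y where y: "y \<in> r" "y \<in> B q" "snd (h q) y = v"
        using germ_in_nonempty[OF germ_in_Int[OF germ_in_Int[OF r(2) gb] r(3)]] by blast
      moreover have "y \<notin> K" using y(1) r(1) in_components_subset unfolding regions_def by blast
      moreover have "y \<in> r \<inter> N" unfolding N_def using y(1,2) qK by blast
      ultimately show ?thesis using CR[OF r(1), of y] F[OF qK y(2)] by simp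
    qed
    have "CR (neg_side s) = fst (C s)" "CR (pos_side s) = snd (C s)"
      using reg[OF _ _ g(2)] reg[OF _ _ g(1)] sides[OF s] eq by blast+
    then show ?thesis by simp
  qed
  then show ?thesis by blast
qed

text \<open>Near a diagram point in its closure, the region has a point in one of the two local
  sides or in one of the four quadrants. Each of these lies inside a side of some semi-arc, so the
  regions coincide.\<close>

lemma region_is_side:
  assumes "r \<in> regions D"
  obtains s where "s \<in> semi_arcs D" "r = neg_side s \<or> r = pos_side s"
proof -
  have "\<exists>s\<in>semi_arcs D. r = neg_side s \<or> r = pos_side s"
    if "z \<in> r" "z \<in> S" "S \<subseteq> side" "side = neg_side s \<or> side = pos_side s" "s \<in> semi_arcs D" for z S side s
  proof -
    have "side \<in> regions D" using that(4,5) sides by blast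
    then have "r = side" using assms that(1-3) components_eq unfolding regions_def by blast
    then show ?thesis using that(4,5) by blast
  qed note found = this
  obtain p where p: "p \<in> K" "p \<in> closure r" by (rule region_closure_meets[OF assms])
  have rK: "r \<inter> K = {}" using assms in_components_subset unfolding regions_def by blast
  have "\<exists>s\<in>semi_arcs D. r = neg_side s \<or> r = pos_side s"
  proof (cases "p \<in> crossings D")
    case True
    then obtain \<epsilon> eu ev where ch: "crossing_chart D p \<epsilon> eu ev" using crossing_chart_exists by blast
    note br = crossing_branches[OF ch] and sd = crossing_sides[OF ch]
    have \<epsilon>: "0 < \<epsilon>" and bK: "ball p \<epsilon> \<inter> K = ball p \<epsilon> \<inter>
        {z. (z - p) \<bullet> normal (dir eu) = 0 \<or> (z - p) \<bullet> normal (dir ev) = 0}"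
      using ch unfolding crossing_chart_def by simp_all
    obtain z where z: "z \<in> ball p \<epsilon>" "z \<in> r"
      using p(2) \<epsilon> unfolding closure_approachable by (metis dist_commute mem_ball)
    then have "z \<notin> ball p \<epsilon> \<inter> {z. (z - p) \<bullet> normal (dir eu) = 0 \<or> (z - p) \<bullet> normal (dir ev) = 0}"
      using rK unfolding bK[symmetric] by blast
    then have "(z - p) \<bullet> normal (dir eu) \<noteq> 0" "(z - p) \<bullet> normal (dir ev) \<noteq> 0" using z by simp_all
    then have "z \<in> quad p \<epsilon> eu ev (- 1) (- 1) \<or> z \<in> quad p \<epsilon> eu ev 1 (- 1) \<or>
        z \<in> quad p \<epsilon> eu ev (- 1) 1 \<or> z \<in> quad p \<epsilon> eu ev 1 1"
      using z by (auto simp: quad_def linorder_neq_iff)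
    then show ?thesis
      using found[OF z(2) _ sd(7) disjI1 br(1)] found[OF z(2) _ sd(8) disjI2 br(1)]
        found[OF z(2) _ sd(9) disjI2 br(3)] found[OF z(2) _ sd(10) disjI2 br(2)] by blast
  next
    case False
    then obtain \<epsilon> L R where ch: "noncrossing_chart D p \<epsilon> L R" using noncrossing_chart_exists p(1) by blast
    have \<epsilon>: "0 < \<epsilon>" and LR: "L \<union> R = ball p \<epsilon> - K"
      using ch unfolding noncrossing_chart_def by simp_all
    obtain r1 r2 where r12: "r1 \<in> regions D" "r2 \<in> regions D" "R \<subseteq> r1" "L \<subseteq> r2" by (rule chart_regions[OF ch])
    obtain z where z: "z \<in> ball p \<epsilon>" "z \<in> r"
      using p(2) \<epsilon> unfolding closure_approachable by (metis dist_commute mem_ball)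
    then have zz: "z \<in> L \<or> z \<in> R" using LR rK by blast
    obtain e q where e: "e \<in> D" "q \<in> ball p \<epsilon> \<inter> oseg e" using ch \<epsilon> unfolding noncrossing_chart_def by blast
    then have g: "germ_in q (normal (dir e)) L" "germ_in q (- normal (dir e)) R" and "q \<in> K - crossings D"
      using ch oseg_subset unfolding noncrossing_chart_def by blast+
    then obtain s where s: "s \<in> semi_arcs D" "q \<in> s" by (metis in_semi_arc)
    have qs: "q \<in> s \<inter> oseg e" using s e by blast
    have "neg_side s = r1" "pos_side s = r2"
      using side_eqI(1)[OF s(1) r12(1) e(1) qs germ_in_mono[OF g(2) r12(3)]]
        side_eqI(2)[OF s(1) r12(2) e(1) qs germ_in_mono[OF g(1) r12(4)]] by simp_all
    then show ?thesis using zz found[OF z(2) _ r12(3) _ s(1)] found[OF z(2) _ r12(4) _ s(1)] by blast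
  qed
  then show ?thesis using that by blast
qed

end

section \<open>The cycle condition\<close>

text \<open>Telescoping for a step function, by removing the largest jump m. The function is
  constant after m, and just before m it equals the left value, where the induction hypothesis
  ends.\<close>

lemma sum_of_jumps:
  fixes g :: "real \<Rightarrow> 'g :: ab_group_add"
  assumes "finite P" "P \<subseteq> {a<..<b}" "a \<le> b"
    and "\<And>x y. a \<le> x \<Longrightarrow> x \<le> y \<Longrightarrow> y \<le> b \<Longrightarrow> {x..y} \<inter> P = {} \<Longrightarrow> g x = g y"
    and "\<And>r. r \<in> P \<Longrightarrow> \<forall>\<^sub>F t in at_right 0. g (r - t) = l r"
    and "\<And>r. r \<in> P \<Longrightarrow> \<forall>\<^sub>F t in at_right 0. g (r + t) = u r"
  shows "(\<Sum>r\<in>P. l r - u r) = g a - g b"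
  using assms
proof (induction P arbitrary: b rule: finite_linorder_max_induct)
  case empty
  then show ?case using empty(3)[of a b] by simp
next
  case (insert m P)
  have m: "a < m" "m < b" using insert.prems(1) by auto
  have small: "\<forall>\<^sub>F t in at_right 0. t < d" if "d > 0" for d :: real
    using that by (auto simp: eventually_at_right[of 0 1])
  have pos: "\<forall>\<^sub>F t in at_right (0::real). t > 0" by (simp add: eventually_at_right_less)
  have "\<forall>\<^sub>F t in at_right 0. \<forall>p\<in>P. t < m - p"
    using insert.hyps by (intro eventually_ball_finite) (auto intro!: small)
  then have "\<forall>\<^sub>F t in at_right 0. g (m - t) = l m \<and> t > 0 \<and> t < m - a \<and> (\<forall>p\<in>P. t < m - p)"
    using insert.prems(4)[of m] pos small[of "m - a"] m by (auto intro!: eventually_conj)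
  then have "\<exists>t. g (m - t) = l m \<and> t > 0 \<and> t < m - a \<and> (\<forall>p\<in>P. t < m - p)"
    by (rule eventually_happens'[OF trivial_limit_at_right_real])
  \<comment> \<open>Besides giving the left value at m, this t keeps \<open>m - t\<close> to the
    right of all remaining jumps.\<close>
  then obtain t where t: "g (m - t) = l m" "t > 0" "t < m - a" "\<forall>p\<in>P. t < m - p" by blast
  have "\<forall>\<^sub>F t in at_right 0. g (m + t) = u m \<and> t > 0 \<and> t < b - m"
    using insert.prems(5)[of m] pos small[of "b - m"] m by (auto intro!: eventually_conj)
  then have "\<exists>t. g (m + t) = u m \<and> t > 0 \<and> t < b - m"
    by (rule eventually_happens'[OF trivial_limit_at_right_real])
  then obtain t' where t': "g (m + t') = u m" "t' > 0" "t' < b - m" by blast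
  have "g (m + t') = g b"
    using t' m insert.hyps(2) by (intro insert.prems(3)) force+
  moreover have "(\<Sum>r\<in>P. l r - u r) = g a - g (m - t)"
  proof (rule insert.IH)
    show "P \<subseteq> {a<..<m - t}"
    proof
      fix p assume "p \<in> P"
      then have "a < p" "t < m - p" using insert.prems(1) t(4) by auto
      then show "p \<in> {a<..<m - t}" by simp
    qed
    show "g x = g y" if "a \<le> x" "x \<le> y" "y \<le> m - t" "{x..y} \<inter> P = {}" for x y
      using that t(2) m by (intro insert.prems(3)) auto
  qed (use insert.prems(4,5) t(3) in auto)
  moreover have "m \<notin> P" using insert.hyps(2) by blast
  ultimately show ?case using insert.hyps(1) t(1) t'(1) by simp
qed

context regular_diagram
begin

section \<open>Telescoping along the edges\<close>

definition arc_at :: "complex \<Rightarrow> complex set" where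
  "arc_at q = (THE s. s \<in> semi_arcs D \<and> q \<in> s)"

text \<open>Names the semi-arcs at a crossing by direction of travel instead of by the indices 1 and
  2, as a sum along an oriented edge demands.\<close>

definition strand_germ :: "complex \<Rightarrow> complex \<Rightarrow> complex set" where
  "strand_germ p w = (THE s. s \<in> semi_arcs D \<and> germ_in p w s)"

lemma arc_at_eq: "s \<in> semi_arcs D \<Longrightarrow> q \<in> s \<Longrightarrow> arc_at q = s"
  unfolding arc_at_def using semi_arc_eq by (intro the_equality) blast+

lemma strand_germ_eq: "s \<in> semi_arcs D \<Longrightarrow> germ_in p w s \<Longrightarrow> strand_germ p w = s"
  unfolding strand_germ_def semi_arcs_def by (rule the_component_germ)

text \<open>At a positive crossing \<open>under1\<close> and \<open>over2\<close> are incoming, so d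
  is the sum of incoming minus outgoing values over the two strands. At a negative crossing incoming
  and outgoing are exchanged and the sign compensates.\<close>

lemma crossing_strands:
  fixes T :: "complex set \<Rightarrow> 'g :: ab_group_add"
  assumes "p \<in> crossings D"
  defines "d \<equiv> T (under1 D p) - T (under2 D p) + T (over2 D p) - T (over1 D p)"
  shows "(if under_dir D p \<bullet> normal (over_dir D p) > 0 then d else - d)
    = (\<Sum>e | e \<in> D \<and> p \<in> oseg e. T (strand_germ p (- dir e)) - T (strand_germ p (dir e)))"
    and "\<And>e. e \<in> D \<Longrightarrow> p \<in> oseg e \<Longrightarrow> \<exists>s\<in>semi_arcs D. germ_in p (- dir e) s"
    and "\<And>e. e \<in> D \<Longrightarrow> p \<in> oseg e \<Longrightarrow> \<exists>s\<in>semi_arcs D. germ_in p (dir e) s"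
proof -
  obtain \<epsilon> eu ev where ch: "crossing_chart D p \<epsilon> eu ev" using crossing_chart_exists[OF assms(1)] by blast
  note br = crossing_branches(1-4)[OF ch]
  have dirs: "under_dir D p = dir eu" "over_dir D p = dir ev" and e: "eu \<in> D" "ev \<in> D"
    and nz: "dir eu \<bullet> normal (dir ev) \<noteq> 0"
    using ch unfolding crossing_chart_def by simp_all
  have "p \<in> ball p \<epsilon>" using ch unfolding crossing_chart_def by simp
  then have os: "(p \<in> oseg eu \<longleftrightarrow> (p - p) \<bullet> normal (dir eu) = 0) \<and> (p \<in> oseg ev \<longleftrightarrow> (p - p) \<bullet> normal (dir ev) = 0)
      \<and> (\<forall>e\<in>D. p \<in> oseg e \<longrightarrow> e = eu \<or> e = ev)"
    using ch unfolding crossing_chart_def by blast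
  then have on: "{e. e \<in> D \<and> p \<in> oseg e} = {eu, ev}" using e by auto
  have neq: "eu \<noteq> ev" using nz by auto
  have *: "(if under_dir D p \<bullet> normal (over_dir D p) > 0 then d else - d)
      = (\<Sum>e | e \<in> D \<and> p \<in> oseg e. T (strand_germ p (- dir e)) - T (strand_germ p (dir e))) \<and>
    (\<forall>e\<in>{eu, ev}. (\<exists>s\<in>semi_arcs D. germ_in p (- dir e) s) \<and> (\<exists>s\<in>semi_arcs D. germ_in p (dir e) s))"
  proof (cases "dir eu \<bullet> normal (dir ev) > 0")
    case True
    note g = crossing_germs_positive[OF ch True]
    have "strand_germ p (- dir eu) = under1 D p" "strand_germ p (dir eu) = under2 D p"
      "strand_germ p (- dir ev) = over2 D p" "strand_germ p (dir ev) = over1 D p"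
      using strand_germ_eq br g by simp_all
    then show ?thesis unfolding on dirs d_def using True neq br g by auto
  next
    case False
    note g = crossing_germs_negative[OF ch False]
    have "strand_germ p (- dir eu) = under2 D p" "strand_germ p (dir eu) = under1 D p"
      "strand_germ p (- dir ev) = over1 D p" "strand_germ p (dir ev) = over2 D p"
      using strand_germ_eq br g by simp_all
    then show ?thesis unfolding on dirs d_def using False neq br g by auto
  qed
  then show "(if under_dir D p \<bullet> normal (over_dir D p) > 0 then d else - d)
    = (\<Sum>e | e \<in> D \<and> p \<in> oseg e. T (strand_germ p (- dir e)) - T (strand_germ p (dir e)))" by blast
  show "\<exists>s\<in>semi_arcs D. germ_in p (- dir e) s" "\<exists>s\<in>semi_arcs D. germ_in p (dir e) s"
    if "e \<in> D" "p \<in> oseg e" for e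
    using * that on by blast+
qed

text \<open>Along an edge the value of T on the current semi-arc changes at crossings only, so it is
  a step function to which \<open>sum_of_jumps\<close> applies. The ends of the edge are not
  crossings.\<close>

lemma edge_sum:
  fixes T :: "complex set \<Rightarrow> 'g :: ab_group_add"
  assumes e: "e \<in> D"
  shows "(\<Sum>p | p \<in> crossings D \<and> p \<in> oseg e. T (strand_germ p (- dir e)) - T (strand_germ p (dir e)))
    = T (arc_at (fst (fst e))) - T (arc_at (fst (snd e)))"
proof -
  define P where "P = {r \<in> {0<..<1}. pnt e r \<in> crossings D}"
  have inj: "inj_on (pnt e) P" using pnt_inj[OF dir_nonzero[OF e]] by (simp add: inj_on_def)
  have img: "{p. p \<in> crossings D \<and> p \<in> oseg e} = pnt e ` P"
    unfolding P_def oseg_eq[OF dir_nonzero[OF e]] by blast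
  have "finite (pnt e ` P)" using finite_crossings by (rule finite_subset[rotated]) (auto simp: P_def)
  then have fin: "finite P" using inj finite_imageD by blast
  let ?g = "\<lambda>x. T (arc_at (pnt e x))"
  have jumps: "(\<Sum>r\<in>P. T (strand_germ (pnt e r) (- dir e)) - T (strand_germ (pnt e r) (dir e))) = ?g 0 - ?g 1"
  proof (rule sum_of_jumps[OF fin])
    show "P \<subseteq> {0<..<1}" by (auto simp: P_def)
    show "?g x = ?g y" if xy: "0 \<le> x" "x \<le> y" "y \<le> 1" "{x..y} \<inter> P = {}" for x y
    proof -
      have nc: "pnt e z \<notin> crossings D" if z: "z \<in> {x..y}" for z
      proof -
        consider "z = 0" | "z = 1" | "z \<in> {0<..<1}" using z xy by fastforce
        then show ?thesis
        proof cases
          case 1 then show ?thesis using tail_not_crossing[OF e] by (simp add: pnt_def)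
        next
          case 2 then show ?thesis using head_not_crossing[OF e] by (simp add: pnt_def dir_def)
        next
          case 3 then show ?thesis using z xy(4) unfolding P_def by blast
        qed
      qed
      have "{x..y} \<subseteq> {0..1}" using xy by auto
      then have sub: "pnt e ` {x..y} \<subseteq> K - crossings D" using nc K_iff e by blast
      have conn: "connected (pnt e ` {x..y})"
        unfolding pnt_def by (intro connected_continuous_image continuous_intros connected_Icc)
      have ne: "pnt e ` {x..y} \<noteq> {}" using xy(2) by simp
      obtain s where s: "s \<in> semi_arcs D" "pnt e ` {x..y} \<subseteq> s" by (rule connected_in_semi_arc[OF conn ne sub])
      then have "pnt e x \<in> s" "pnt e y \<in> s" using xy(2) by auto
      then show ?thesis using arc_at_eq[OF s(1)] by simp
    qed
    fix r assume r: "r \<in> P"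
    then have p: "pnt e r \<in> crossings D" "pnt e r \<in> oseg e"
      unfolding P_def oseg_eq[OF dir_nonzero[OF e]] by blast+
    obtain s where s: "s \<in> semi_arcs D" "germ_in (pnt e r) (- dir e) s"
      using crossing_strands(2)[OF p(1) e p(2)] by blast
    show "\<forall>\<^sub>F t in at_right 0. ?g (r - t) = T (strand_germ (pnt e r) (- dir e))"
      unfolding strand_germ_eq[OF s] using s(2) unfolding germ_in_def
      by (rule eventually_mono) (use arc_at_eq[OF s(1)] pnt_add[of e r] in \<open>simp add: diff_conv_add_uminus del: add_uminus_conv_diff\<close>)
    obtain s' where s': "s' \<in> semi_arcs D" "germ_in (pnt e r) (dir e) s'"
      using crossing_strands(3)[OF p(1) e p(2)] by blast
    show "\<forall>\<^sub>F t in at_right 0. ?g (r + t) = T (strand_germ (pnt e r) (dir e))"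
      unfolding strand_germ_eq[OF s'] using s'(2) unfolding germ_in_def
      by (rule eventually_mono) (simp add: arc_at_eq[OF s'(1)] pnt_add)
  qed simp
  have "pnt e 0 = fst (fst e)" "pnt e 1 = fst (snd e)" by (simp_all add: pnt_def dir_def)
  then show ?thesis using jumps unfolding img by (simp add: sum.reindex[OF inj] o_def)
qed

text \<open>The double sum over incident crossings and edges is exchanged and each edge telescopes
  to tail minus head. Every vertex is the tail of one edge and the head of one edge, so everything
  cancels.\<close>

lemma crossing_sum_zero:
  fixes T :: "complex set \<Rightarrow> 'g :: ab_group_add"
  defines "d p \<equiv> T (under1 D p) - T (under2 D p) + T (over2 D p) - T (over1 D p)"
  shows "(\<Sum>p\<in>crossings D. if under_dir D p \<bullet> normal (over_dir D p) > 0 then d p else - d p) = 0"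
proof -
  let ?f = "\<lambda>e p. T (strand_germ p (- dir e)) - T (strand_germ p (dir e))"
  have "(\<Sum>p\<in>crossings D. if under_dir D p \<bullet> normal (over_dir D p) > 0 then d p else - d p)
      = (\<Sum>p\<in>crossings D. \<Sum>e | e \<in> D \<and> p \<in> oseg e. ?f e p)"
    unfolding d_def by (intro sum.cong refl crossing_strands(1))
  also have "\<dots> = (\<Sum>e\<in>D. \<Sum>p | p \<in> crossings D \<and> p \<in> oseg e. ?f e p)"
    by (rule sum.swap_restrict[OF finite_crossings finite_D])
  also have "\<dots> = (\<Sum>e\<in>D. T (arc_at (fst (fst e))) - T (arc_at (fst (snd e))))"
    by (intro sum.cong refl edge_sum)
  also have "\<dots> = (\<Sum>v\<in>fst ` D. T (arc_at (fst v))) - (\<Sum>v\<in>snd ` D. T (arc_at (fst v)))"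
    by (simp add: sum_subtractf sum.reindex[OF inj_fst] sum.reindex[OF inj_snd] o_def)
  also have "\<dots> = 0" by (simp add: fst_snd_D)
  finally show ?thesis .
qed

end

section \<open>Colourings\<close>

text \<open>A value-preserving bijection of the index sets restricts to bijections of the fibres,
  which compares infinite multiplicities as well.\<close>

lemma mset_eqI:
  assumes "bij_betw f (fst M) (fst N)" "\<And>i. i \<in> fst M \<Longrightarrow> snd N (f i) = snd M i"
  shows "M =\<^sub>m N" "N =\<^sub>m M"
proof -
  have "fibre M a \<approx> fibre N a" for a
  proof -
    have "f ` fibre M a = fibre N a"
      using assms unfolding fibre_def bij_betw_def by force
    moreover have "fibre M a \<subseteq> fst M" by (auto simp: fibre_def)
    ultimately have "bij_betw f (fibre M a) (fibre N a)" using assms(1) bij_betw_subset by blast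
    then show ?thesis unfolding eqpoll_def by blast
  qed
  then show "M =\<^sub>m N" "N =\<^sub>m M" unfolding mset_eq_def using eqpoll_sym by blast+
qed

locale coloured_diagram = strong_shadow B us os X act + regular_diagram D
  for B :: "'b set" and us os and X :: "'x set" and act and D +
  assumes connected_K: "connected K"
begin

section \<open>The bijection between the two sets of colourings\<close>

definition induced :: "(complex set \<Rightarrow> 'b) \<times> (complex set \<Rightarrow> 'x) \<Rightarrow> complex set \<Rightarrow> 'x \<times> 'x" where
  "induced C = (\<lambda>s\<in>semi_arcs D. (snd C (neg_side s), snd C (pos_side s)))"

text \<open>\<open>normal_points\<close> singles out exactly one pair of regions for each semi-arc,
  so the region condition becomes one equation per semi-arc.\<close>

lemma Col_SB_iff:
  "(CS, CR) \<in> Col_SB B us os X act D \<longleftrightarrow>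
     CS \<in> semi_arcs D \<rightarrow>\<^sub>E B \<and> CR \<in> regions D \<rightarrow>\<^sub>E X \<and>
     (\<forall>p\<in>crossings D. CS (under2 D p) = us (CS (under1 D p)) (CS (over1 D p)) \<and>
        CS (over2 D p) = os (CS (over1 D p)) (CS (under1 D p))) \<and>
     (\<forall>s\<in>semi_arcs D. act (CR (neg_side s)) (CS s) = CR (pos_side s))"
proof -
  have "(\<forall>s\<in>semi_arcs D. \<forall>r1\<in>regions D. \<forall>r2\<in>regions D.
      normal_points D s r1 r2 \<longrightarrow> act (CR r1) (CS s) = CR r2) \<longleftrightarrow>
    (\<forall>s\<in>semi_arcs D. act (CR (neg_side s)) (CS s) = CR (pos_side s))"
    using normal_points_iff sides(1,2) by blast
  then show ?thesis unfolding Col_SB_def by simp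
qed

lemma crossing_arcs:
  assumes "p \<in> crossings D"
  shows "under1 D p \<in> semi_arcs D" "under2 D p \<in> semi_arcs D" "over1 D p \<in> semi_arcs D"
    "over2 D p \<in> semi_arcs D" "cr_region D p \<in> regions D"
    "neg_side (under1 D p) = cr_region D p" "neg_side (over1 D p) = cr_region D p"
    "neg_side (over2 D p) = pos_side (under1 D p)" "neg_side (under2 D p) = pos_side (over1 D p)"
    "pos_side (over2 D p) = pos_side (under2 D p)"
proof -
  obtain \<epsilon> eu ev where ch: "crossing_chart D p \<epsilon> eu ev" using crossing_chart_exists[OF assms] by blast
  show "under1 D p \<in> semi_arcs D" "under2 D p \<in> semi_arcs D" "over1 D p \<in> semi_arcs D"
    "over2 D p \<in> semi_arcs D" "cr_region D p \<in> regions D"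
    "neg_side (under1 D p) = cr_region D p" "neg_side (over1 D p) = cr_region D p"
    "neg_side (over2 D p) = pos_side (under1 D p)" "neg_side (under2 D p) = pos_side (over1 D p)"
    "pos_side (over2 D p) = pos_side (under2 D p)"
    using crossing_branches[OF ch] crossing_sides[OF ch] by simp_all
qed

text \<open>All colours around a crossing are expressed through x, a and b, the form in which both
  the bracket and the boundary of the weight are evaluated.\<close>

lemma crossing_colours:
  assumes C: "(CS, CR) \<in> Col_SB B us os X act D" and p: "p \<in> crossings D"
  defines "x \<equiv> CR (cr_region D p)" and "a \<equiv> CS (under1 D p)" and "b \<equiv> CS (over1 D p)"
  shows "x \<in> X" "a \<in> B" "b \<in> B" "CS (under2 D p) = us a b" "CS (over2 D p) = os b a"
    "CR (neg_side (under2 D p)) = act x b" "CR (neg_side (over2 D p)) = act x a"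
    "induced (CS, CR) (under1 D p) = (x, act x a)" "induced (CS, CR) (over1 D p) = (x, act x b)"
    "induced (CS, CR) (under2 D p) = (act x b, act (act x b) (us a b))"
    "induced (CS, CR) (over2 D p) = (act x a, act (act x a) (os b a))"
proof -
  note ar = crossing_arcs[OF p]
  have C': "CS \<in> semi_arcs D \<rightarrow>\<^sub>E B" "CR \<in> regions D \<rightarrow>\<^sub>E X"
    and cc: "CS (under2 D p) = us a b" "CS (over2 D p) = os b a"
    and st: "\<And>s. s \<in> semi_arcs D \<Longrightarrow> act (CR (neg_side s)) (CS s) = CR (pos_side s)"
    using C p unfolding Col_SB_iff a_def b_def by blast+
  show "x \<in> X" "a \<in> B" "b \<in> B" using C' ar unfolding x_def a_def b_def by blast+
  show "CS (under2 D p) = us a b" "CS (over2 D p) = os b a" by fact+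
  have y: "CR (pos_side (under1 D p)) = act x a" "CR (pos_side (over1 D p)) = act x b"
    using st[OF ar(1)] st[OF ar(3)] ar(6,7) by (simp_all add: x_def a_def b_def)
  then show n: "CR (neg_side (under2 D p)) = act x b" "CR (neg_side (over2 D p)) = act x a"
    by (simp_all add: ar(8,9))
  have w: "CR (pos_side (under2 D p)) = act (act x b) (us a b)" "CR (pos_side (over2 D p)) = act (act x a) (os b a)"
    using st[OF ar(2)] st[OF ar(4)] n cc by simp_all
  show "induced (CS, CR) (under1 D p) = (x, act x a)" "induced (CS, CR) (over1 D p) = (x, act x b)"
    "induced (CS, CR) (under2 D p) = (act x b, act (act x b) (us a b))"
    "induced (CS, CR) (over2 D p) = (act x a, act (act x a) (os b a))"
    using ar(1-4,6,7) y n w by (simp_all add: induced_def x_def)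
qed

lemma induced_colouring:
  assumes C: "(CS, CR) \<in> Col_SB B us os X act D"
  shows "induced (CS, CR) \<in> Col_LB X br D"
proof -
  have "CR \<in> regions D \<rightarrow>\<^sub>E X" using C unfolding Col_SB_iff by blast
  then have "induced (CS, CR) \<in> semi_arcs D \<rightarrow>\<^sub>E X \<times> X"
    using sides(1,2) unfolding induced_def by (intro PiE_I) (auto simp: PiE_mem)
  moreover have "fst (induced (CS, CR) (under1 D p)) = fst (induced (CS, CR) (over1 D p)) \<and>
      induced (CS, CR) (under2 D p) = lb_under br (induced (CS, CR) (under1 D p)) (induced (CS, CR) (over1 D p)) \<and>
      induced (CS, CR) (over2 D p) = lb_over br (induced (CS, CR) (over1 D p)) (induced (CS, CR) (under1 D p))"
    if p: "p \<in> crossings D" for p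
    using crossing_colours(1-3,8-11)[OF C p] by (simp add: lb_under_def lb_over_def br_under flip: br_over)
  ultimately show ?thesis unfolding Col_LB_def by blast
qed

lemma induced_inj: "inj_on induced (Col_SB B us os X act D)"
proof (rule inj_onI)
  fix C C' assume C: "C \<in> Col_SB B us os X act D" and C': "C' \<in> Col_SB B us os X act D"
    and eq: "induced C = induced C'"
  obtain CS CR CS' CR' where c: "C = (CS, CR)" "C' = (CS', CR')" by (cases C; cases C')
  have sides_eq: "CR (neg_side s) = CR' (neg_side s)" "CR (pos_side s) = CR' (pos_side s)"
    if "s \<in> semi_arcs D" for s
    using fun_cong[OF eq, of s] that by (simp_all add: induced_def c)
  have P: "CS \<in> semi_arcs D \<rightarrow>\<^sub>E B" "CR \<in> regions D \<rightarrow>\<^sub>E X" "CS' \<in> semi_arcs D \<rightarrow>\<^sub>E B" "CR' \<in> regions D \<rightarrow>\<^sub>E X"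
    and st: "\<And>s. s \<in> semi_arcs D \<Longrightarrow> act (CR (neg_side s)) (CS s) = CR (pos_side s)"
      "\<And>s. s \<in> semi_arcs D \<Longrightarrow> act (CR' (neg_side s)) (CS' s) = CR' (pos_side s)"
    using C C' unfolding c Col_SB_iff by blast+
  have "CR = CR'"
  proof (rule PiE_ext[OF P(2,4)])
    fix r assume "r \<in> regions D"
    then obtain s where s: "s \<in> semi_arcs D" "r = neg_side s \<or> r = pos_side s" by (rule region_is_side)
    then show "CR r = CR' r" using sides_eq[OF s(1)] by auto
  qed
  moreover have "CS = CS'"
  proof (rule PiE_ext[OF P(1,3)])
    fix s assume s: "s \<in> semi_arcs D"
    have "CR (neg_side s) \<in> X" using P(2) sides(1)[OF s] by blast
    moreover have "CS s \<in> B" "CS' s \<in> B" using P s by blast+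
    moreover have "act (CR (neg_side s)) (CS s) = act (CR (neg_side s)) (CS' s)"
      using st[OF s] sides_eq[OF s] by simp
    ultimately show "CS s = CS' s" by (simp add: act_inj)
  qed
  ultimately show "C = C'" by (simp add: c)
qed

lemma induced_surj:
  assumes C: "C \<in> Col_LB X br D"
  obtains CS CR where "(CS, CR) \<in> Col_SB B us os X act D" "induced (CS, CR) = C"
proof -
  have P: "C \<in> semi_arcs D \<rightarrow>\<^sub>E X \<times> X"
    and eqs: "\<And>p. p \<in> crossings D \<Longrightarrow> fst (C (under1 D p)) = fst (C (over1 D p))"
      "\<And>p. p \<in> crossings D \<Longrightarrow> C (under2 D p) = lb_under br (C (under1 D p)) (C (over1 D p))"
      "\<And>p. p \<in> crossings D \<Longrightarrow> C (over2 D p) = lb_over br (C (over1 D p)) (C (under1 D p))"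
    using C unfolding Col_LB_def by blast+
  \<comment> \<open>With \<open>C(under1) = (x, y)\<close> and \<open>C(over1) = (x, z)\<close> the
    second pair is \<open>(z, [x,y,z])\<close> under and \<open>(y, [x,y,z])\<close> over, which
    contains all four equations.\<close>
  have "corner_compatible C"
    unfolding corner_compatible_def by (auto simp: eqs lb_under_def lb_over_def)
  from corner_compatible_region_colouring[OF connected_K this] obtain F where
    F: "\<And>s. s \<in> semi_arcs D \<Longrightarrow> C s = (F (neg_side s), F (pos_side s))" by blast
  define CR where "CR = restrict F (regions D)"
  \<comment> \<open>The only element of \<open>B\<close> that acts from the colour of the negative
    side to that of the positive side.\<close>
  define CS where "CS = (\<lambda>s\<in>semi_arcs D. arrow (fst (C s)) (snd (C s)))"
  have CR: "CR (neg_side s) = fst (C s)" "CR (pos_side s) = snd (C s)" if "s \<in> semi_arcs D" for s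
    using F[OF that] sides(1,2)[OF that] by (simp_all add: CR_def)
  have CX: "fst (C s) \<in> X" "snd (C s) \<in> X" if "s \<in> semi_arcs D" for s
    using PiE_mem[OF P that] by auto
  \<comment> \<open>The values on regions come from an unrestricted function; they lie in
    \<open>X\<close> because every region is a side of a semi-arc.\<close>
  have "CR r \<in> X" if r: "r \<in> regions D" for r
  proof -
    obtain s where s: "s \<in> semi_arcs D" "r = neg_side s \<or> r = pos_side s" by (rule region_is_side[OF r])
    then show ?thesis using CR[OF s(1)] CX[OF s(1)] by auto
  qed
  then have "CR \<in> regions D \<rightarrow>\<^sub>E X" by (simp add: CR_def)
  moreover have "CS \<in> semi_arcs D \<rightarrow>\<^sub>E B" using CX by (auto simp: CS_def)
  moreover have "CS (under2 D p) = us (CS (under1 D p)) (CS (over1 D p)) \<and>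
      CS (over2 D p) = os (CS (over1 D p)) (CS (under1 D p))" if p: "p \<in> crossings D" for p
  proof -
    note ar = crossing_arcs(1-4)[OF p]
    define x y z where "x = fst (C (under1 D p))" and "y = snd (C (under1 D p))" and "z = snd (C (over1 D p))"
    have X: "x \<in> X" "y \<in> X" "z \<in> X" using CX ar by (simp_all add: x_def y_def z_def)
    have u: "C (under2 D p) = (z, br x y z)" "C (over2 D p) = (y, br x y z)"
      using eqs[OF p] by (simp_all add: lb_under_def lb_over_def x_def y_def z_def)
    have s: "CS (under1 D p) = arrow x y" "CS (over1 D p) = arrow x z"
      "CS (under2 D p) = arrow z (br x y z)" "CS (over2 D p) = arrow y (br x y z)"
      using ar u eqs(1)[OF p] by (simp_all add: CS_def x_def y_def z_def)
    \<comment> \<open>The crossing relations for \<open>CS\<close> follow by cancelling the action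
      of z, respectively of y, in the two forms of the bracket.\<close>
    have "br x y z = act z (us (arrow x y) (arrow x z))" "br x y z = act y (os (arrow x z) (arrow x y))"
      using br_under[of x "arrow x y" "arrow x z"] br_over[of x "arrow x y" "arrow x z"] X by simp_all
    then have "arrow z (br x y z) = us (arrow x y) (arrow x z)" "arrow y (br x y z) = os (arrow x z) (arrow x y)"
      using X by (metis arrow_act arrow_closed us_closed, metis arrow_act arrow_closed os_closed)
    then show ?thesis using s by simp
  qed
  moreover have "act (CR (neg_side s)) (CS s) = CR (pos_side s)" if "s \<in> semi_arcs D" for s
    using CX[OF that] that by (simp add: CR CS_def)
  ultimately have "(CS, CR) \<in> Col_SB B us os X act D" unfolding Col_SB_iff by blast
  moreover have "induced (CS, CR) = C"
  proof
    fix s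
    show "induced (CS, CR) s = C s"
      using PiE_arb[OF P, of s] CR[of s] by (cases "s \<in> semi_arcs D") (simp_all add: induced_def)
  qed
  ultimately show ?thesis by (rule that)
qed

lemma induced_bij: "bij_betw induced (Col_SB B us os X act D) (Col_LB X br D)"
proof -
  have "Col_LB X br D \<subseteq> induced ` Col_SB B us os X act D"
  proof
    fix C assume "C \<in> Col_LB X br D"
    then obtain CS CR where "(CS, CR) \<in> Col_SB B us os X act D" "induced (CS, CR) = C"
      by (rule induced_surj)
    then show "C \<in> induced ` Col_SB B us os X act D" by blast
  qed
  then show ?thesis using induced_inj induced_colouring unfolding bij_betw_def by fast
qed

section \<open>The weight of a colouring\<close>

text \<open>The representative of \<open>W_SB\<close> in the free group. Its boundary vanishes there
  already, before degenerate chains are divided out.\<close>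

definition weight :: "(complex set \<Rightarrow> 'b) \<times> (complex set \<Rightarrow> 'x) \<Rightarrow> ('x \<times> 'b list) \<Rightarrow>\<^sub>0 int" where
  "weight C = (\<Sum>p\<in>crossings D. frag_cmul (cr_sign D p)
     (frag_of (snd C (cr_region D p), [fst C (under1 D p), fst C (over1 D p)])))"

lemma W_SB_weight: "W_SB B X D C = quot_cls (sb_basis B X 2) (sb_degen B X 2) (weight C)"
  by (cases C) (simp add: W_SB_def weight_def)

lemma weight_basis:
  assumes "C \<in> Col_SB B us os X act D"
  shows "Poly_Mapping.keys (weight C) \<subseteq> sb_basis B X 2"
proof -
  obtain CS CR where c: "C = (CS, CR)" by (cases C)
  have "weight C \<in> carrier (free_Abelian_group (sb_basis B X 2))"
    unfolding weight_def
  proof (rule sum_closed_free_Abelian_group)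
    fix p assume p: "p \<in> crossings D"
    have "(CR (cr_region D p), [CS (under1 D p), CS (over1 D p)]) \<in> sb_basis B X 2"
      using crossing_colours(1-3)[OF assms[unfolded c] p] by (simp add: sb_basis_2)
    then show "frag_cmul (cr_sign D p) (frag_of (snd C (cr_region D p), [fst C (under1 D p), fst C (over1 D p)]))
      \<in> carrier (free_Abelian_group (sb_basis B X 2))"
      using keys_cmul[of "cr_sign D p"] by (auto simp: c)
  qed
  then show ?thesis by simp
qed

lemma W_LB_induced:
  assumes "C \<in> Col_SB B us os X act D"
  shows "W_LB X D (induced C) = mu X act 2 (W_SB B X D C)"
proof -
  obtain CS CR where c: "C = (CS, CR)" by (cases C)
  have "mu_ext (weight C) = (\<Sum>p\<in>crossings D. frag_cmul (cr_sign D p)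
      (frag_of (mu_basis act (CR (cr_region D p), [CS (under1 D p), CS (over1 D p)]))))"
    by (simp add: weight_def c frag_extend_sum[OF finite_crossings] frag_extend_cmul o_def)
  also have "\<dots> = (\<Sum>p\<in>crossings D. frag_cmul (cr_sign D p)
      (frag_of [induced C (under1 D p), induced C (over1 D p)]))"
    using crossing_colours(8,9)[OF assms[unfolded c]] by (intro sum.cong refl) (simp add: mu_basis_def c)
  finally show ?thesis by (simp add: W_LB_def W_SB_weight mu_quot_cls)
qed

text \<open>The boundary of (x, a, b) has four terms, each consisting of the colour of the negative
  side and the colour of one of the four semi-arcs at the crossing. It is therefore the combination
  d of a single function T of semi-arcs, whose signed sum over the crossings is zero.\<close>

lemma weight_cycle:
  assumes "C \<in> Col_SB B us os X act D"
  shows "frag_extend (sb_bd_basis us os act) (weight C) = 0"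
proof -
  obtain CS CR where c: "C = (CS, CR)" by (cases C)
  define T where "T s = frag_of (CR (neg_side s), [CS s])" for s
  define d where "d p = T (under1 D p) - T (under2 D p) + T (over2 D p) - T (over1 D p)" for p
  have "frag_extend (sb_bd_basis us os act) (weight C)
      = (\<Sum>p\<in>crossings D. frag_cmul (cr_sign D p)
          (sb_bd_basis us os act (CR (cr_region D p), [CS (under1 D p), CS (over1 D p)])))"
    by (simp add: weight_def c frag_extend_sum[OF finite_crossings] frag_extend_cmul o_def)
  also have "\<dots> = (\<Sum>p\<in>crossings D. if under_dir D p \<bullet> normal (over_dir D p) > 0 then d p else - d p)"
  proof (intro sum.cong refl)
    fix p assume p: "p \<in> crossings D"
    have "sb_bd_basis us os act (CR (cr_region D p), [CS (under1 D p), CS (over1 D p)]) = d p"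
      using crossing_colours(4-7)[OF assms[unfolded c] p] crossing_arcs(6,7)[OF p]
      by (simp add: sb_bd_2 d_def T_def)
    then show "frag_cmul (cr_sign D p) (sb_bd_basis us os act (CR (cr_region D p), [CS (under1 D p), CS (over1 D p)]))
        = (if under_dir D p \<bullet> normal (over_dir D p) > 0 then d p else - d p)"
      by (simp add: cr_sign_def)
  qed
  also have "\<dots> = 0" unfolding d_def by (rule crossing_sum_zero)
  finally show ?thesis .
qed

lemma W_SB_kernel:
  assumes "C \<in> Col_SB B us os X act D"
  shows "W_SB B X D C \<in> kernel (C_SB B X 2) (C_SB B X 1) (bd_SB B us os X act 2)"
  unfolding W_SB_weight by (rule cycle_in_kernel[OF weight_basis[OF assms] weight_cycle[OF assms]])

lemma W_SB_carrier: "C \<in> Col_SB B us os X act D \<Longrightarrow> W_SB B X D C \<in> carrier (C_SB B X 2)"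
  using W_SB_kernel by (simp add: kernel_def)

lemma Hinv_LB_eq: "Hinv_LB X br D =\<^sub>m mset_map (mu_star X act br 2) (Hinv_SB B us os X act D)"
  by (rule mset_eqI(2)[of induced])
    (simp_all add: Hinv_LB_def Hinv_SB_def mset_map_def induced_bij W_LB_induced mu_star_cls(1) W_SB_carrier)

text \<open>The same bijection \<open>induced\<close> serves; the classes can be pulled back because
  weights are cycles.\<close>

lemma Hinv_SB_eq:
  "mset_map (inv_into (carrier (H_SB B us os X act 2)) (mu_star X act br 2)) (Hinv_LB X br D)
     =\<^sub>m Hinv_SB B us os X act D"
  by (rule mset_eqI(2)[of induced])
    (simp_all add: Hinv_LB_def Hinv_SB_def mset_map_def induced_bij W_LB_induced inv_mu_star_cls[OF W_SB_kernel])

lemma Phi_eq: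
  assumes "\<And>c. c \<in> carrier (C_SB B X 2) \<Longrightarrow> \<theta> c = \<theta>' (mu X act 2 c)"
  shows "Phi_SB B us os X act \<theta> D =\<^sub>m Phi_LB X br \<theta>' D"
  by (rule mset_eqI(1)[of induced])
    (simp_all add: Phi_LB_def Phi_SB_def induced_bij W_LB_induced assms W_SB_carrier)

end

theorem theorem4p6:
  fixes L D :: edges
    and B :: "'b set" and us os :: "'b \<Rightarrow> 'b \<Rightarrow> 'b"
    and X :: "'x set" and act :: "'x \<Rightarrow> 'b \<Rightarrow> 'x"
    and br :: "'x \<Rightarrow> 'x \<Rightarrow> 'x \<Rightarrow> 'x"
    and A :: "('a, 'm) monoid_scheme"
  assumes "oriented_link L"
    and "diagram_of D L" and "connected_diagram D"
    and "shadow_biquandle B us os X act" and "strongly_connected B X act"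
    and "br = shadow_bracket B os act"
  shows "Hinv_LB X br D =\<^sub>m mset_map (mu_star X act br 2) (Hinv_SB B us os X act D) \<and>
         mset_map (inv_into (carrier (H_SB B us os X act 2)) (mu_star X act br 2)) (Hinv_LB X br D)
           =\<^sub>m Hinv_SB B us os X act D \<and>
         (\<forall>\<theta> \<theta>'. comm_group A \<longrightarrow>
            \<theta> \<in> Z_SB B us os X act 2 A \<longrightarrow> \<theta>' \<in> Z_LB X br 2 A \<longrightarrow>
            (\<forall>c \<in> carrier (C_SB B X 2). \<theta> c = \<theta>' (mu X act 2 c)) \<longrightarrow>
            Phi_SB B us os X act \<theta> D =\<^sub>m Phi_LB X br \<theta>' D)"
proof -
  interpret coloured_diagram B us os X act D
    by unfold_locales (use assms in \<open>simp_all add: diagram_of_def connected_diagram_def\<close>)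
  show ?thesis
    unfolding assms(6) using Hinv_LB_eq Hinv_SB_eq Phi_eq by blast
qed

end
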